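(* Consider the one-parameter family of differential equations $$\frac{d^2z}{d\varphi^2}+\rho(z)=\frac1{K^2}\Psi(z)$$ on an interval $(a,b)\subset\mathbb{R}$ with parameter $K\in\mathbb{R}\setminus\{0\}$, where $\Psi=\Psi(z)$ and $\rho=\rho(z)$ are $C^\infty$ functions on $(a,b)$. If $\Psi$ is semilocally $\rho$-closing (or $\rho$-closing, or strongly or weakly $\rho$-closing), then it is locally $\rho$-closing. Suppose that $\rho$ has no zeros on $(a,b)$. Then on $(a,b)$ the classes of closing, semilocally closing, locally closing, strongly closing and weakly closing functions $\Psi$ for $\rho$ coincide; moreover, there exist at most two closing functions $\Psi(z)$ up to a positive multiplicative constant, and they are determined by the following conditions: (a) if $\rho'|_{(a,b)}=\mathrm{const}>0$, then there exist exactly two (up to a positive multiplicative constant) $\rho$-closing functions $\Psi$ on $(a,b)$, namely $\Psi_i(z)=A_i/\rho^{i^2-1}(z)$, $i=1,2$, where $A_i\ne0$ is an arbitrary multiplicative constant such that $A_i\rho^i(z)>0$; the minimal positive period of any bounded nonconstant solution equals $\Phi_i=2\pi/(i\sqrt{\rho'})$; (b) if $\rho|_{(a,b)}$ is a rational function of the form $\rho(z)=\frac{(z-\zeta)^4+D}{\mu^2(z-\zeta)^3}$, where $D=\mathrm{const}\ne0$, $\mu=\mathrm{const}>0$, $\zeta=\mathrm{const}\notin(a,b)$, then there exists a unique (up to a positive multiplicative constant) $\rho$-closing function on $(a,b)$: $\Psi(z)=\Psi_2(z)=\frac{A}{(z-\zeta)^3}$, where $A\ne0$ is an arbitrary multiplicative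 constant such that $A((z-\zeta)^4+D)>0$; the minimal positive period of any bounded nonconstant solution equals $\Phi=\pi\mu$; (c) if $\rho(z)$ has none of the forms indicated above, then there are no $\rho$-closing functions on $(a,b)$. In cases (a) and (b) every point $z\in(a,b)$ is a nondegenerate stable equilibrium of the equation for $K=K_i:=\pm\sqrt{A_i/\rho^{i^2}(z)}$, $i=1,2$ (in case (a)), respectively for $K=\pm\mu\sqrt{\frac{A}{(z-\zeta)^4+D}}$ (in case (b)), and is not an equilibrium for other values of the parameter $K$.
   Context: A solution $z=z(\varphi)$ is bounded if it is defined for all $\varphi\in\mathbb{R}$ and its image lies in a compact subset of $(a,b)$. Writing the equation as $z''=-U'(z)$, a nondegenerate stable equilibrium is a point $z_0$ with $U'(z_0)=0$, $U''(z_0)>0$. Conditions on $\Psi$: ($\exists$) there is a parameter value $K=\hat K\ne0$ for which the equation has a bounded nonconstant solution $\hat z=\hat z(\varphi)$; ($\forall$) all bounded nonconstant solutions of the equation, for all values of $K$, are periodic functions with pairwise commensurable periods; ($\exists$)$^{\rm loc}$ there is a parameter value $K=K_0$ for which the equation has a nondegenerate stable equilibrium $z_0\in(a,b)$; ($\forall$)$^{\rm loc}$ for every pair $(K_0,z_0)\in(\mathbb{R}\setminus\{0\})\times(a,b)$ as in ($\exists$)$^{\rm loc}$ there are $\varepsilon,\delta>0$ such that all bounded nonconstant solutions $z(\varphi)$ of the equations with $K\in(K_0-\delta,K_0+\delta)$ and $z(\mathbb{R})\subseteq[z_0-\varepsilon,z_0+\varepsilon]$ are periodic with pairwise commensurable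 periods; ($\forall$)$^{\rm s-loc}$ all bounded nonconstant solutions $z(\varphi)$ of the equation with $K=\hat K$ and $z(\mathbb{R})\subseteq\hat z(\mathbb{R})$ are periodic with pairwise commensurable periods, where $\hat K,\hat z$ are from ($\exists$). $\Psi$ is called: $\rho$-closing (closing for $\rho$) if ($\exists$), ($\forall$) hold; locally $\rho$-closing if ($\exists$)$^{\rm loc}$, ($\forall$)$^{\rm loc}$ hold; semilocally $\rho$-closing if ($\exists$), ($\forall$)$^{\rm loc}$, ($\forall$)$^{\rm s-loc}$ hold; strongly (resp. weakly) $\rho$-closing if every point $z_0\in(a,b)$ is a nondegenerate stable (resp. stable) equilibrium of the equation for some $K=K_0$ depending on $z_0$, and condition ($\forall$)$^{\rm loc}$ holds (resp. its analogue for every pair $(K_0,z_0)\in(\mathbb{R}\setminus\{0\})\times(a,b)$ such that $z_0$ is a stable equilibrium of the equation for $K=K_0$). *)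

theory Defs
  imports "HOL-Analysis.Analysis" "HOL-Library.Periodic_Fun"
begin

text \<open>
  Throughout, \<open>I\<close> is the open interval \<open>(a,b)\<close>. Functions on \<open>I\<close> are total functions on the
  reals whose values outside \<open>I\<close> are never used.
\<close>

definition C_infinity_on :: "real set \<Rightarrow> (real \<Rightarrow> real) \<Rightarrow> bool" where
  "C_infinity_on I f \<longleftrightarrow> (\<forall>n. \<forall>x\<in>I. (deriv ^^ n) f field_differentiable (at x))"

text \<open>The equation \<open>z'' + \<rho>(z) = \<Psi>(z) / K\<^sup>2\<close> on the time interval \<open>J\<close>, with velocity \<open>v = z'\<close>.\<close>

definition solves_ode_on ::
  "real set \<Rightarrow> real set \<Rightarrow> (real \<Rightarrow> real) \<Rightarrow> (real \<Rightarrow> real) \<Rightarrow> real \<Rightarrow> (real \<Rightarrow> real) \<Rightarrow> (real \<Rightarrow> real) \<Rightarrow> bool"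
where
  "solves_ode_on J I \<rho> \<Psi> K z v \<longleftrightarrow>
     (\<forall>t\<in>J. z t \<in> I \<and> (z has_real_derivative v t) (at t within J) \<and>
        (\<exists>w. (v has_real_derivative w) (at t within J) \<and> w + \<rho> (z t) = 1 / K\<^sup>2 * \<Psi> (z t)))"

definition bounded_nonconstant_solution ::
  "real set \<Rightarrow> (real \<Rightarrow> real) \<Rightarrow> (real \<Rightarrow> real) \<Rightarrow> real \<Rightarrow> (real \<Rightarrow> real) \<Rightarrow> bool" where
  "bounded_nonconstant_solution I \<rho> \<Psi> K z \<longleftrightarrow>
     (\<exists>v. solves_ode_on UNIV I \<rho> \<Psi> K z v) \<and>
     (\<exists>C. compact C \<and> C \<subseteq> I \<and> range z \<subseteq> C) \<and>
     \<not> z constant_on UNIV"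

definition is_period :: "(real \<Rightarrow> real) \<Rightarrow> real \<Rightarrow> bool" where
  "is_period z T \<longleftrightarrow> T > 0 \<and> periodic_fun_simple z T"

definition is_minimal_period :: "(real \<Rightarrow> real) \<Rightarrow> real \<Rightarrow> bool" where
  "is_minimal_period z T \<longleftrightarrow> is_period z T \<and> (\<forall>T'. is_period z T' \<longrightarrow> T \<le> T')"

definition periodic_commensurable :: "(real \<Rightarrow> real) set \<Rightarrow> bool" where
  "periodic_commensurable S \<longleftrightarrow>
     (\<forall>z\<in>S. \<exists>T. is_period z T) \<and>
     (\<forall>z\<^sub>1\<in>S. \<forall>z\<^sub>2\<in>S. \<forall>T\<^sub>1 T\<^sub>2. is_period z\<^sub>1 T\<^sub>1 \<and> is_period z\<^sub>2 T\<^sub>2 \<longrightarrow> T\<^sub>1 / T\<^sub>2 \<in> \<rat>)"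

text \<open>The function \<open>U'\<close>, where the equation is written as \<open>z'' = - U'(z)\<close>.\<close>

definition potential_deriv ::
  "(real \<Rightarrow> real) \<Rightarrow> (real \<Rightarrow> real) \<Rightarrow> real \<Rightarrow> real \<Rightarrow> real" where
  "potential_deriv \<rho> \<Psi> K = (\<lambda>z. \<rho> z - 1 / K\<^sup>2 * \<Psi> z)"

definition equilibrium ::
  "real set \<Rightarrow> (real \<Rightarrow> real) \<Rightarrow> (real \<Rightarrow> real) \<Rightarrow> real \<Rightarrow> real \<Rightarrow> bool" where
  "equilibrium I \<rho> \<Psi> K z\<^sub>0 \<longleftrightarrow> z\<^sub>0 \<in> I \<and> potential_deriv \<rho> \<Psi> K z\<^sub>0 = 0"

definition nondeg_stable_equilibrium ::
  "real set \<Rightarrow> (real \<Rightarrow> real) \<Rightarrow> (real \<Rightarrow> real) \<Rightarrow> real \<Rightarrow> real \<Rightarrow> bool" where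
  "nondeg_stable_equilibrium I \<rho> \<Psi> K z\<^sub>0 \<longleftrightarrow>
     equilibrium I \<rho> \<Psi> K z\<^sub>0 \<and> deriv (potential_deriv \<rho> \<Psi> K) z\<^sub>0 > 0"

text \<open>
  Lyapunov stability in the phase plane \<open>(z, z')\<close>. Quantifying over solutions on all
  \<open>[0,T)\<close> covers solutions that leave \<open>I\<close> in finite time; a solution that stays in a compact
  subset of \<open>I\<close> with bounded velocity extends to \<open>[0,\<infinity>)\<close>.
\<close>

definition stable_equilibrium ::
  "real set \<Rightarrow> (real \<Rightarrow> real) \<Rightarrow> (real \<Rightarrow> real) \<Rightarrow> real \<Rightarrow> real \<Rightarrow> bool" where
  "stable_equilibrium I \<rho> \<Psi> K z\<^sub>0 \<longleftrightarrow>
     equilibrium I \<rho> \<Psi> K z\<^sub>0 \<and>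
     (\<forall>\<epsilon>>0. \<exists>\<delta>>0. \<forall>T>0. \<forall>z v.
        solves_ode_on {0..<T} I \<rho> \<Psi> K z v \<and> dist (z 0, v 0) (z\<^sub>0, 0) < \<delta> \<longrightarrow>
        (\<forall>t\<in>{0..<T}. dist (z t, v t) (z\<^sub>0, 0) < \<epsilon>))"

definition cond_all ::
  "real set \<Rightarrow> (real \<Rightarrow> real) \<Rightarrow> (real \<Rightarrow> real) \<Rightarrow> bool" where
  "cond_all I \<rho> \<Psi> \<longleftrightarrow>
     periodic_commensurable {z. \<exists>K. K \<noteq> 0 \<and> bounded_nonconstant_solution I \<rho> \<Psi> K z}"

definition cond_ex_loc ::
  "real set \<Rightarrow> (real \<Rightarrow> real) \<Rightarrow> (real \<Rightarrow> real) \<Rightarrow> bool" where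
  "cond_ex_loc I \<rho> \<Psi> \<longleftrightarrow>
     (\<exists>K\<^sub>0 z\<^sub>0. K\<^sub>0 \<noteq> 0 \<and> nondeg_stable_equilibrium I \<rho> \<Psi> K\<^sub>0 z\<^sub>0)"

definition commensurable_near ::
  "real set \<Rightarrow> (real \<Rightarrow> real) \<Rightarrow> (real \<Rightarrow> real) \<Rightarrow> real \<Rightarrow> real \<Rightarrow> bool" where
  "commensurable_near I \<rho> \<Psi> K\<^sub>0 z\<^sub>0 \<longleftrightarrow>
     (\<exists>\<epsilon>>0. \<exists>\<delta>>0. periodic_commensurable
        {z. \<exists>K. K \<noteq> 0 \<and> K \<in> {K\<^sub>0 - \<delta> <..< K\<^sub>0 + \<delta>} \<and>
              bounded_nonconstant_solution I \<rho> \<Psi> K z \<and> range z \<subseteq> {z\<^sub>0 - \<epsilon> .. z\<^sub>0 + \<epsilon>}})"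

definition cond_all_loc ::
  "real set \<Rightarrow> (real \<Rightarrow> real) \<Rightarrow> (real \<Rightarrow> real) \<Rightarrow> bool" where
  "cond_all_loc I \<rho> \<Psi> \<longleftrightarrow>
     (\<forall>K\<^sub>0 z\<^sub>0. K\<^sub>0 \<noteq> 0 \<and> nondeg_stable_equilibrium I \<rho> \<Psi> K\<^sub>0 z\<^sub>0 \<longrightarrow>
        commensurable_near I \<rho> \<Psi> K\<^sub>0 z\<^sub>0)"

definition cond_all_loc_weak ::
  "real set \<Rightarrow> (real \<Rightarrow> real) \<Rightarrow> (real \<Rightarrow> real) \<Rightarrow> bool" where
  "cond_all_loc_weak I \<rho> \<Psi> \<longleftrightarrow>
     (\<forall>K\<^sub>0 z\<^sub>0. K\<^sub>0 \<noteq> 0 \<and> stable_equilibrium I \<rho> \<Psi> K\<^sub>0 z\<^sub>0 \<longrightarrow>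
        commensurable_near I \<rho> \<Psi> K\<^sub>0 z\<^sub>0)"

definition cond_all_semiloc ::
  "real set \<Rightarrow> (real \<Rightarrow> real) \<Rightarrow> (real \<Rightarrow> real) \<Rightarrow> real \<Rightarrow> (real \<Rightarrow> real) \<Rightarrow> bool" where
  "cond_all_semiloc I \<rho> \<Psi> K' z' \<longleftrightarrow>
     periodic_commensurable
       {z. bounded_nonconstant_solution I \<rho> \<Psi> K' z \<and> range z \<subseteq> range z'}"

definition closing ::
  "real set \<Rightarrow> (real \<Rightarrow> real) \<Rightarrow> (real \<Rightarrow> real) \<Rightarrow> bool" where
  "closing I \<rho> \<Psi> \<longleftrightarrow>
     (\<exists>K' z'. K' \<noteq> 0 \<and> bounded_nonconstant_solution I \<rho> \<Psi> K' z') \<and> cond_all I \<rho> \<Psi>"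

definition locally_closing ::
  "real set \<Rightarrow> (real \<Rightarrow> real) \<Rightarrow> (real \<Rightarrow> real) \<Rightarrow> bool" where
  "locally_closing I \<rho> \<Psi> \<longleftrightarrow> cond_ex_loc I \<rho> \<Psi> \<and> cond_all_loc I \<rho> \<Psi>"

definition semilocally_closing ::
  "real set \<Rightarrow> (real \<Rightarrow> real) \<Rightarrow> (real \<Rightarrow> real) \<Rightarrow> bool" where
  "semilocally_closing I \<rho> \<Psi> \<longleftrightarrow>
     (\<exists>K' z'. K' \<noteq> 0 \<and> bounded_nonconstant_solution I \<rho> \<Psi> K' z' \<and>
        cond_all_semiloc I \<rho> \<Psi> K' z') \<and>
     cond_all_loc I \<rho> \<Psi>"

definition strongly_closing ::
  "real set \<Rightarrow> (real \<Rightarrow> real) \<Rightarrow> (real \<Rightarrow> real) \<Rightarrow> bool" where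
  "strongly_closing I \<rho> \<Psi> \<longleftrightarrow>
     (\<forall>z\<^sub>0\<in>I. \<exists>K\<^sub>0. K\<^sub>0 \<noteq> 0 \<and> nondeg_stable_equilibrium I \<rho> \<Psi> K\<^sub>0 z\<^sub>0) \<and>
     cond_all_loc I \<rho> \<Psi>"

definition weakly_closing ::
  "real set \<Rightarrow> (real \<Rightarrow> real) \<Rightarrow> (real \<Rightarrow> real) \<Rightarrow> bool" where
  "weakly_closing I \<rho> \<Psi> \<longleftrightarrow>
     (\<forall>z\<^sub>0\<in>I. \<exists>K\<^sub>0. K\<^sub>0 \<noteq> 0 \<and> stable_equilibrium I \<rho> \<Psi> K\<^sub>0 z\<^sub>0) \<and>
     cond_all_loc_weak I \<rho> \<Psi>"

definition pos_proportional ::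
  "real set \<Rightarrow> ((real \<Rightarrow> real) \<times> (real \<Rightarrow> real)) set" where
  "pos_proportional I = {(f, g). \<exists>c>0. \<forall>z\<in>I. g z = c * f z}"

text \<open>The closing functions on \<open>I\<close> up to a positive multiplicative constant.\<close>

definition closing_classes :: "real set \<Rightarrow> (real \<Rightarrow> real) \<Rightarrow> (real \<Rightarrow> real) set set" where
  "closing_classes I \<rho> = {\<Psi>. C_infinity_on I \<Psi> \<and> closing I \<rho> \<Psi>} // pos_proportional I"

text \<open>The two special forms of \<open>\<rho>\<close> on \<open>I\<close>.\<close>

definition const_deriv_form :: "real set \<Rightarrow> (real \<Rightarrow> real) \<Rightarrow> real \<Rightarrow> bool" where
  "const_deriv_form I \<rho> k \<longleftrightarrow> k > 0 \<and> (\<forall>z\<in>I. deriv \<rho> z = k)"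

definition rational_form :: "real set \<Rightarrow> (real \<Rightarrow> real) \<Rightarrow> real \<Rightarrow> real \<Rightarrow> real \<Rightarrow> bool" where
  "rational_form I \<rho> D \<mu> \<zeta> \<longleftrightarrow> D \<noteq> 0 \<and> \<mu> > 0 \<and> \<zeta> \<notin> I \<and>
     (\<forall>z\<in>I. \<rho> z = ((z - \<zeta>) ^ 4 + D) / (\<mu>\<^sup>2 * (z - \<zeta>) ^ 3))"

definition all_periods_equal ::
  "real set \<Rightarrow> (real \<Rightarrow> real) \<Rightarrow> (real \<Rightarrow> real) \<Rightarrow> real \<Rightarrow> bool" where
  "all_periods_equal I \<rho> \<Psi> T \<longleftrightarrow>
     (\<forall>K z. K \<noteq> 0 \<and> bounded_nonconstant_solution I \<rho> \<Psi> K z \<longrightarrow> is_minimal_period z T)"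

definition nondeg_stable_exactly_at ::
  "real set \<Rightarrow> (real \<Rightarrow> real) \<Rightarrow> (real \<Rightarrow> real) \<Rightarrow> real set \<Rightarrow> real \<Rightarrow> bool" where
  "nondeg_stable_exactly_at I \<rho> \<Psi> Ks z\<^sub>0 \<longleftrightarrow>
     (\<forall>K\<in>Ks. K \<noteq> 0 \<and> nondeg_stable_equilibrium I \<rho> \<Psi> K z\<^sub>0) \<and>
     (\<forall>K. K \<noteq> 0 \<and> K \<notin> Ks \<longrightarrow> \<not> equilibrium I \<rho> \<Psi> K z\<^sub>0)"

end

theory Submission
  imports Defs
begin

text \<open>
  With \<open>w = \<plusminus>sqrt (2 (U - U(z\<^sub>0)))\<close> as coordinate near a nondegenerate minimum \<open>z\<^sub>0\<close>, the motion
  of amplitude \<open>r\<close> is a rotation in the \<open>(w, z')\<close>-plane with period \<open>T(r) = \<integral> g(r cos \<theta>) d\<theta>\<close>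
  over a full turn, where \<open>g = dz/dw\<close>. Commensurable periods make \<open>T\<close> constant, so that its
  \<open>r\<^sup>2\<close>-coefficient vanishes: \<open>5 U'''\<^sup>2 = 3 U'' U''''\<close> at \<open>z\<^sub>0\<close>. Moving \<open>z\<^sub>0\<close> with \<open>K\<close> shows in addition
  that \<open>U''(z\<^sub>0) = \<rho>' - \<rho> \<Psi>' / \<Psi>\<close> is locally constant. Together these equations say
  \<open>3 \<Psi> \<Psi>'' = 4 \<Psi>'\<^sup>2\<close>, that is, \<open>\<Psi>\<close> to the power \<open>-1/3\<close> is affine; hence \<open>\<Psi>\<close> cannot
  vanish at a boundary point of the set of nondegenerate equilibria, and this set is all of \<open>I\<close>.
  Conversely, for the resulting \<open>\<Psi>\<close> either \<open>z\<close> or \<open>(z - \<zeta>)\<^sup>2\<close> satisfies a harmonic oscillator equation.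

  If only a bounded nonconstant solution is given, a nondegenerate minimum is found at a minimum \<open>m\<close>
  of \<open>U\<close> on its range: a common period of the solutions through \<open>m\<close> with small speed would be
  impossible if \<open>U''(m) = 0\<close>.
\<close>

section \<open>Second-order equations with a Lipschitz right-hand side\<close>

text \<open>Commensurability only places all periods in the countable set of rational multiples of
  one period. The recurring step is that a continuous real function on a connected set with values
  in such a set is constant. It is applied to the amplitude \<open>r\<close>, to the equilibrium
  \<open>x\<close> and, in a variant for crossing times, to the initial speed \<open>p\<close>.

  Two free parameters give two equations. Varying the amplitude at fixed \<open>K\<close> gives the
  fourth-order relation, because odd powers in the expansion of \<open>g\<close> average out over a
  turn. Varying \<open>K\<close> moves the equilibrium, which sits where
  \<open>K\<^sup>2 = \<Psi> / \<rho>\<close>, and gives the frequency relation, because the periods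
  tend to \<open>2 * pi / sqrt c\<close> with \<open>c = U''\<close> as the amplitude tends to 0.
  Differentiating the second relation twice removes the derivatives of \<open>\<rho>\<close> from
  the first.

  There no period function is formed: a single crossing time is followed by continuous dependence on
  the initial speed.\<close>

lemma nonneg_if_second_derivative_nonneg:
  fixes H H' H'' :: "real \<Rightarrow> real"
  assumes "H 0 = 0" "H' 0 = 0"
    and H: "\<And>t. (H has_real_derivative H' t) (at t)"
    and H': "\<And>t. (H' has_real_derivative H'' t) (at t)"
    and "\<And>t. H'' t \<ge> 0"
  shows "H t \<ge> 0"
proof -
  have mono: "H' x \<le> H' y" if "x \<le> y" for x y
    using DERIV_nonneg_imp_nondecreasing[OF that] H' assms(5) by blast
  show ?thesis
  proof (cases "t \<ge> 0")
    case True
    have "H 0 \<le> H t"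
      using DERIV_nonneg_imp_nondecreasing[OF True, of H] H mono[of 0] assms(2) by force
    then show ?thesis using assms(1) by simp
  next
    case False
    then have "H 0 \<le> H t"
      using DERIV_nonpos_imp_nonincreasing[of t 0 H] H mono[of _ 0] assms(2) by force
    then show ?thesis using assms(1) by simp
  qed
qed

text \<open>For both signs \<open>s\<close>, compare \<open>s * G\<close> with
  \<open>C * (cosh (\<alpha> * t) - 1) / \<alpha>\<^sup>2\<close>, which vanishes to first order at
  0 and has the given bound as its second derivative. The factor \<open>1 / \<alpha>\<^sup>2\<close>
  gained by integrating twice is what makes the Picard operator contract.\<close>

lemma abs_le_cosh_if_second_derivative_le_cosh:
  fixes G G1 k :: "real \<Rightarrow> real"
  assumes "\<alpha> > 0" "C \<ge> 0" "G 0 = 0" "G1 0 = 0"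
    and G: "\<And>t. (G has_real_derivative G1 t) (at t)"
    and G1: "\<And>t. (G1 has_real_derivative k t) (at t)"
    and k: "\<And>t. \<bar>k t\<bar> \<le> C * cosh (\<alpha> * t)"
  shows "\<bar>G t\<bar> \<le> C / \<alpha>\<^sup>2 * cosh (\<alpha> * t)"
proof -
  have "C * (cosh (\<alpha> * t) - 1) / \<alpha>\<^sup>2 - s * G t \<ge> 0" if s: "s = 1 \<or> s = -1" for s
  proof (rule nonneg_if_second_derivative_nonneg[where
        H = "\<lambda>t. C * (cosh (\<alpha> * t) - 1) / \<alpha>\<^sup>2 - s * G t" and H' = "\<lambda>t. C * sinh (\<alpha> * t) / \<alpha> - s * G1 t"
        and H'' = "\<lambda>t. C * cosh (\<alpha> * t) - s * k t"])
    show "((\<lambda>t. C * (cosh (\<alpha> * t) - 1) / \<alpha>\<^sup>2 - s * G t) has_real_derivative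
            C * sinh (\<alpha> * t) / \<alpha> - s * G1 t) (at t)" for t
      using \<open>\<alpha> > 0\<close>
      by (auto intro!: derivative_eq_intros G simp: field_simps power2_eq_square)
    show "((\<lambda>t. C * sinh (\<alpha> * t) / \<alpha> - s * G1 t) has_real_derivative
            C * cosh (\<alpha> * t) - s * k t) (at t)" for t
      using \<open>\<alpha> > 0\<close> by (auto intro!: derivative_eq_intros G1 simp: field_simps)
    show "C * cosh (\<alpha> * t) - s * k t \<ge> 0" for t
      using k[of t] s by auto
  qed (use assms in auto)
  from this[of 1] this[of "-1"] have "\<bar>G t\<bar> \<le> C * (cosh (\<alpha> * t) - 1) / \<alpha>\<^sup>2"
    by (auto simp: abs_le_iff)
  also have "\<dots> \<le> C / \<alpha>\<^sup>2 * cosh (\<alpha> * t)"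
    using assms(1,2) by (simp add: divide_simps algebra_simps)
  finally show ?thesis .
qed

section \<open>Antiderivatives of continuous functions\<close>

lemma antiderivative_on_real_line:
  fixes f :: "real \<Rightarrow> real"
  assumes "continuous_on UNIV f"
  obtains F where "\<And>x. (F has_real_derivative f x) (at x)" "F x0 = 0"
proof -
  have "\<exists>F. \<forall>x::real. -\<infinity> < ereal x \<longrightarrow> ereal x < \<infinity> \<longrightarrow> (F has_vector_derivative f x) (at x)"
    by (rule einterval_antiderivative) (use assms in \<open>auto simp: continuous_on_eq_continuous_at\<close>)
  then obtain F where F: "\<And>x. (F has_real_derivative f x) (at x)"
    by (auto simp: has_real_derivative_iff_has_vector_derivative)
  show thesis
    by (rule that[of "\<lambda>x. F x - F x0"]) (auto intro!: derivative_eq_intros F)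
qed

text \<open>The integrand is continued by constants beyond \<open>c\<close> and \<open>d\<close>, so
  the derivative is two-sided at the endpoints as well.\<close>

lemma antiderivative_on_interval:
  fixes f :: "real \<Rightarrow> real"
  assumes "continuous_on {c..d} f" "c \<le> d"
  obtains F where "\<And>x. x \<in> {c..d} \<Longrightarrow> (F has_real_derivative f x) (at x)" "F x0 = 0"
proof -
  have "continuous_on UNIV (\<lambda>x. f (max c (min d x)))"
    by (rule continuous_on_compose2[OF assms(1)]) (use assms(2) in \<open>auto intro!: continuous_intros\<close>)
  then obtain F where "\<And>x. (F has_real_derivative f (max c (min d x))) (at x)" "F x0 = 0"
    using antiderivative_on_real_line by metis
  moreover have "max c (min d x) = x" if "x \<in> {c..d}" for x
    using that by auto
  ultimately show thesis by (metis that)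
qed

section \<open>Solutions for all time\<close>

definition newton_solution :: "(real \<Rightarrow> real) \<Rightarrow> (real \<Rightarrow> real) \<Rightarrow> (real \<Rightarrow> real) \<Rightarrow> bool" where
  "newton_solution F z v \<longleftrightarrow>
     (\<forall>t. (z has_real_derivative v t) (at t) \<and> (v has_real_derivative F (z t)) (at t))"

text \<open>
  Picard iteration on the whole time axis: writing \<open>z(t) = z0 + v0 t + cosh(\<alpha> t) h(t)\<close> with \<open>h\<close>
  bounded, the integral operator contracts in \<open>h\<close> with factor \<open>L/\<alpha>\<^sup>2\<close>.
\<close>

lemma newton_solution_exists:
  fixes F :: "real \<Rightarrow> real"
  assumes lip: "\<And>x y. \<bar>F x - F y\<bar> \<le> L * \<bar>x - y\<bar>" and bdd: "\<And>x. \<bar>F x\<bar> \<le> M"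
  shows "\<exists>z v. newton_solution F z v \<and> z 0 = z0 \<and> v 0 = v0"
proof -
  have L0: "L \<ge> 0" using lip[of 0 1] by simp
  have M0: "M \<ge> 0" using bdd[of 0] by simp
  have contF: "continuous_on UNIV F"
    by (rule lipschitz_on_continuous_on[of L])
       (auto simp: lipschitz_on_def dist_real_def L0 lip)
  \<comment> \<open>Chosen so that \<open>L / \<alpha>\<^sup>2 \<le> 1/2\<close>; the summand 1
    keeps \<open>\<alpha>\<close> positive when \<open>L = 0\<close>.\<close>
  define \<alpha> where "\<alpha> = sqrt (2 * L + 1)"
  have \<alpha>: "\<alpha> > 0" "\<alpha>\<^sup>2 = 2 * L + 1"
    using L0 by (auto simp: \<alpha>_def)
  define k where "k h t = F (z0 + v0 * t + cosh (\<alpha> * t) * apply_bcontfun h t)" for h t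
  have contk: "continuous_on UNIV (k h)" for h
    unfolding k_def by (intro continuous_on_compose2[OF contF] continuous_intros) auto
  have "\<exists>G G1. G 0 = 0 \<and> G1 0 = 0 \<and> (\<forall>t. (G has_real_derivative G1 t) (at t)) \<and>
      (\<forall>t. (G1 has_real_derivative k h t) (at t))" for h
  proof -
    obtain G1 where G1: "\<And>t. (G1 has_real_derivative k h t) (at t)" "G1 0 = 0"
      using antiderivative_on_real_line[OF contk] by metis
    have "continuous_on UNIV G1"
      using G1(1) by (meson DERIV_isCont continuous_at_imp_continuous_on)
    then obtain G where "\<And>t. (G has_real_derivative G1 t) (at t)" "G 0 = 0"
      using antiderivative_on_real_line by metis
    with G1 show ?thesis by blast
  qed
  then obtain G G1 where G0: "\<And>h. G h 0 = 0" "\<And>h. G1 h 0 = 0"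
    and G: "\<And>h t. (G h has_real_derivative G1 h t) (at t)"
    and G1: "\<And>h t. (G1 h has_real_derivative k h t) (at t)"
    by metis
  define T where "T h = Bcontfun (\<lambda>t. G h t / cosh (\<alpha> * t))" for h
  \<comment> \<open>The bound \<open>M\<close> on the force makes the quotient by
    \<open>cosh\<close> bounded, so that the iteration stays inside \<open>bcontfun\<close>.\<close>
  have Gb: "\<bar>G h t\<bar> \<le> M / \<alpha>\<^sup>2 * cosh (\<alpha> * t)" for h t
  proof (rule abs_le_cosh_if_second_derivative_le_cosh[OF \<alpha>(1) M0 G0 G G1])
    show "\<bar>k h t\<bar> \<le> M * cosh (\<alpha> * t)" for t
      using bdd[of "z0 + v0 * t + cosh (\<alpha> * t) * apply_bcontfun h t"]
        mult_left_mono[OF cosh_real_ge_1[of "\<alpha> * t"] M0] by (simp add: k_def)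
  qed
  have T: "apply_bcontfun (T h) t = G h t / cosh (\<alpha> * t)" for h t
  proof -
    have "(\<lambda>t. G h t / cosh (\<alpha> * t)) \<in> bcontfun"
    proof (rule bcontfun_normI)
      have "continuous_on UNIV (G h)"
        using G by (meson DERIV_isCont continuous_at_imp_continuous_on)
      then show "continuous_on UNIV (\<lambda>t. G h t / cosh (\<alpha> * t))"
        by (intro continuous_intros) auto
      show "norm (G h t / cosh (\<alpha> * t)) \<le> M / \<alpha>\<^sup>2" for t
        using Gb[of h t] by (simp add: pos_divide_le_eq)
    qed
    then show ?thesis by (simp add: T_def Bcontfun_inverse)
  qed
  have "dist (T h) (T h') \<le> 1/2 * dist h h'" for h h'
  proof (rule dist_bound)
    fix t
    have "\<bar>G h t - G h' t\<bar> \<le> (L * dist h h') / \<alpha>\<^sup>2 * cosh (\<alpha> * t)"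
    proof (rule abs_le_cosh_if_second_derivative_le_cosh[OF \<alpha>(1)])
      show "((\<lambda>t. G h t - G h' t) has_real_derivative G1 h t - G1 h' t) (at t)" for t
        by (intro derivative_intros G)
      show "((\<lambda>t. G1 h t - G1 h' t) has_real_derivative k h t - k h' t) (at t)" for t
        by (intro derivative_intros G1)
      show "\<bar>k h t - k h' t\<bar> \<le> L * dist h h' * cosh (\<alpha> * t)" for t
      proof -
        have "\<bar>k h t - k h' t\<bar> \<le> L * (cosh (\<alpha> * t) * \<bar>apply_bcontfun h t - apply_bcontfun h' t\<bar>)"
          unfolding k_def by (rule order_trans[OF lip]) (simp add: abs_mult flip: right_diff_distrib)
        also have "\<dots> \<le> L * (cosh (\<alpha> * t) * dist h h')"
          using dist_bounded[of h t h'] L0 by (intro mult_left_mono) (auto simp: dist_real_def)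
        finally show ?thesis by (simp add: mult_ac)
      qed
    qed (use L0 G0 in auto)
    then have "dist (T h t) (T h' t) \<le> (L * dist h h') / \<alpha>\<^sup>2"
      by (simp add: T dist_real_def pos_divide_le_eq flip: diff_divide_distrib)
    also have "\<dots> \<le> 1/2 * dist h h'"
      using L0 by (simp add: \<alpha>(2) field_simps)
    finally show "dist (T h t) (T h' t) \<le> 1/2 * dist h h'" .
  qed
  then have "\<exists>!h. T h = h"
    by (intro banach_fix_type[of "1/2"]) auto
  then obtain h where h: "T h = h" by blast
  define z where "z t = z0 + v0 * t + G h t" for t
  have "k h t = F (z t)" for t
    using arg_cong[OF h, of "\<lambda>h. apply_bcontfun h t"] unfolding T
    by (simp add: k_def z_def field_simps)
  moreover have "(z has_real_derivative v0 + G1 h t) (at t)" for t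
    unfolding z_def by (auto intro!: derivative_eq_intros G)
  moreover have "((\<lambda>t. v0 + G1 h t) has_real_derivative k h t) (at t)" for t
    by (auto intro!: derivative_eq_intros G1)
  ultimately have "newton_solution F z (\<lambda>t. v0 + G1 h t)"
    by (simp add: newton_solution_def)
  then show ?thesis using G0 by (intro exI[of _ z] exI) (auto simp: z_def)
qed

section \<open>Dependence on initial data, uniqueness and conservation of energy\<close>

lemma newton_solution_reverse:
  assumes "newton_solution F z v"
  shows "newton_solution F (\<lambda>t. z (- t)) (\<lambda>t. - v (- t))"
  unfolding newton_solution_def
proof (intro allI conjI)
  fix t
  have z: "(z has_real_derivative v (- t)) (at (- t))"
    and v: "(v has_real_derivative F (z (- t))) (at (- t))"
    using assms by (auto simp: newton_solution_def)
  show "((\<lambda>t. z (- t)) has_real_derivative - v (- t)) (at t)"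
    using DERIV_mirror[of z "v (-t)" t] z by simp
  show "((\<lambda>t. - v (- t)) has_real_derivative F (z (- t))) (at t)"
    using DERIV_mirror[of v "F (z (-t))" t] v DERIV_minus[of "\<lambda>x. v (- x)"] by fastforce
qed

text \<open>The squared distance in the phase plane grows at most at the rate \<open>1 + L\<close>,
  since \<open>2 * x * y \<le> x\<^sup>2 + y\<^sup>2\<close> bounds both cross terms of its
  derivative. Negative times follow by reversing time.\<close>

lemma newton_solution_gronwall:
  fixes F :: "real \<Rightarrow> real"
  assumes lip: "\<And>x y. \<bar>F x - F y\<bar> \<le> L * \<bar>x - y\<bar>"
    and 1: "newton_solution F z\<^sub>1 v\<^sub>1" and 2: "newton_solution F z\<^sub>2 v\<^sub>2"
  shows "(z\<^sub>1 t - z\<^sub>2 t)\<^sup>2 + (v\<^sub>1 t - v\<^sub>2 t)\<^sup>2 \<le>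
         ((z\<^sub>1 0 - z\<^sub>2 0)\<^sup>2 + (v\<^sub>1 0 - v\<^sub>2 0)\<^sup>2) * exp ((1 + L) * \<bar>t\<bar>)"
proof -
  have L0: "L \<ge> 0" using lip[of 0 1] by simp
  have fwd: "(z\<^sub>1 t - z\<^sub>2 t)\<^sup>2 + (v\<^sub>1 t - v\<^sub>2 t)\<^sup>2 \<le>
         ((z\<^sub>1 0 - z\<^sub>2 0)\<^sup>2 + (v\<^sub>1 0 - v\<^sub>2 0)\<^sup>2) * exp ((1 + L) * t)"
    if "t \<ge> 0" and 1: "newton_solution F z\<^sub>1 v\<^sub>1" and 2: "newton_solution F z\<^sub>2 v\<^sub>2"
    for t z\<^sub>1 v\<^sub>1 z\<^sub>2 v\<^sub>2
  proof -
    define D where "D t = ((z\<^sub>1 t - z\<^sub>2 t)\<^sup>2 + (v\<^sub>1 t - v\<^sub>2 t)\<^sup>2) * exp (- ((1 + L) * t))" for t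
    have "D t \<le> D 0"
    proof (rule DERIV_nonpos_imp_nonincreasing[OF that(1)])
      fix s
      define x y w where "x = z\<^sub>1 s - z\<^sub>2 s" and "y = v\<^sub>1 s - v\<^sub>2 s" and "w = F (z\<^sub>1 s) - F (z\<^sub>2 s)"
      note d = 1[unfolded newton_solution_def, rule_format, of s]
        2[unfolded newton_solution_def, rule_format, of s]
      have "(D has_real_derivative
          (2 * x * y + 2 * y * w - (1 + L) * (x\<^sup>2 + y\<^sup>2)) * exp (- ((1 + L) * s))) (at s)"
        unfolding D_def using d
        by (auto intro!: derivative_eq_intros simp: x_def y_def w_def algebra_simps power2_eq_square)
      moreover have "2 * x * y + 2 * y * w - (1 + L) * (x\<^sup>2 + y\<^sup>2) \<le> 0"
      proof -
        have "2 * y * w \<le> 2 * \<bar>y\<bar> * (L * \<bar>x\<bar>)"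
          using lip[of "z\<^sub>1 s" "z\<^sub>2 s"] abs_ge_self[of "y * w"] mult_left_mono[of "\<bar>w\<bar>" "L * \<bar>x\<bar>" "\<bar>y\<bar>"]
          by (simp add: x_def w_def abs_mult)
        also have "\<dots> = L * (2 * \<bar>x\<bar> * \<bar>y\<bar>)" by simp
        also have "\<dots> \<le> L * (x\<^sup>2 + y\<^sup>2)"
          using sum_squares_bound[of "\<bar>x\<bar>" "\<bar>y\<bar>"] L0 by (intro mult_left_mono) auto
        finally show ?thesis
          using sum_squares_bound[of x y] by (simp add: algebra_simps)
      qed
      ultimately show "\<exists>y. (D has_real_derivative y) (at s) \<and> y \<le> 0"
        by (meson exp_ge_zero mult_nonpos_nonneg)
    qed
    then show ?thesis
      by (simp add: D_def exp_minus pos_divide_le_eq flip: divide_inverse)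
  qed
  show ?thesis
  proof (cases "t \<ge> 0")
    case True
    then show ?thesis using fwd[OF _ 1 2] by simp
  next
    case False
    then show ?thesis
      using fwd[OF _ newton_solution_reverse[OF 1] newton_solution_reverse[OF 2], of "-t"]
      by (simp add: power2_commute[of "v\<^sub>2 _"] power2_commute[of "v\<^sub>2 0"] power2_eq_iff)
  qed
qed

lemma newton_solution_dependence:
  fixes F :: "real \<Rightarrow> real"
  assumes "\<And>x y. \<bar>F x - F y\<bar> \<le> L * \<bar>x - y\<bar>"
    and "newton_solution F z\<^sub>1 v\<^sub>1" "newton_solution F z\<^sub>2 v\<^sub>2" "z\<^sub>1 0 = z\<^sub>2 0"
  shows "\<bar>z\<^sub>1 t - z\<^sub>2 t\<bar> \<le> \<bar>v\<^sub>1 0 - v\<^sub>2 0\<bar> * exp ((1 + L) * \<bar>t\<bar> / 2)"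
    and "\<bar>v\<^sub>1 t - v\<^sub>2 t\<bar> \<le> \<bar>v\<^sub>1 0 - v\<^sub>2 0\<bar> * exp ((1 + L) * \<bar>t\<bar> / 2)"
proof -
  have "(z\<^sub>1 t - z\<^sub>2 t)\<^sup>2 + (v\<^sub>1 t - v\<^sub>2 t)\<^sup>2 \<le> (v\<^sub>1 0 - v\<^sub>2 0)\<^sup>2 * exp ((1 + L) * \<bar>t\<bar>)"
    using newton_solution_gronwall[OF assms(1-3), of t] assms(4) by simp
  also have "\<dots> = (\<bar>v\<^sub>1 0 - v\<^sub>2 0\<bar> * exp ((1 + L) * \<bar>t\<bar> / 2))\<^sup>2"
    by (simp add: power_mult_distrib flip: exp_double)
  finally have *: "\<bar>z\<^sub>1 t - z\<^sub>2 t\<bar>\<^sup>2 + \<bar>v\<^sub>1 t - v\<^sub>2 t\<bar>\<^sup>2 \<le> (\<bar>v\<^sub>1 0 - v\<^sub>2 0\<bar> * exp ((1 + L) * \<bar>t\<bar> / 2))\<^sup>2"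
    by simp
  have nn: "\<bar>z\<^sub>1 t - z\<^sub>2 t\<bar>\<^sup>2 \<ge> 0" "\<bar>v\<^sub>1 t - v\<^sub>2 t\<bar>\<^sup>2 \<ge> 0" "\<bar>v\<^sub>1 0 - v\<^sub>2 0\<bar> * exp ((1 + L) * \<bar>t\<bar> / 2) \<ge> 0"
    by auto
  show "\<bar>z\<^sub>1 t - z\<^sub>2 t\<bar> \<le> \<bar>v\<^sub>1 0 - v\<^sub>2 0\<bar> * exp ((1 + L) * \<bar>t\<bar> / 2)"
    using * nn by - (rule power2_le_imp_le, linarith, linarith)
  show "\<bar>v\<^sub>1 t - v\<^sub>2 t\<bar> \<le> \<bar>v\<^sub>1 0 - v\<^sub>2 0\<bar> * exp ((1 + L) * \<bar>t\<bar> / 2)"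
    using * nn by - (rule power2_le_imp_le, linarith, linarith)
qed

lemma newton_solution_unique:
  fixes F :: "real \<Rightarrow> real"
  assumes "\<And>x y. \<bar>F x - F y\<bar> \<le> L * \<bar>x - y\<bar>"
    and "newton_solution F z\<^sub>1 v\<^sub>1" "newton_solution F z\<^sub>2 v\<^sub>2" "z\<^sub>1 0 = z\<^sub>2 0" "v\<^sub>1 0 = v\<^sub>2 0"
  shows "z\<^sub>1 t = z\<^sub>2 t"
  using newton_solution_dependence(1)[OF assms(1-4), of t] assms(5) by simp

lemma newton_solution_shift:
  assumes "newton_solution F z v"
  shows "newton_solution F (\<lambda>t. z (t + s)) (\<lambda>t. v (t + s))"
  unfolding newton_solution_def
proof (intro allI conjI)
  fix t
  have *: "(z has_real_derivative v (t + s)) (at (t + s))"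
    "(v has_real_derivative F (z (t + s))) (at (t + s))"
    using assms by (auto simp: newton_solution_def)
  show "((\<lambda>t. z (t + s)) has_real_derivative v (t + s)) (at t)"
    using *(1) unfolding DERIV_shift .
  show "((\<lambda>t. v (t + s)) has_real_derivative F (z (t + s))) (at t)"
    using *(2) unfolding DERIV_shift .
qed

lemma newton_solution_energy:
  assumes z: "newton_solution F z v" and V: "\<And>x. (V has_real_derivative - F x) (at x)"
  shows "(v t)\<^sup>2 / 2 + V (z t) = (v s)\<^sup>2 / 2 + V (z s)"
proof -
  have "((\<lambda>t. (v t)\<^sup>2 / 2 + V (z t)) has_real_derivative 0) (at t)" for t
  proof -
    have "(z has_real_derivative v t) (at t)" "(v has_real_derivative F (z t)) (at t)"
      using z by (auto simp: newton_solution_def)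
    moreover have "((\<lambda>t. V (z t)) has_real_derivative - F (z t) * v t) (at t)"
      by (rule DERIV_chain2[OF V calculation(1)])
    ultimately show ?thesis
      by (auto intro!: derivative_eq_intros)
  qed
  then show ?thesis
    using DERIV_isconst_all[of "\<lambda>t. (v t)\<^sup>2 / 2 + V (z t)" t s] by blast
qed

text \<open>The rational multiples of \<open>T\<close> are countable, an interval is not. This is
  the device that turns commensurability into constancy: an interval of periods would contain a
  value incommensurable with \<open>T\<close>.\<close>

lemma irrational_multiple_between:
  fixes a b T :: real
  assumes "a < b" "T \<noteq> 0"
  obtains s where "a < s" "s < b" "s / T \<notin> \<rat>"
proof -
  have "{s. s / T \<in> \<rat>} \<subseteq> (\<lambda>q. q * T) ` \<rat>"
  proof
    fix s assume "s \<in> {s. s / T \<in> \<rat>}"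
    then show "s \<in> (\<lambda>q. q * T) ` \<rat>"
      using assms by (intro image_eqI[of _ _ "s / T"]) auto
  qed
  then have "countable {s. s / T \<in> \<rat>}"
    using countable_rat by (meson countable_image countable_subset)
  then have "\<not> {a<..<b} \<subseteq> {s. s / T \<in> \<rat>}"
    using assms uncountable_open_interval countable_subset by blast
  then obtain s where "s \<in> {a<..<b}" "s / T \<notin> \<rat>" by blast
  then show thesis using that by auto
qed
section \<open>Existence of a nondegenerate minimum\<close>

text \<open>Clamping the argument to \<open>{c..d}\<close> makes the force bounded and Lipschitz on
  the whole line, so its solutions exist for all time. While a solution stays in
  \<open>{c..d}\<close>, it solves the original equation.\<close>

lemma clamped_lipschitz:
  fixes f :: "real \<Rightarrow> real"
  assumes "c \<le> d" and f: "\<And>x. x \<in> {c..d} \<Longrightarrow> (f has_real_derivative f' x) (at x)"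
    and f': "continuous_on {c..d} f'"
  obtains L M where "\<And>x y. \<bar>f (max c (min d x)) - f (max c (min d y))\<bar> \<le> L * \<bar>x - y\<bar>"
    "\<And>x. \<bar>f (max c (min d x))\<bar> \<le> M"
proof -
  have "bounded (f' ` {c..d})"
    using compact_continuous_image[OF f'] compact_imp_bounded by auto
  then obtain L where L: "\<And>x. x \<in> {c..d} \<Longrightarrow> \<bar>f' x\<bar> \<le> L"
    unfolding bounded_iff by (metis imageI real_norm_def)
  have contf: "continuous_on {c..d} f"
    using f by (meson DERIV_isCont continuous_at_imp_continuous_on)
  then have "bounded (f ` {c..d})"
    using compact_continuous_image compact_imp_bounded by blast
  then obtain M where M: "\<And>x. x \<in> {c..d} \<Longrightarrow> \<bar>f x\<bar> \<le> M"
    unfolding bounded_iff by (metis imageI real_norm_def)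
  have cl: "max c (min d x) \<in> {c..d}" for x
    using assms(1) by auto
  have "L \<ge> 0" using L[of c] assms(1) by (smt (verit) atLeastAtMost_iff)
  have "\<bar>f (max c (min d x)) - f (max c (min d y))\<bar> \<le> L * \<bar>x - y\<bar>" for x y
  proof -
    have "norm (f (max c (min d x)) - f (max c (min d y))) \<le> L * norm (max c (min d x) - max c (min d y))"
      by (rule field_differentiable_bound[of "{c..d}" f f'])
         (use f L cl in \<open>auto intro: DERIV_subset\<close>)
    also have "\<dots> \<le> L * \<bar>x - y\<bar>"
      using \<open>L \<ge> 0\<close> by (intro mult_left_mono) (auto simp: max_def min_def)
    finally show ?thesis by simp
  qed
  then show thesis using M cl that by blast
qed

text \<open>
  \<open>Z p\<close> is the solution that starts at the minimum \<open>m\<close> with speed \<open>p\<close>; by conservation of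
  energy, each time at which it passes \<open>m\<close> with positive speed is a period. A period \<open>\<tau>\<close> of
  one of these solutions is a period of all of them: a crossing time that moved with \<open>p\<close> would attain
  values that are not rational multiples of \<open>\<tau>\<close>.
\<close>

lemma commensurable_imp_nondegenerate_minimum:
  fixes f f' zh vh :: "real \<Rightarrow> real"
  assumes "c < d"
    and f: "\<And>x. x \<in> {c..d} \<Longrightarrow> (f has_real_derivative f' x) (at x)"
    and f': "continuous_on {c..d} f'"
    and zh: "\<And>t. zh t \<in> {c..d}" "\<And>t. (zh has_real_derivative vh t) (at t)"
      "\<And>t. (vh has_real_derivative - f (zh t)) (at t)"
    and ends: "zh ta = c" "zh tb = d"
    and comm: "periodic_commensurable S"
    and S: "\<And>z v. (\<forall>t. z t \<in> {c..d} \<and> (z has_real_derivative v t) (at t) \<and>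
        (v has_real_derivative - f (z t)) (at t)) \<Longrightarrow> \<not> z constant_on UNIV \<Longrightarrow> z \<in> S"
  shows "\<exists>m. c < m \<and> m < d \<and> f m = 0 \<and> f' m > 0"
proof -
  define F where "F x = - f (max c (min d x))" for x
  have F: "F x = - f x" if "x \<in> {c..d}" for x
    using that by (auto simp: F_def)
  obtain L M where L: "\<And>x y. \<bar>F x - F y\<bar> \<le> L * \<bar>x - y\<bar>" and M: "\<And>x. \<bar>F x\<bar> \<le> M"
  proof -
    obtain L M where "\<And>x y. \<bar>f (max c (min d x)) - f (max c (min d y))\<bar> \<le> L * \<bar>x - y\<bar>"
      "\<And>x. \<bar>f (max c (min d x))\<bar> \<le> M"
      using clamped_lipschitz[OF less_imp_le[OF \<open>c < d\<close>] f f'] by metis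
    then show thesis
      by (intro that[of L M]) (auto simp: F_def abs_minus_commute)
  qed
  have L0: "L \<ge> 0" using L[of 0 1] by simp
  have M0: "M \<ge> 0" using M[of 0] by simp
  have contF: "continuous_on UNIV F"
    by (rule lipschitz_on_continuous_on[of L]) (auto simp: lipschitz_on_def dist_real_def L0 L)
  obtain V where V: "\<And>x. (V has_real_derivative - F x) (at x)"
    using antiderivative_on_real_line[of "\<lambda>x. - F x"] continuous_on_minus[OF contF] by metis
  have zhF: "newton_solution F zh vh"
    using zh by (auto simp: newton_solution_def F)
  \<comment> \<open>\<open>zh\<close> has an extremum at \<open>ta\<close> and at \<open>tb\<close>.
    With zero velocity there, conservation of energy puts both ends of the range at the same height
    of the potential.\<close>
  have vh0: "vh ta = 0" "vh tb = 0"
    using DERIV_local_min[OF zh(2)[of ta], of 1] DERIV_local_max[OF zh(2)[of tb], of 1] zh(1) ends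
    by auto
  have Ecd: "V c = V d"
    using newton_solution_energy[OF zhF V, of ta tb] vh0 ends by simp
  have "\<exists>t. vh t \<noteq> 0"
    using DERIV_isconst_all[of zh ta tb] zh(2) ends \<open>c < d\<close> by force
  then obtain t1 where "vh t1 \<noteq> 0" ..
  then have Vt1: "V (zh t1) < V c"
    using newton_solution_energy[OF zhF V, of ta t1] vh0 ends zero_less_power2[of "vh t1"] by simp
  have contV: "continuous_on A V" for A
    using V by (meson DERIV_isCont continuous_at_imp_continuous_on)
  obtain m where m: "m \<in> {c..d}" "\<And>x. x \<in> {c..d} \<Longrightarrow> V m \<le> V x"
    using continuous_attains_inf[of "{c..d}" V] contV \<open>c < d\<close> by auto
  have Vm: "V m < V c" using m(2)[OF zh(1)[of t1]] Vt1 by simp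
  then have mcd: "c < m" "m < d" using m(1) Ecd by (auto simp: less_le)
  have Vd: "(V has_real_derivative f x) (at x)" if "x \<in> {c..d}" for x
    using V[of x] F[OF that] by simp
  have fm: "f m = 0"
    by (rule DERIV_local_min[OF Vd[OF m(1)], of "min (m - c) (d - m)"])
       (use mcd m in \<open>auto simp: abs_if split: if_splits\<close>)
  have f'm: "f' m \<ge> 0"
  proof (rule ccontr)
    assume "\<not> f' m \<ge> 0"
    then obtain e where e: "e > 0" "\<And>h. h > 0 \<Longrightarrow> h < e \<Longrightarrow> f (m + h) < 0"
      using DERIV_neg_dec_right[OF f[OF m(1)]] fm by auto
    define h where "h = min (e / 2) ((d - m) / 2)"
    have h: "0 < h" "h < e" "m + h < d" using e(1) mcd by (auto simp: h_def min_def field_simps)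
    have "V (m + h) < V m"
    proof (rule DERIV_neg_imp_decreasing_open[of m "m + h" V])
      show "\<exists>y. (V has_real_derivative y) (at x) \<and> y < 0" if "m < x" "x < m + h" for x
        using Vd[of x] e(2)[of "x - m"] that h mcd by (intro exI[of _ "f x"]) auto
    qed (use h contV in auto)
    then show False using m(2)[of "m + h"] h mcd by auto
  qed
  \<comment> \<open>At this speed in \<open>m\<close> the energy would just suffice to reach the
    ends \<open>c\<close> and \<open>d\<close>; smaller speeds keep the motion strictly
    inside.\<close>
  define p0 where "p0 = sqrt (2 * (V c - V m))"
  have p0: "p0 > 0" "p0\<^sup>2 = 2 * (V c - V m)" using Vm by (auto simp: p0_def)
  have "\<forall>p. \<exists>z v. newton_solution F z v \<and> z 0 = m \<and> v 0 = p"
    using newton_solution_exists[OF L M] by blast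
  then obtain Z Y where ZY: "\<And>p. newton_solution F (Z p) (Y p)" and Z0: "\<And>p. Z p 0 = m"
    and Y0: "\<And>p. Y p 0 = p"
    by metis
  have Zd: "(Z p has_real_derivative Y p t) (at t)"
    and Yd: "(Y p has_real_derivative F (Z p t)) (at t)" for p t
    using ZY[of p] by (auto simp: newton_solution_def)
  have contZ: "continuous_on A (Z p)" for A p
    using Zd by (meson DERIV_isCont continuous_at_imp_continuous_on)
  have dep: "\<bar>Z p t - Z q t\<bar> \<le> \<bar>p - q\<bar> * exp ((1 + L) * \<bar>t\<bar> / 2)"
    "\<bar>Y p t - Y q t\<bar> \<le> \<bar>p - q\<bar> * exp ((1 + L) * \<bar>t\<bar> / 2)" for p q t
    using newton_solution_dependence[OF L ZY[of p] ZY[of q], of t] by (auto simp: Z0 Y0)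
  have "(exp ((1 + L) * \<bar>t\<bar> / 2))-lipschitz_on A (\<lambda>p. Z p t)"
    "(exp ((1 + L) * \<bar>t\<bar> / 2))-lipschitz_on A (\<lambda>p. Y p t)" for A t
    using dep[of _ t] by (simp_all add: lipschitz_on_def dist_real_def mult.commute)
  then have contp: "continuous_on A (\<lambda>p. Z p t)" "continuous_on A (\<lambda>p. Y p t)" for A t
    using lipschitz_on_continuous_on by blast+
  have energy: "(Y p t)\<^sup>2 / 2 + V (Z p t) = p\<^sup>2 / 2 + V m" for p t
    using newton_solution_energy[OF ZY[of p] V, of t 0] by (simp add: Z0 Y0)
  have range: "Z p t \<in> {c<..<d}" if "p \<in> {0<..<p0}" for p t
  proof (rule ccontr)
    assume *: "Z p t \<notin> {c<..<d}"
    have conn: "connected (range (Z p))"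
      using contZ by (intro connected_continuous_image) auto
    have mr: "m \<in> range (Z p)" using Z0[of p] by (metis rangeI)
    have "c \<in> range (Z p) \<or> d \<in> range (Z p)"
    proof (cases "Z p t \<le> c")
      case True
      then show ?thesis
        using connectedD_interval[OF conn _ mr, of "Z p t" c] mcd by auto
    next
      case False
      then show ?thesis
        using connectedD_interval[OF conn mr, of "Z p t" d] mcd * by auto
    qed
    then obtain s where "Z p s = c \<or> Z p s = d" by auto
    then have "V (Z p s) = V c" using Ecd by auto
    then have "V c \<le> p\<^sup>2 / 2 + V m"
      using energy[of p s] zero_le_power2[of "Y p s"] by linarith
    moreover have "p\<^sup>2 < p0\<^sup>2" using that by (intro power_strict_mono) auto
    ultimately show False using p0 by simp
  qed
  have nonconst: "\<not> Z p constant_on UNIV" if "p \<noteq> 0" for p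
  proof
    assume "Z p constant_on UNIV"
    then obtain k where "Z p = (\<lambda>_. k)" by (auto simp: constant_on_def)
    then have "Y p 0 = 0" using Zd[of p 0] DERIV_unique DERIV_const by metis
    with Y0 that show False by simp
  qed
  have ZS: "Z p \<in> S" if "p \<in> {0<..<p0}" for p
  proof (rule S)
    show "\<forall>t. Z p t \<in> {c..d} \<and> (Z p has_real_derivative Y p t) (at t) \<and>
        (Y p has_real_derivative - f (Z p t)) (at t)"
      using range[OF that] Zd Yd F by (metis greaterThanLessThan_iff atLeastAtMost_iff less_imp_le)
    show "\<not> Z p constant_on UNIV" using that by (intro nonconst) auto
  qed
  have period: "is_period (Z p) s" if "s > 0" "Z p s = m" "Y p s > 0" "p > 0" for p s
  proof -
    have "(Y p s)\<^sup>2 = p\<^sup>2" using energy[of p s] that by simp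
    then have "Y p s = p" using that by (simp add: power2_eq_iff)
    then have "Z p (t + s) = Z p t" for t
      using newton_solution_unique[OF L newton_solution_shift[OF ZY[of p], of s] ZY[of p], of t]
        that Z0 Y0 by simp
    then show ?thesis using that by (auto simp: is_period_def periodic_fun_simple_def)
  qed
  obtain \<tau> where \<tau>: "is_period (Z (p0 / 2)) \<tau>"
    using comm ZS[of "p0 / 2"] p0 by (auto simp: periodic_commensurable_def)
  have \<tau>0: "\<tau> > 0" using \<tau> by (simp add: is_period_def)
  have rat: "s / \<tau> \<in> \<rat>" if "p \<in> {0<..<p0}" "is_period (Z p) s" for p s
    using comm ZS[OF that(1)] ZS[of "p0/2"] p0 that(2) \<tau> unfolding periodic_commensurable_def by force
  \<comment> \<open>The speeds whose solution has \<open>\<tau>\<close> as a period, written as the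
    preimage of one point under a continuous map. The set is closed, open and nonempty, hence
    everything.\<close>
  define Q where "Q = {p \<in> {0<..<p0}. (Z p \<tau>, Y p \<tau> - p) = (m, 0)}"
  have "Q = {0<..<p0}"
  proof -
    have "closedin (top_of_set {0<..<p0}) Q"
      unfolding Q_def by (intro continuous_closedin_preimage_constant continuous_intros contp)
    moreover have "openin (top_of_set {0<..<p0}) Q"
      unfolding openin_contains_ball
    proof (intro conjI ballI)
      fix p assume "p \<in> Q"
      then have p: "0 < p" "p < p0" "Z p \<tau> = m" "Y p \<tau> = p" by (auto simp: Q_def)
      \<comment> \<open>Since the force is at most \<open>M\<close>, the velocity changes by at most
        \<open>M * \<eta> \<le> p / 4\<close> on the window of radius \<open>\<eta>\<close> around
        \<open>\<tau>\<close>, so \<open>Z p\<close> increases strictly through \<open>m\<close>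
        there. The summand 1 guards against \<open>M = 0\<close>.\<close>
      define \<eta> where "\<eta> = min (\<tau> / 2) (p / (4 * (M + 1)))"
      have \<eta>: "\<eta> > 0" "\<eta> < \<tau>" "M * \<eta> \<le> p / 4"
      proof -
        show "\<eta> > 0" "\<eta> < \<tau>" using \<tau>0 p M0 by (auto simp: \<eta>_def)
        have "M * \<eta> \<le> (M + 1) * (p / (4 * (M + 1)))"
          using M0 p \<open>\<eta> > 0\<close> by (intro mult_mono) (auto simp: \<eta>_def)
        also have "\<dots> = p / 4" using M0 by (subst nonzero_eq_divide_eq) (auto simp: field_simps)
        finally show "M * \<eta> \<le> p / 4" .
      qed
      have Yp: "Y p t \<ge> 3/4 * p" if "t \<in> {\<tau> - \<eta>..\<tau> + \<eta>}" for t
      proof -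
        have "norm (Y p t - Y p \<tau>) \<le> M * norm (t - \<tau>)"
          by (rule field_differentiable_bound[of UNIV "Y p" "\<lambda>t. F (Z p t)"]) (use Yd M in auto)
        also have "\<dots> \<le> M * \<eta>" using that M0 by (intro mult_left_mono) auto
        finally show ?thesis using p \<eta>(3) by simp
      qed
      have Zp: "Z p s < Z p t" if "\<tau> - \<eta> \<le> s" "s < t" "t \<le> \<tau> + \<eta>" for s t
      proof (rule DERIV_pos_imp_increasing[OF that(2)])
        fix x assume "s \<le> x" "x \<le> t"
        then have "Y p x > 0" using Yp[of x] that p(1) by auto
        then show "\<exists>y. (Z p has_real_derivative y) (at x) \<and> y > 0" using Zd by blast
      qed
      define B where "B = exp ((1 + L) * (\<tau> + \<eta>) / 2)"
      have B: "B > 0" by (simp add: B_def)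
      have depB: "\<bar>Z q t - Z p t\<bar> \<le> \<bar>q - p\<bar> * B" "\<bar>Y q t - Y p t\<bar> \<le> \<bar>q - p\<bar> * B"
        if "t \<in> {\<tau> - \<eta>..\<tau> + \<eta>}" for q t
      proof -
        have "exp ((1 + L) * \<bar>t\<bar> / 2) \<le> B"
          using that \<eta> L0 by (auto simp: B_def intro!: mult_left_mono)
        then have "\<bar>q - p\<bar> * exp ((1 + L) * \<bar>t\<bar> / 2) \<le> \<bar>q - p\<bar> * B"
          by (rule mult_left_mono) simp
        then show "\<bar>Z q t - Z p t\<bar> \<le> \<bar>q - p\<bar> * B" "\<bar>Y q t - Y p t\<bar> \<le> \<bar>q - p\<bar> * B"
          using dep[of q t p] by linarith+
      qed
      \<comment> \<open>A solution within distance \<open>g\<close> of \<open>Z p\<close> on the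
        window, in position and velocity, still has positive velocity and still lies on either side
        of \<open>m\<close> at the two ends of the window. \<open>B\<close> is the Lipschitz
        constant in the initial speed, so \<open>g / B\<close> is an admissible change of
        speed.\<close>
      define g where "g = min (p / 4) (min (m - Z p (\<tau> - \<eta>)) (Z p (\<tau> + \<eta>) - m))"
      have g: "g \<le> p / 4" "g \<le> m - Z p (\<tau> - \<eta>)" "g \<le> Z p (\<tau> + \<eta>) - m"
        unfolding g_def by (meson min.cobounded1 min.cobounded2 order_trans)+
      have "g > 0"
        using p Zp[of "\<tau> - \<eta>" \<tau>] Zp[of \<tau> "\<tau> + \<eta>"] \<eta> by (auto simp: g_def)
      define e where "e = g / B"
      have e: "e > 0" using \<open>g > 0\<close> B by (simp add: e_def)
      define N where "N = ball p e \<inter> {0<..<p0}"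
      have close: "\<bar>Z q t - Z p t\<bar> < g" "\<bar>Y q t - Y p t\<bar> < g"
        if "q \<in> N" "t \<in> {\<tau> - \<eta>..\<tau> + \<eta>}" for q t
      proof -
        have "\<bar>q - p\<bar> * B < g"
          using that(1) B by (simp add: N_def e_def dist_real_def abs_minus_commute pos_less_divide_eq)
        then show "\<bar>Z q t - Z p t\<bar> < g" "\<bar>Y q t - Y p t\<bar> < g"
          using depB[OF that(2), of q] by linarith+
      qed
      have Yq: "Y q t > 0" if "q \<in> N" "t \<in> {\<tau> - \<eta>..\<tau> + \<eta>}" for q t
      proof -
        show ?thesis using close(2)[OF that] Yp[OF that(2)] p(1) g(1) by linarith
      qed
      have "q \<in> Q" if q: "q \<in> N" for q
      proof -
        have "Z q (\<tau> - \<eta>) \<le> m" "m \<le> Z q (\<tau> + \<eta>)"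
          using close(1)[OF q, of "\<tau> - \<eta>"] close(1)[OF q, of "\<tau> + \<eta>"] \<eta> g by auto
        then obtain \<sigma> where \<sigma>: "\<tau> - \<eta> \<le> \<sigma>" "\<sigma> \<le> \<tau> + \<eta>" "Z q \<sigma> = m"
          using IVT'[of "Z q" "\<tau> - \<eta>" m "\<tau> + \<eta>"] contZ \<eta> by auto
        have Zq: "Z q s < Z q t" if "\<tau> - \<eta> \<le> s" "s < t" "t \<le> \<tau> + \<eta>" for s t
        proof (rule DERIV_pos_imp_increasing[OF that(2)])
          fix x assume "s \<le> x" "x \<le> t"
          then have "Y q x > 0" using Yq[OF q, of x] that by auto
          then show "\<exists>y. (Z q has_real_derivative y) (at x) \<and> y > 0" using Zd by blast
        qed
        have pN: "p \<in> N" using e p by (simp add: N_def)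
        have connN: "connected ((\<lambda>r. Z r s) ` N)" for s
          unfolding N_def by (intro connected_continuous_image contp convex_connected convex_Int) auto
        \<comment> \<open>If the crossing time \<open>\<sigma>\<close> of \<open>Z q\<close>
          differed from \<open>\<tau>\<close>, then at every time \<open>s\<close> between them one
          of \<open>Z p\<close>, \<open>Z q\<close> would be below \<open>m\<close> and the other
          above. By connectedness some speed \<open>r\<close> crosses \<open>m\<close> exactly at
          time \<open>s\<close>, so \<open>s\<close> is a period of \<open>Z r\<close> and cannot be
          an irrational multiple of \<open>\<tau>\<close>.\<close>
        have False if s: "min \<sigma> \<tau> < s" "s < max \<sigma> \<tau>" "s / \<tau> \<notin> \<rat>" for s
        proof -
          have s': "s \<in> {\<tau> - \<eta>..\<tau> + \<eta>}" using s \<sigma> \<eta> by (auto simp: min_def max_def split: if_splits)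
          have "m \<in> (\<lambda>r. Z r s) ` N"
          proof (cases "\<tau> < \<sigma>")
            case True
            then have "Z q s < m" "m < Z p s"
              using s \<sigma> Zq[of s \<sigma>] Zp[of \<tau> s] p \<eta> by auto
            then show ?thesis
              using connectedD_interval[OF connN[of s], of "Z q s" "Z p s" m] q pN by auto
          next
            case False
            then have "Z p s < m" "m < Z q s"
              using s \<sigma> Zq[of \<sigma> s] Zp[of s \<tau>] p \<eta> by auto
            then show ?thesis
              using connectedD_interval[OF connN[of s], of "Z p s" "Z q s" m] q pN by auto
          qed
          then obtain r where r: "r \<in> N" "Z r s = m" by auto
          then have "is_period (Z r) s"
            using period[of s r] Yq[OF r(1) s'] s' \<eta> by (auto simp: N_def)
          then show False using rat[of r s] r s(3) by (auto simp: N_def)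
        qed
        then have "\<not> min \<sigma> \<tau> < max \<sigma> \<tau>"
          using irrational_multiple_between[of "min \<sigma> \<tau>" "max \<sigma> \<tau>" \<tau>] \<tau>0 by (metis less_irrefl)
        then have "\<sigma> = \<tau>" by (auto simp: min_def max_def split: if_splits)
        then have "Z q \<tau> = m" "Y q \<tau> > 0"
          using \<sigma> Yq[OF q, of \<tau>] \<eta> by auto
        moreover have "(Y q \<tau>)\<^sup>2 = q\<^sup>2" using energy[of q \<tau>] \<open>Z q \<tau> = m\<close> by simp
        ultimately show ?thesis
          using q by (auto simp: Q_def N_def power2_eq_iff)
      qed
      then show "\<exists>e>0. ball p e \<inter> {0<..<p0} \<subseteq> Q"
        using e by (auto simp: N_def intro!: exI[of _ e])
    qed (auto simp: Q_def)
    moreover have "p0 / 2 \<in> Q"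
    proof -
      have per: "Z (p0 / 2) (t + \<tau>) = Z (p0 / 2) t" for t
        using \<tau> by (simp add: is_period_def periodic_fun_simple_def)
      have "((\<lambda>t. Z (p0 / 2) (t + \<tau>)) has_real_derivative Y (p0 / 2) (0 + \<tau>)) (at 0)"
        using Zd[of "p0 / 2" "0 + \<tau>"] unfolding DERIV_shift .
      then have "Y (p0 / 2) \<tau> = Y (p0 / 2) 0"
        using Zd[of "p0 / 2" 0] DERIV_unique unfolding per by fastforce
      then show ?thesis using per[of 0] p0 by (simp add: Q_def Z0 Y0)
    qed
    ultimately show ?thesis
      using connected_clopen[of "{0<..<p0}"] by (metis connected_Ioo empty_iff)
  qed
  \<comment> \<open>If the force vanished to second order at \<open>m\<close>, a sufficiently slow
    start would meet too little resistance to turn round within time \<open>\<tau>\<close>,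
    contradicting the return to \<open>m\<close> at time \<open>\<tau>\<close>.\<close>
  have "f' m \<noteq> 0"
  proof
    assume "f' m = 0"
    define B where "B = exp ((1 + L) * \<tau> / 2)"
    have B: "B \<ge> 1" using L0 \<tau>0 by (simp add: B_def)
    \<comment> \<open>On \<open>{0..\<tau>}\<close> the solution stays within \<open>p * B\<close>
      of \<open>m\<close>, so the force is at most
      \<open>e * p * B = p / (2 * (\<tau> + 1))\<close>, and less than \<open>p / 2\<close> of the
      velocity \<open>p\<close> is lost.\<close>
    define e where "e = 1 / (2 * B * (\<tau> + 1))"
    have e: "e > 0" using B \<tau>0 by (simp add: e_def)
    have "((\<lambda>x. (f x - f m) / (x - m)) \<longlongrightarrow> 0) (at m)"
      using f[OF m(1)] \<open>f' m = 0\<close> by (simp add: has_field_derivative_iff)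
    then have "\<forall>\<^sub>F x in at m. \<bar>f x / (x - m)\<bar> < e"
      using e fm by (auto simp: tendsto_iff dist_real_def)
    then obtain \<delta> where \<delta>: "\<delta> > 0" "\<And>x. x \<noteq> m \<Longrightarrow> \<bar>x - m\<bar> < \<delta> \<Longrightarrow> \<bar>f x / (x - m)\<bar> < e"
      by (auto simp: eventually_at dist_real_def)
    have fe: "\<bar>f x\<bar> \<le> e * \<bar>x - m\<bar>" if "\<bar>x - m\<bar> < \<delta>" for x
      using \<delta>(2)[of x] that fm by (cases "x = m") (auto simp: field_simps)
    define p where "p = min (p0 / 2) (\<delta> / (2 * B))"
    have p: "0 < p" "p < p0" "p * B < \<delta>"
      using p0 \<delta>(1) B by (auto simp: p_def min_def field_simps)
    have "newton_solution F (\<lambda>_. m) (\<lambda>_. 0)"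
      using F[OF m(1)] fm by (auto simp: newton_solution_def)
    then have "\<bar>Z p t - m\<bar> \<le> p * exp ((1 + L) * \<bar>t\<bar> / 2)" for t
      using newton_solution_dependence(1)[OF L ZY[of p], of "\<lambda>_. m" "\<lambda>_. 0" t] p by (simp add: Z0 Y0)
    moreover have "p * exp ((1 + L) * \<bar>t\<bar> / 2) \<le> p * B" if "t \<in> {0..\<tau>}" for t
      using that p L0 by (intro mult_left_mono) (auto simp: B_def mult_left_mono)
    ultimately have Zm: "\<bar>Z p t - m\<bar> \<le> p * B" if "t \<in> {0..\<tau>}" for t
      using that by (meson order_trans)
    have Fb: "- (p / (2 * (\<tau> + 1))) \<le> F (Z p t)" if "t \<in> {0..\<tau>}" for t
    proof -
      have "\<bar>F (Z p t)\<bar> \<le> e * \<bar>Z p t - m\<bar>"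
        using fe[of "Z p t"] Zm[OF that] p range[of p t] F[of "Z p t"] by auto
      also have "\<dots> \<le> e * (p * B)"
        using Zm[OF that] e by (intro mult_left_mono) auto
      also have "\<dots> = p / (2 * (\<tau> + 1))"
        using B by (simp add: e_def)
      finally show ?thesis by simp
    qed
    have Yp: "Y p t > 0" if "t \<in> {0..\<tau>}" for t
    proof -
      define k where "k = p / (2 * (\<tau> + 1))"
      have "Y p 0 + k * 0 \<le> Y p t + k * t"
      proof (rule DERIV_nonneg_imp_nondecreasing[of 0 t "\<lambda>t. Y p t + k * t"])
        fix s assume "0 \<le> s" "s \<le> t"
        then show "\<exists>y. ((\<lambda>t. Y p t + k * t) has_real_derivative y) (at s) \<and> 0 \<le> y"
          using Fb[of s] that
          by (intro exI[of _ "F (Z p s) + k"]) (auto intro!: derivative_eq_intros Yd simp: k_def)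
      qed (use that in auto)
      moreover have "k * t < p"
      proof -
        have "k * t \<le> k * \<tau>" using that p \<tau>0 by (intro mult_left_mono) (auto simp: k_def)
        also have "\<dots> < p" using p \<tau>0 by (simp add: k_def field_simps add_pos_pos)
        finally show ?thesis .
      qed
      ultimately show ?thesis by (simp add: Y0)
    qed
    have "Z p 0 < Z p \<tau>"
    proof (rule DERIV_pos_imp_increasing[OF \<tau>0])
      fix x assume "0 \<le> x" "x \<le> \<tau>"
      then show "\<exists>y. (Z p has_real_derivative y) (at x) \<and> y > 0" using Zd Yp[of x] by auto
    qed
    moreover have "Z p \<tau> = m" using \<open>Q = {0<..<p0}\<close> p by (auto simp: Q_def set_eq_iff)
    ultimately show False by (simp add: Z0)
  qed
  with f'm mcd fm show ?thesis by (intro exI[of _ m]) auto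
qed
section \<open>Periods of small oscillations\<close>

text \<open>\<open>\<tau>\<close> is the time at which the phase \<open>\<theta>\<close> is reached,
  and \<open>\<Theta>\<close> is its inverse function. Positivity of \<open>k\<close> makes
  \<open>\<tau>\<close> strictly increasing; periodicity of \<open>k\<close> makes every turn last
  \<open>T\<close>, which gives both surjectivity and the shift law of
  \<open>\<Theta>\<close>.\<close>

lemma phase_function_exists:
  fixes k :: "real \<Rightarrow> real"
  assumes cont: "continuous_on UNIV k" and pos: "\<And>\<theta>. k \<theta> > 0"
    and per: "\<And>\<theta>. k (\<theta> + 2 * pi) = k \<theta>"
  defines "T \<equiv> integral {0..2 * pi} k"
  obtains \<Theta> where "T > 0" "\<And>t. (\<Theta> has_real_derivative 1 / k (\<Theta> t)) (at t)"
    "\<And>t. \<Theta> (t + T) = \<Theta> t + 2 * pi"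
proof -
  obtain \<tau> where \<tau>: "\<And>\<theta>. (\<tau> has_real_derivative k \<theta>) (at \<theta>)" and \<tau>0: "\<tau> 0 = 0"
    using antiderivative_on_real_line[OF cont] by metis
  have mono: "\<tau> x < \<tau> y" if "x < y" for x y
    by (rule DERIV_pos_imp_increasing[OF that]) (use \<tau> pos in blast)
  have "(k has_integral \<tau> (2 * pi) - \<tau> 0) {0..2 * pi}"
    using \<tau> by (intro fundamental_theorem_of_calculus)
      (auto simp flip: has_real_derivative_iff_has_vector_derivative intro: DERIV_subset)
  then have T: "T = \<tau> (2 * pi)" by (simp add: T_def integral_unique \<tau>0)
  have Tpos: "T > 0" using mono[of 0 "2 * pi"] by (simp add: T \<tau>0)
  have add: "\<tau> (\<theta> + 2 * pi) = \<tau> \<theta> + T" for \<theta>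
  proof -
    have "((\<lambda>\<theta>. \<tau> (\<theta> + 2 * pi) - \<tau> \<theta>) has_real_derivative 0) (at \<theta>)" for \<theta>
    proof -
      have "((\<lambda>\<theta>. \<tau> (\<theta> + 2 * pi)) has_real_derivative k \<theta>) (at \<theta>)"
        using \<tau>[of "\<theta> + 2 * pi"] unfolding DERIV_shift per .
      then show ?thesis using DERIV_diff[OF _ \<tau>, of "\<lambda>\<theta>. \<tau> (\<theta> + 2 * pi)" "k \<theta>" \<theta>] by simp
    qed
    then have "\<tau> (\<theta> + 2 * pi) - \<tau> \<theta> = \<tau> (0 + 2 * pi) - \<tau> 0"
      using DERIV_isconst_all[of "\<lambda>\<theta>. \<tau> (\<theta> + 2 * pi) - \<tau> \<theta>" \<theta> 0] by blast
    then show ?thesis by (simp add: T \<tau>0)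
  qed
  have nT: "\<tau> (\<theta> + real n * (2 * pi)) = \<tau> \<theta> + real n * T" for n \<theta>
  proof (induction n)
    case (Suc n)
    then show ?case using add[of "\<theta> + real n * (2 * pi)"] by (simp add: algebra_simps)
  qed simp
  have contT: "isCont \<tau> x" for x using \<tau> DERIV_isCont by blast
  have surj: "\<exists>\<theta>. \<tau> \<theta> = y" for y
  proof -
    obtain n where n: "\<bar>y\<bar> < real n * T"
      using reals_Archimedean3[OF Tpos] by blast
    have "\<tau> (- (real n * (2 * pi))) = - (real n * T)"
      using nT[of "- (real n * (2 * pi))" n] by (simp add: \<tau>0)
    then have "\<tau> (- (real n * (2 * pi))) \<le> y" "y \<le> \<tau> (real n * (2 * pi))"
      using n nT[of 0 n] by (auto simp: \<tau>0)
    then show ?thesis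
      using IVT[of \<tau> "- (real n * (2 * pi))" y "real n * (2 * pi)"] contT by auto
  qed
  have inj: "\<tau> x = \<tau> y \<longleftrightarrow> x = y" for x y
    using mono[of x y] mono[of y x] by (cases x y rule: linorder_cases) auto
  obtain \<Theta> where \<Theta>: "\<And>y. \<tau> (\<Theta> y) = y" using surj by metis
  have \<Theta>': "\<Theta> (\<tau> x) = x" for x using inj \<Theta> by blast
  have "(\<Theta> has_real_derivative 1 / k (\<Theta> t)) (at t)" for t
  proof -
    have "isCont \<Theta> (\<tau> (\<Theta> t))"
      by (rule isCont_inverse_function[where d = 1]) (use \<Theta>' contT in auto)
    then have "isCont \<Theta> t" by (simp add: \<Theta>)
    then show ?thesis
      using DERIV_inverse_function[of \<tau> "k (\<Theta> t)" \<Theta> t "t - 1" "t + 1"] \<tau> pos[of "\<Theta> t"]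
      by (simp add: \<Theta> inverse_eq_divide)
  qed
  moreover have "\<Theta> (t + T) = \<Theta> t + 2 * pi" for t
    using add[of "\<Theta> t"] inj \<Theta> by metis
  ultimately show thesis using that Tpos by blast
qed

text \<open>The intermediate point in Lagrange's form of the remainder lies between
  \<open>z0\<close> and \<open>z0 + h\<close>, so continuity of \<open>diff n\<close> at
  \<open>z0\<close> yields the limit.\<close>

lemma taylor_remainder_tendsto:
  fixes f :: "real \<Rightarrow> real" and diff :: "nat \<Rightarrow> real \<Rightarrow> real"
  assumes "n > 0" "e > 0" "diff 0 = f"
    and diff: "\<And>m x. m < n \<Longrightarrow> \<bar>x - z0\<bar> \<le> e \<Longrightarrow> (diff m has_real_derivative diff (Suc m) x) (at x)"
    and cont: "isCont (diff n) z0"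
  shows "((\<lambda>h. (f (z0 + h) - (\<Sum>m<n. diff m z0 / fact m * h ^ m)) / h ^ n) \<longlongrightarrow> diff n z0 / fact n) (at 0)"
proof (rule tendstoI)
  fix \<epsilon> :: real assume "\<epsilon> > 0"
  have "isCont (\<lambda>x. diff n x / fact n) z0" using cont by (intro continuous_intros) auto
  then obtain s where s: "s > 0" "\<And>x. \<bar>x - z0\<bar> < s \<Longrightarrow> \<bar>diff n x / fact n - diff n z0 / fact n\<bar> < \<epsilon>"
    using \<open>\<epsilon> > 0\<close> unfolding continuous_at_eps_delta by (auto simp: dist_real_def)
  have "\<bar>(f (z0 + h) - (\<Sum>m<n. diff m z0 / fact m * h ^ m)) / h ^ n - diff n z0 / fact n\<bar> < \<epsilon>"
    if h: "h \<noteq> 0" "\<bar>h\<bar> < min s e" for h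
  proof -
    have "\<exists>t. (if z0 + h < z0 then z0 + h < t \<and> t < z0 else z0 < t \<and> t < z0 + h) \<and>
       f (z0 + h) = (\<Sum>m<n. (diff m z0 / fact m) * (z0 + h - z0) ^ m) + (diff n t / fact n) * (z0 + h - z0) ^ n"
      by (rule Taylor[where a = "z0 - e" and b = "z0 + e"]) (use assms h in auto)
    then obtain t where t: "if z0 + h < z0 then z0 + h < t \<and> t < z0 else z0 < t \<and> t < z0 + h"
      "f (z0 + h) = (\<Sum>m<n. diff m z0 / fact m * h ^ m) + (diff n t / fact n) * h ^ n"
      by auto
    from t(1) have th: "\<bar>t - z0\<bar> < \<bar>h\<bar>" by (auto split: if_splits)
    have "(f (z0 + h) - (\<Sum>m<n. diff m z0 / fact m * h ^ m)) / h ^ n = diff n t / fact n"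
      using h(1) by (simp add: t(2))
    then show ?thesis using s(2)[of t] th h(2) by simp
  qed
  then show "\<forall>\<^sub>F h in at 0. dist ((f (z0 + h) - (\<Sum>m<n. diff m z0 / fact m * h ^ m)) / h ^ n)
      (diff n z0 / fact n) < \<epsilon>"
    using s(1) assms(2) unfolding eventually_at dist_real_def
    by (intro exI[of _ "min s e"]) auto
qed

text \<open>If a force has the expansion
  \<open>f (z0 + h) = c * h + b * h\<^sup>2 / 2 + E h * h ^ 3\<close> and the potential has the
  corresponding one with \<open>E'\<close>, then \<open>f = c * h * Q h\<close> and
  \<open>2 * U = c * h\<^sup>2 * P h\<close>. Hence \<open>h * sqrt (P h)\<close> is
  \<open>w / sqrt c\<close> and \<open>sqrt (P h) / Q h\<close> is \<open>sqrt c * dz/dw\<close>.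
  The limit is the second-order coefficient of \<open>dz/dw\<close> in powers of \<open>w\<close>,
  up to powers of \<open>sqrt c\<close>.\<close>

lemma period_density_expansion:
  fixes b c d :: real and E E' :: "real \<Rightarrow> real"
  assumes c: "c > 0" and E: "(E \<longlongrightarrow> d / 6) (at 0)" and E': "(E' \<longlongrightarrow> d / 24) (at 0)"
  defines "P \<equiv> \<lambda>h. 1 + b * h / (3 * c) + 2 * h\<^sup>2 * E' h / c"
    and "Q \<equiv> \<lambda>h. 1 + b * h / (2 * c) + h\<^sup>2 * E h / c"
  shows "(P \<longlongrightarrow> 1) (at 0)" "(Q \<longlongrightarrow> 1) (at 0)"
    "((\<lambda>h. (sqrt (P h) / Q h - 1 + b / (3 * c) * (h * sqrt (P h))) / (h\<^sup>2 * P h)) \<longlongrightarrow>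
       (5 * b\<^sup>2 - 3 * c * d) / (24 * c\<^sup>2)) (at 0)"
proof -
  have "(P \<longlongrightarrow> 1 + b * 0 / (3 * c) + 2 * 0\<^sup>2 * (d / 24) / c) (at 0)"
    unfolding P_def using c by (intro tendsto_intros E') auto
  then show P: "(P \<longlongrightarrow> 1) (at 0)" by simp
  have "(Q \<longlongrightarrow> 1 + b * 0 / (2 * c) + 0\<^sup>2 * (d / 6) / c) (at 0)"
    unfolding Q_def using c by (intro tendsto_intros E) auto
  then show Q: "(Q \<longlongrightarrow> 1) (at 0)" by simp
  have sP: "((\<lambda>h. sqrt (P h)) \<longlongrightarrow> 1) (at 0)"
    using tendsto_real_sqrt[OF P] by simp
  \<comment> \<open>The second-order remainder in
    \<open>sqrt (P h) = 1 + b / (6 * c) * h + p h * h\<^sup>2\<close>, obtained by multiplying with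
    the conjugate sum so that its limit can be read off.\<close>
  define p where "p h = (2 * E' h / c - (b / (6 * c))\<^sup>2) / (sqrt (P h) + 1 + b / (6 * c) * h)" for h
  have p: "(p \<longlongrightarrow> (2 * (d / 24) / c - (b / (6 * c))\<^sup>2) / (1 + 1 + b / (6 * c) * 0)) (at 0)"
    unfolding p_def using c by (intro tendsto_intros E' sP) auto
  have "((\<lambda>h. (p h - E h / c + b / (3 * c) * ((b / (6 * c) + p h * h) + (b / (2 * c) + E h / c * h) * sqrt (P h)))
      / (Q h * P h)) \<longlongrightarrow>
      ((2 * (d / 24) / c - (b / (6 * c))\<^sup>2) / (1 + 1 + b / (6 * c) * 0) - (d / 6) / c +
        b / (3 * c) * ((b / (6 * c) + (2 * (d / 24) / c - (b / (6 * c))\<^sup>2) / (1 + 1 + b / (6 * c) * 0) * 0)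
           + (b / (2 * c) + d / 6 / c * 0) * 1)) / (1 * 1)) (at 0)"
    using c by (intro tendsto_intros p E sP P Q) auto
  also have "((2 * (d / 24) / c - (b / (6 * c))\<^sup>2) / (1 + 1 + b / (6 * c) * 0) - (d / 6) / c +
        b / (3 * c) * ((b / (6 * c) + (2 * (d / 24) / c - (b / (6 * c))\<^sup>2) / (1 + 1 + b / (6 * c) * 0) * 0)
           + (b / (2 * c) + d / 6 / c * 0) * 1)) / (1 * 1) = (5 * b\<^sup>2 - 3 * c * d) / (24 * c\<^sup>2)"
    using c by (simp add: field_simps power2_eq_square)
  finally have lim: "((\<lambda>h. (p h - E h / c + b / (3 * c) * ((b / (6 * c) + p h * h) + (b / (2 * c) + E h / c * h) * sqrt (P h)))
      / (Q h * P h)) \<longlongrightarrow> (5 * b\<^sup>2 - 3 * c * d) / (24 * c\<^sup>2)) (at 0)" .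
  have "((\<lambda>h. 1 + b / (6 * c) * h) \<longlongrightarrow> 1 + b / (6 * c) * 0) (at 0)"
    by (intro tendsto_intros)
  then have "\<forall>\<^sub>F h in at 0. 1 + b / (6 * c) * h > 0"
    by (rule order_tendstoD) simp
  moreover have "\<forall>\<^sub>F h in at 0. P h > 0" "\<forall>\<^sub>F h in at 0. Q h > 0"
    using order_tendstoD(1)[OF P, of 0] order_tendstoD(1)[OF Q, of 0] by auto
  moreover have "\<forall>\<^sub>F h in at (0::real). h \<noteq> 0" by (simp add: eventually_at_filter)
  ultimately have "\<forall>\<^sub>F h in at 0.
      (p h - E h / c + b / (3 * c) * ((b / (6 * c) + p h * h) + (b / (2 * c) + E h / c * h) * sqrt (P h)))
      / (Q h * P h) = (sqrt (P h) / Q h - 1 + b / (3 * c) * (h * sqrt (P h))) / (h\<^sup>2 * P h)"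
  proof eventually_elim
    case (elim h)
    define s where "s = sqrt (P h)"
    have s: "s > 0" "s\<^sup>2 = P h" using elim by (auto simp: s_def)
    have den: "s + 1 + b / (6 * c) * h > 0" using s elim by simp
    have "s\<^sup>2 - (1 + b / (6 * c) * h)\<^sup>2 = h\<^sup>2 * (2 * E' h / c - (b / (6 * c))\<^sup>2)"
      unfolding s(2) P_def using c by (simp add: field_simps power2_eq_square)
    also have "\<dots> = h\<^sup>2 * (p h * (s + 1 + b / (6 * c) * h))"
      using den by (simp add: p_def s_def)
    finally have "(s - (1 + b / (6 * c) * h)) * (s + 1 + b / (6 * c) * h) = h\<^sup>2 * p h * (s + 1 + b / (6 * c) * h)"
      by (simp add: power2_eq_square algebra_simps)
    then have "s - (1 + b / (6 * c) * h) = h\<^sup>2 * p h"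
      using den by (simp only: mult_cancel_right) simp
    then have sp: "s = 1 + b / (6 * c) * h + p h * h\<^sup>2" by (simp add: algebra_simps)
    have num: "s - Q h + b / (3 * c) * h * s * Q h =
       h\<^sup>2 * (p h - E h / c + b / (3 * c) * ((b / (6 * c) + p h * h) + (b / (2 * c) + E h / c * h) * s))"
    proof -
      have "s * Q h = 1 + h * ((b / (6 * c) + p h * h) + (b / (2 * c) + E h / c * h) * s)"
      proof -
        have "s * Q h = s + h * ((b / (2 * c) + E h / c * h) * s)"
          unfolding Q_def by (simp add: algebra_simps power2_eq_square)
        moreover have "s = 1 + h * (b / (6 * c) + p h * h)"
          using sp by (simp add: algebra_simps power2_eq_square)
        ultimately show ?thesis by (simp add: algebra_simps)
      qed
      moreover have "s - Q h = - (b / (3 * c)) * h + h\<^sup>2 * (p h - E h / c)"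
        unfolding Q_def using c by (subst sp) (simp add: field_simps power2_eq_square)
      moreover have "s - Q h + \<beta> * h * s * Q h = h\<^sup>2 * (Y + \<beta> * X)"
        if "s * Q h = 1 + h * X" "s - Q h = - \<beta> * h + h\<^sup>2 * Y" for X Y \<beta>
      proof -
        have "s - Q h + \<beta> * h * s * Q h = (s - Q h) + \<beta> * h * (s * Q h)" by simp
        also have "\<dots> = h\<^sup>2 * (Y + \<beta> * X)"
          unfolding that by (simp add: algebra_simps power2_eq_square)
        finally show ?thesis .
      qed
      ultimately show ?thesis by blast
    qed
    have "(s / Q h - 1 + b / (3 * c) * (h * s)) / (h\<^sup>2 * P h) =
       (s - Q h + b / (3 * c) * h * s * Q h) / (Q h * (h\<^sup>2 * P h))"
      using elim by (simp add: field_simps)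
    also have "\<dots> = (p h - E h / c + b / (3 * c) * ((b / (6 * c) + p h * h) + (b / (2 * c) + E h / c * h) * s)) / (Q h * P h)"
      unfolding num using elim by simp
    finally show ?case by (simp add: s_def)
  qed
  then show "((\<lambda>h. (sqrt (P h) / Q h - 1 + b / (3 * c) * (h * sqrt (P h))) / (h\<^sup>2 * P h)) \<longlongrightarrow>
       (5 * b\<^sup>2 - 3 * c * d) / (24 * c\<^sup>2)) (at 0)"
    by (rule Lim_transform_eventually[OF lim])
qed

text \<open>
  The coordinate \<open>w = sgn (z - z0) sqrt (2 U(z))\<close> turns the energy level sets into circles
  \<open>w\<^sup>2 + v\<^sup>2 = r\<^sup>2\<close>; \<open>Z\<close> is its inverse and \<open>g = Z'\<close>.
\<close>

lemma well_coordinate: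
  fixes f f1 f2 f3 :: "real \<Rightarrow> real" and z0 e c b d :: real
  assumes "e > 0"
    and f: "\<And>x. \<bar>x - z0\<bar> \<le> e \<Longrightarrow> (f has_real_derivative f1 x) (at x)"
    and f1: "\<And>x. \<bar>x - z0\<bar> \<le> e \<Longrightarrow> (f1 has_real_derivative f2 x) (at x)"
    and f2: "\<And>x. \<bar>x - z0\<bar> \<le> e \<Longrightarrow> (f2 has_real_derivative f3 x) (at x)"
    and f3: "isCont f3 z0"
    and z0: "f z0 = 0" "c = f1 z0" "c > 0" "b = f2 z0" "d = f3 z0"
  obtains R Z g where "R > 0" "Z 0 = z0" "g 0 = 1 / sqrt c"
    "\<And>w. \<bar>w\<bar> \<le> R \<Longrightarrow> \<bar>Z w - z0\<bar> \<le> e" "\<And>w. \<bar>w\<bar> \<le> R \<Longrightarrow> (Z has_real_derivative g w) (at w)"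
    "\<And>w. \<bar>w\<bar> \<le> R \<Longrightarrow> g w > 0" "\<And>w. \<bar>w\<bar> \<le> R \<Longrightarrow> f (Z w) * g w = w"
    "continuous_on {-R..R} g"
    "((\<lambda>w. (g w - 1 / sqrt c + b / (3 * c\<^sup>2) * w) / w\<^sup>2) \<longlongrightarrow>
       (5 * b\<^sup>2 - 3 * c * d) / (24 * c\<^sup>2) / (c * sqrt c)) (at 0)"
proof -
  define \<omega> where "\<omega> = sqrt c"
  have \<omega>: "\<omega> > 0" "\<omega>\<^sup>2 = c" using z0 by (auto simp: \<omega>_def)
  have contf: "continuous_on {z0 - e..z0 + e} f"
  proof -
    have "isCont f x" if "x \<in> {z0 - e..z0 + e}" for x
      using DERIV_isCont[OF f[of x]] that by (auto simp: abs_le_iff)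
    then show ?thesis by (simp add: continuous_at_imp_continuous_on)
  qed
  obtain U where U: "\<And>x. \<bar>x - z0\<bar> \<le> e \<Longrightarrow> (U has_real_derivative f x) (at x)" and U0: "U z0 = 0"
  proof (rule antiderivative_on_interval[OF contf])
    fix F assume F: "\<And>x. x \<in> {z0 - e..z0 + e} \<Longrightarrow> (F has_real_derivative f x) (at x)" "F z0 = 0"
    show thesis by (rule that[of F]) (use F in \<open>auto simp: abs_le_iff\<close>)
  qed (use \<open>e > 0\<close> in auto)
  obtain \<eta> where \<eta>: "\<eta> > 0" "\<eta> \<le> e" and fpos: "\<And>x. x \<noteq> z0 \<Longrightarrow> \<bar>x - z0\<bar> \<le> \<eta> \<Longrightarrow> f x / (x - z0) > 0"
  proof -
    have "((\<lambda>x. (f x - f z0) / (x - z0)) \<longlongrightarrow> c) (at z0)"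
      using f[of z0] z0 \<open>e > 0\<close> by (simp add: has_field_derivative_iff)
    then have "\<forall>\<^sub>F x in at z0. f x / (x - z0) > 0"
      using order_tendstoD(1)[of _ c _ 0] z0 by auto
    then obtain s where s: "s > 0" "\<And>x. x \<noteq> z0 \<Longrightarrow> \<bar>x - z0\<bar> < s \<Longrightarrow> f x / (x - z0) > 0"
      by (auto simp: eventually_at dist_real_def)
    show thesis
      by (rule that[of "min (s / 2) e"]) (use s \<open>e > 0\<close> in auto)
  qed
  have Upos: "U x > 0" if "x \<noteq> z0" "\<bar>x - z0\<bar> \<le> \<eta>" for x
  proof (cases "x > z0")
    case True
    have "U z0 < U x"
    proof (rule DERIV_pos_imp_increasing_open[OF True])
      show "\<exists>y. (U has_real_derivative y) (at s) \<and> y > 0" if "z0 < s" "s < x" for s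
        using that U[of s] fpos[of s] \<open>\<bar>x - z0\<bar> \<le> \<eta>\<close> \<eta> by (intro exI[of _ "f s"]) (auto simp: zero_less_divide_iff)
      show "continuous_on {z0..x} U"
        using U that \<eta> True by (intro continuous_at_imp_continuous_on ballI DERIV_isCont[OF U]) auto
    qed
    then show ?thesis by (simp add: U0)
  next
    case False
    then have "x < z0" using that by auto
    have "U z0 < U x"
    proof (rule DERIV_neg_imp_decreasing_open[OF \<open>x < z0\<close>])
      show "\<exists>y. (U has_real_derivative y) (at s) \<and> y < 0" if "x < s" "s < z0" for s
        using that U[of s] fpos[of s] \<open>\<bar>x - z0\<bar> \<le> \<eta>\<close> \<eta> by (intro exI[of _ "f s"]) (auto simp: zero_less_divide_iff)
      show "continuous_on {x..z0} U"
        using U that \<eta> \<open>x < z0\<close> by (intro continuous_at_imp_continuous_on ballI DERIV_isCont[OF U]) auto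
    qed
    then show ?thesis by (simp add: U0)
  qed
  define W where "W x = sgn (x - z0) * sqrt (2 * U x)" for x
  \<comment> \<open>\<open>G\<close> is \<open>dz/dw\<close> as a function of \<open>z\<close>:
    differentiating \<open>W\<^sup>2 = 2 * U\<close> gives \<open>W * W' = f\<close>. At
    \<open>z0\<close> the quotient is 0/0 and is replaced by its limit.\<close>
  define G where "G x = (if x = z0 then 1 / \<omega> else W x / f x)" for x
  define E where "E h = (f (z0 + h) - (c * h + b * h\<^sup>2 / 2)) / h ^ 3" for h
  define E' where "E' h = (U (z0 + h) - (c * h\<^sup>2 / 2 + b * h ^ 3 / 6)) / h ^ 4" for h
  have Elim: "(E \<longlongrightarrow> d / 6) (at 0)"
  proof -
    define D where "D m = (if m = 0 then f else if m = 1 then f1 else if m = 2 then f2 else f3)" for m :: nat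
    have "((\<lambda>h. (f (z0 + h) - (\<Sum>m<3. D m z0 / fact m * h ^ m)) / h ^ 3) \<longlongrightarrow> D 3 z0 / fact 3) (at 0)"
    proof (rule taylor_remainder_tendsto[OF _ \<open>e > 0\<close>])
      show "(D m has_real_derivative D (Suc m) x) (at x)" if "m < 3" "\<bar>x - z0\<bar> \<le> e" for m x
        using that f f1 f2 by (auto simp: D_def less_Suc_eq numeral_3_eq_3 numeral_2_eq_2)
    qed (use f3 in \<open>auto simp: D_def\<close>)
    then show ?thesis
      unfolding E_def by (simp add: D_def numeral_3_eq_3 z0 numeral_2_eq_2 algebra_simps)
  qed
  have E'lim: "(E' \<longlongrightarrow> d / 24) (at 0)"
  proof -
    define D where "D m = (if m = 0 then U else if m = 1 then f else if m = 2 then f1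
      else if m = 3 then f2 else f3)" for m :: nat
    have "((\<lambda>h. (U (z0 + h) - (\<Sum>m<4. D m z0 / fact m * h ^ m)) / h ^ 4) \<longlongrightarrow> D 4 z0 / fact 4) (at 0)"
    proof (rule taylor_remainder_tendsto[OF _ \<open>e > 0\<close>])
      show "(D m has_real_derivative D (Suc m) x) (at x)" if "m < 4" "\<bar>x - z0\<bar> \<le> e" for m x
      proof -
        have "m = 0 \<or> m = 1 \<or> m = 2 \<or> m = 3" using that(1) by auto
        then show ?thesis using that(2) U f f1 f2 by (auto simp: D_def)
      qed
    qed (use f3 in \<open>auto simp: D_def\<close>)
    moreover have "(\<Sum>m<4. D m z0 / fact m * h ^ m) = c * h\<^sup>2 / 2 + b * h ^ 3 / 6" for h
      by (simp add: D_def eval_nat_numeral z0 U0)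
    ultimately show ?thesis
      unfolding E'_def by (simp add: D_def z0 fact_numeral)
  qed
  define P where "P h = 1 + b * h / (3 * c) + 2 * h\<^sup>2 * E' h / c" for h
  define Q where "Q h = 1 + b * h / (2 * c) + h\<^sup>2 * E h / c" for h
  note expansion = period_density_expansion[OF z0(3) Elim E'lim, of b, folded P_def Q_def]
  have U_P: "2 * U (z0 + h) = c * h\<^sup>2 * P h" if "h \<noteq> 0" for h
    using that z0(3) by (simp add: P_def E'_def field_simps power2_eq_square power3_eq_cube power4_eq_xxxx)
  have f_Q: "f (z0 + h) = c * h * Q h" if "h \<noteq> 0" for h
    using that z0(3) by (simp add: Q_def E_def field_simps power2_eq_square power3_eq_cube)
  have W_P: "W (z0 + h) = \<omega> * h * sqrt (P h)" if "h \<noteq> 0" for h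
  proof -
    have "W (z0 + h) = sgn h * (\<omega> * \<bar>h\<bar> * sqrt (P h))"
      unfolding W_def U_P[OF that] by (simp add: real_sqrt_mult \<omega>_def)
    also have "\<dots> = \<omega> * (sgn h * \<bar>h\<bar>) * sqrt (P h)" by (simp add: mult_ac)
    finally show ?thesis by (simp only: sgn_mult_abs)
  qed
  have G_PQ: "G (z0 + h) = sqrt (P h) / Q h / \<omega>" if "h \<noteq> 0" for h
    unfolding G_def W_P[OF that] f_Q[OF that] using that \<omega> by (simp flip: \<omega>(2) add: power2_eq_square)
  have sP: "((\<lambda>h. sqrt (P h)) \<longlongrightarrow> 1) (at 0)"
    using tendsto_real_sqrt[OF expansion(1)] by simp
  have G_lim: "(G \<longlongrightarrow> 1 / \<omega>) (at z0)"
  proof -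
    have lim: "((\<lambda>h. sqrt (P h) / Q h / \<omega>) \<longlongrightarrow> 1 / 1 / \<omega>) (at 0)"
      using \<omega> by (intro tendsto_intros sP expansion(2)) auto
    have "((\<lambda>h. G (z0 + h)) \<longlongrightarrow> 1 / 1 / \<omega>) (at 0)"
      by (rule Lim_transform_eventually[OF lim]) (auto simp: eventually_at_filter G_PQ)
    then show ?thesis by (simp add: LIM_offset_zero_iff[of z0 G])
  qed
  have Gpos: "G x > 0" if "\<bar>x - z0\<bar> \<le> \<eta>" for x
    using that fpos[of x] Upos[of x] \<omega>
    by (auto simp: G_def W_def zero_less_divide_iff zero_less_mult_iff mult_less_0_iff sgn_if split: if_splits)
  have W': "(W has_real_derivative 1 / G x) (at x)" if x: "\<bar>x - z0\<bar> \<le> \<eta>" for x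
  proof (cases "x = z0")
    case True
    have "((\<lambda>h. \<omega> * sqrt (P h)) \<longlongrightarrow> \<omega> * 1) (at 0)"
      by (intro tendsto_intros sP)
    then have "((\<lambda>h. (W (z0 + h) - W z0) / h) \<longlongrightarrow> \<omega> * 1) (at 0)"
      by (rule Lim_transform_eventually) (auto simp: eventually_at_filter W_P, simp add: W_def)
    then show ?thesis using True \<omega> by (simp add: DERIV_def G_def)
  next
    case False
    define s where "s = sgn (x - z0)"
    have s: "s = 1 \<or> s = - 1" using False by (auto simp: s_def sgn_if)
    have "((\<lambda>x. s * sqrt (2 * U x)) has_real_derivative s * (f x / sqrt (2 * U x))) (at x)"
      using U[of x] Upos[OF False x] x \<eta>
      by (auto intro!: derivative_eq_intros simp: field_simps)
    moreover have "\<forall>\<^sub>F y in nhds x. s * sqrt (2 * U y) = W y"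
    proof -
      have "\<forall>\<^sub>F y in nhds x. dist y x < \<bar>x - z0\<bar>"
        using False unfolding eventually_nhds_metric by (intro exI[of _ "\<bar>x - z0\<bar>"]) auto
      then show ?thesis
        by eventually_elim (auto simp: W_def s_def sgn_if dist_real_def)
    qed
    ultimately have "(W has_real_derivative s * (f x / sqrt (2 * U x))) (at x)"
      by (simp add: DERIV_cong_ev[OF refl _ refl])
    moreover have "s * (f x / sqrt (2 * U x)) = 1 / G x"
    proof -
      have "s * (f x / sqrt (2 * U x)) = f x / (s * sqrt (2 * U x))"
        using s by auto
      then show ?thesis using False by (simp add: G_def W_def s_def)
    qed
    ultimately show ?thesis by simp
  qed
  have contW: "isCont W x" if "\<bar>x - z0\<bar> \<le> \<eta>" for x
    using DERIV_isCont[OF W'[OF that]] .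
  have Wmono: "W x < W y" if "x < y" "\<bar>x - z0\<bar> \<le> \<eta>" "\<bar>y - z0\<bar> \<le> \<eta>" for x y
  proof (rule DERIV_pos_imp_increasing[OF that(1)])
    fix s assume "x \<le> s" "s \<le> y"
    then have "\<bar>s - z0\<bar> \<le> \<eta>" using that by auto
    then show "\<exists>k. (W has_real_derivative k) (at s) \<and> k > 0"
      using W'[of s] Gpos[of s] by auto
  qed
  have W0: "W z0 = 0" by (simp add: W_def)
  \<comment> \<open>The factor 1/2 places the closed interval \<open>{-R..R}\<close> inside the open
    interval \<open>J\<close>, on which the inverse function theorem applies.\<close>
  define R where "R = min (W (z0 + \<eta>)) (- W (z0 - \<eta>)) / 2"
  have R: "R > 0" "R < W (z0 + \<eta>)" "W (z0 - \<eta>) < - R"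
    using Wmono[of z0 "z0 + \<eta>"] Wmono[of "z0 - \<eta>" z0] \<eta> W0 by (auto simp: R_def)
  define J where "J = {W (z0 - \<eta>)<..<W (z0 + \<eta>)}"
  have "\<exists>x. \<bar>x - z0\<bar> < \<eta> \<and> W x = w" if "w \<in> J" for w
  proof -
    have "\<exists>x\<ge>z0 - \<eta>. x \<le> z0 + \<eta> \<and> W x = w"
      by (rule IVT) (use that \<eta> contW in \<open>auto simp: J_def abs_le_iff\<close>)
    then obtain x where x: "z0 - \<eta> \<le> x" "x \<le> z0 + \<eta>" "W x = w" by auto
    moreover have "x \<noteq> z0 - \<eta>" "x \<noteq> z0 + \<eta>" using that x(3) by (auto simp: J_def)
    ultimately show ?thesis by (intro exI[of _ x]) auto
  qed
  then obtain Z where Z: "\<And>w. w \<in> J \<Longrightarrow> \<bar>Z w - z0\<bar> < \<eta>" "\<And>w. w \<in> J \<Longrightarrow> W (Z w) = w"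
    by metis
  have WJ: "W x \<in> J" if "\<bar>x - z0\<bar> < \<eta>" for x
    using Wmono[of "z0 - \<eta>" x] Wmono[of x "z0 + \<eta>"] that by (auto simp: J_def abs_less_iff)
  have ZW: "Z (W x) = x" if "\<bar>x - z0\<bar> < \<eta>" for x
  proof (rule ccontr)
    assume "Z (W x) \<noteq> x"
    then have "W (Z (W x)) \<noteq> W x"
      using Wmono[of x "Z (W x)"] Wmono[of "Z (W x)" x] that Z(1)[OF WJ[OF that]]
      by (cases "x < Z (W x)") auto
    then show False using Z(2)[OF WJ[OF that]] by simp
  qed
  have JR: "w \<in> J" if "\<bar>w\<bar> \<le> R" for w using that R by (auto simp: J_def)
  have contZ: "isCont Z w" if "w \<in> J" for w
  proof -
    define \<delta> where "\<delta> = (\<eta> - \<bar>Z w - z0\<bar>) / 2"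
    have "isCont Z (W (Z w))"
    proof (rule isCont_inverse_function[where d = \<delta> and f = W and x = "Z w"])
      show "\<delta> > 0" using Z(1)[OF that] by (simp add: \<delta>_def)
      fix x assume "\<bar>x - Z w\<bar> \<le> \<delta>"
      then have "\<bar>x - z0\<bar> < \<eta>" using Z(1)[OF that] unfolding \<delta>_def by (simp add: abs_if field_simps split: if_splits)
      then show "Z (W x) = x" "isCont W x" using ZW contW by auto
    qed
    then show ?thesis using Z(2)[OF that] by simp
  qed
  have Z': "(Z has_real_derivative G (Z w)) (at w)" if "w \<in> J" for w
    using DERIV_inverse_function[of W "1 / G (Z w)" Z w "W (z0 - \<eta>)" "W (z0 + \<eta>)"]
      W'[of "Z w"] Gpos[of "Z w"] Z contZ[OF that] that
    by (auto simp: J_def inverse_eq_divide less_imp_le)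
  have Z0: "Z 0 = z0" using ZW[of z0] \<eta> W0 by simp
  have contG: "isCont G x" if "\<bar>x - z0\<bar> < \<eta>" for x
  proof (cases "x = z0")
    case True
    then show ?thesis using G_lim by (simp add: isCont_def G_def)
  next
    case False
    have "isCont (\<lambda>x. W x / f x) x"
      using that False \<eta> fpos[of x] contW[of x] DERIV_isCont[OF f[of x]] by (intro continuous_intros) auto
    moreover have "\<forall>\<^sub>F y in nhds x. W y / f y = G y"
    proof -
      have "\<forall>\<^sub>F y in nhds x. y \<noteq> z0"
        using False t1_space_nhds by blast
      then show ?thesis by eventually_elim (auto simp: G_def)
    qed
    ultimately show ?thesis by (simp add: isCont_cong)
  qed
  show thesis
  proof (rule that[of R Z "\<lambda>w. G (Z w)"])
    show "R > 0" "Z 0 = z0" "G (Z 0) = 1 / sqrt c"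
      using R Z0 by (auto simp: G_def \<omega>_def)
    fix w assume w: "\<bar>w\<bar> \<le> R"
    show "\<bar>Z w - z0\<bar> \<le> e" "(Z has_real_derivative G (Z w)) (at w)" "G (Z w) > 0"
      using Z[OF JR[OF w]] Z'[OF JR[OF w]] Gpos[of "Z w"] \<eta> by auto
    show "f (Z w) * G (Z w) = w"
      using Z[OF JR[OF w]] fpos[of "Z w"] z0 W0 by (cases "Z w = z0") (auto simp: G_def)
  next
    show "continuous_on {-R..R} (\<lambda>w. G (Z w))"
    proof (intro continuous_at_imp_continuous_on ballI)
      fix w assume "w \<in> {-R..R}"
      then have "w \<in> J" using JR[of w] by auto
      then show "isCont (\<lambda>w. G (Z w)) w"
        using isCont_o2[OF contZ contG] Z(1) by blast
    qed
    define \<phi> where "\<phi> h = (sqrt (P h) / Q h - 1 + b / (3 * c) * (h * sqrt (P h))) / (h\<^sup>2 * P h)" for h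
    have "((\<lambda>w. Z w - z0) \<longlongrightarrow> Z 0 - z0) (at 0)"
      using contZ[of 0] JR[of 0] R by (intro tendsto_intros) (auto simp: isCont_def)
    then have "((\<lambda>w. Z w - z0) \<longlongrightarrow> 0) (at 0)" by (simp add: Z0)
    then have "filterlim (\<lambda>w. Z w - z0) (at 0) (at 0)"
    proof (rule filterlim_atI)
      have "\<forall>\<^sub>F w in at 0. \<bar>w\<bar> < R"
        using R by (auto simp: eventually_at intro!: exI[of _ R])
      then show "\<forall>\<^sub>F w in at 0. Z w - z0 \<noteq> 0"
        unfolding eventually_at_filter
        by eventually_elim (use Z(2) JR W0 in force)
    qed
    then have "((\<lambda>w. \<phi> (Z w - z0)) \<longlongrightarrow> (5 * b\<^sup>2 - 3 * c * d) / (24 * c\<^sup>2)) (at 0)"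
      by (rule filterlim_compose[OF expansion(3)[folded \<phi>_def]])
    then have "((\<lambda>w. \<phi> (Z w - z0) / (c * \<omega>)) \<longlongrightarrow> (5 * b\<^sup>2 - 3 * c * d) / (24 * c\<^sup>2) / (c * \<omega>)) (at 0)"
      using z0 \<omega> by (intro tendsto_divide tendsto_const) auto
    \<comment> \<open>With \<open>h = Z w - z0\<close> one has
      \<open>w = \<omega> * h * sqrt (P h)\<close>, \<open>w\<^sup>2 = c * h\<^sup>2 * P h\<close>
      and \<open>G (Z w) = sqrt (P h) / (Q h * \<omega>)\<close>, which turns the quotient in
      \<open>w\<close> into the one in \<open>h\<close>.\<close>
    moreover have "\<forall>\<^sub>F w in at 0. \<phi> (Z w - z0) / (c * \<omega>) =
        (G (Z w) - 1 / sqrt c + b / (3 * c\<^sup>2) * w) / w\<^sup>2"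
    proof -
      have "\<forall>\<^sub>F w in at 0. \<bar>w\<bar> < R \<and> w \<noteq> 0"
        using R by (auto simp: eventually_at intro!: exI[of _ R])
      then show ?thesis
      proof eventually_elim
        case (elim w)
        define h where "h = Z w - z0"
        have wJ: "w \<in> J" using elim JR by auto
        have h0: "h \<noteq> 0" using Z(2)[OF wJ] elim W0 by (auto simp: h_def)
        have Zh: "Z w = z0 + h" by (simp add: h_def)
        have wh: "w = \<omega> * h * sqrt (P h)" using Z(2)[OF wJ] W_P[OF h0] by (simp add: Zh)
        have "2 * U (z0 + h) > 0" using Upos[of "z0 + h"] h0 Z(1)[OF wJ] by (simp add: Zh)
        then have Ph: "P h > 0" using U_P[OF h0] z0(3) h0 zero_less_mult_pos[of "c * h\<^sup>2" "P h"] by simp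
        have w2: "w\<^sup>2 = c * (h\<^sup>2 * P h)" unfolding wh using Ph \<omega> by (simp add: power_mult_distrib)
        have "G (Z w) - 1 / sqrt c + b / (3 * c\<^sup>2) * w = (sqrt (P h) / Q h - 1 + b / (3 * c) * (h * sqrt (P h))) / \<omega>"
        proof -
          have "G (Z w) = sqrt (P h) / Q h / \<omega>" unfolding Zh by (rule G_PQ[OF h0])
          moreover have "b / (3 * c\<^sup>2) * w = b / (3 * c) * (h * sqrt (P h)) / \<omega>"
            by (subst wh) (use \<omega>(1) in \<open>simp flip: \<omega>(2) add: field_simps power2_eq_square\<close>)
          ultimately show ?thesis by (simp add: add_divide_distrib diff_divide_distrib flip: \<omega>_def)
        qed
        then show ?case
          using z0 by (simp add: w2 \<phi>_def flip: h_def)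
      qed
    qed
    ultimately show "((\<lambda>w. (G (Z w) - 1 / sqrt c + b / (3 * c\<^sup>2) * w) / w\<^sup>2) \<longlongrightarrow>
       (5 * b\<^sup>2 - 3 * c * d) / (24 * c\<^sup>2) / (c * sqrt c)) (at 0)"
      unfolding \<omega>_def by (rule Lim_transform_eventually)
  qed
qed

text \<open>On the circle \<open>w = r * cos \<theta>\<close>, \<open>v = - r * sin \<theta>\<close>
  the equation becomes \<open>d\<theta>/dt = 1 / g (r * cos \<theta>)\<close>, which is solved by a
  phase function. \<open>T 0\<close> is the limit of the periods and not the period of a motion. The
  last conclusion is an implication because constancy of \<open>T\<close> has to come from
  commensurability, which only the users of the lemma have.\<close>

lemma small_oscillations:
  fixes f f1 f2 f3 :: "real \<Rightarrow> real" and z0 e c b d :: real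
  assumes "e > 0"
    and f: "\<And>x. \<bar>x - z0\<bar> \<le> e \<Longrightarrow> (f has_real_derivative f1 x) (at x)"
    and f1: "\<And>x. \<bar>x - z0\<bar> \<le> e \<Longrightarrow> (f1 has_real_derivative f2 x) (at x)"
    and f2: "\<And>x. \<bar>x - z0\<bar> \<le> e \<Longrightarrow> (f2 has_real_derivative f3 x) (at x)"
    and f3: "isCont f3 z0"
    and z0: "f z0 = 0" "c = f1 z0" "c > 0" "b = f2 z0" "d = f3 z0"
  obtains R :: real and T :: "real \<Rightarrow> real" and z :: "real \<Rightarrow> real \<Rightarrow> real" and v :: "real \<Rightarrow> real \<Rightarrow> real"
  where "R > 0" "continuous_on {0..R} T" "T 0 = 2 * pi / sqrt c"
    "\<And>r. r \<in> {0<..R} \<Longrightarrow> is_period (z r) (T r)"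
    "\<And>r. r \<in> {0<..R} \<Longrightarrow> \<not> z r constant_on UNIV"
    "\<And>r t. r \<in> {0<..R} \<Longrightarrow> \<bar>z r t - z0\<bar> \<le> e"
    "\<And>r t. r \<in> {0<..R} \<Longrightarrow> (z r has_real_derivative v r t) (at t)"
    "\<And>r t. r \<in> {0<..R} \<Longrightarrow> (v r has_real_derivative - f (z r t)) (at t)"
    "(\<And>r. r \<in> {0<..R} \<Longrightarrow> T r = T 0) \<Longrightarrow> 5 * b\<^sup>2 = 3 * c * d"
proof -
  obtain R Z g where R: "R > 0" and Z0: "Z 0 = z0" and g0: "g 0 = 1 / sqrt c"
    and Z: "\<And>w. \<bar>w\<bar> \<le> R \<Longrightarrow> \<bar>Z w - z0\<bar> \<le> e" "\<And>w. \<bar>w\<bar> \<le> R \<Longrightarrow> (Z has_real_derivative g w) (at w)"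
    and gpos: "\<And>w. \<bar>w\<bar> \<le> R \<Longrightarrow> g w > 0" and fg: "\<And>w. \<bar>w\<bar> \<le> R \<Longrightarrow> f (Z w) * g w = w"
    and contg: "continuous_on {-R..R} g"
    and glim: "((\<lambda>w. (g w - 1 / sqrt c + b / (3 * c\<^sup>2) * w) / w\<^sup>2) \<longlongrightarrow>
       (5 * b\<^sup>2 - 3 * c * d) / (24 * c\<^sup>2) / (c * sqrt c)) (at 0)"
    by (rule well_coordinate[OF \<open>e > 0\<close> f f1 f2 f3 z0], assumption+, rule that)
  define k where "k r \<theta> = g (r * cos \<theta>)" for r \<theta>
  define T where "T r = integral {0..2 * pi} (k r)" for r
  have rcos: "\<bar>r * cos \<theta>\<bar> \<le> r" if "0 \<le> r" for r \<theta> :: real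
    using that by (simp add: abs_mult mult_left_le)
  have contk: "continuous_on A (k r)" if "r \<in> {0..R}" for A r
  proof -
    have "r * cos \<theta> \<in> {-R..R}" for \<theta> using rcos[of r \<theta>] that by (auto simp: abs_le_iff)
    then show ?thesis
      unfolding k_def by (intro continuous_on_compose2[OF contg] continuous_intros) auto
  qed
  have contT: "continuous_on {0..R} T"
  proof -
    have "continuous_on ({0..R} \<times> cbox 0 (2 * pi)) (\<lambda>(r, \<theta>). g (r * cos \<theta>))"
      unfolding case_prod_beta
    proof (rule continuous_on_compose2[OF contg])
      show "(\<lambda>x. fst x * cos (snd x)) ` ({0..R} \<times> cbox 0 (2 * pi)) \<subseteq> {-R..R}"
      proof clarsimp
        fix r \<theta> :: real assume "0 \<le> r" "r \<le> R"
        then show "- R \<le> r * cos \<theta> \<and> r * cos \<theta> \<le> R"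
          using rcos[of r \<theta>] by (auto simp: abs_le_iff)
      qed
    qed (intro continuous_intros)
    then show ?thesis
      unfolding T_def k_def
      using integral_continuous_on_param[of "{0..R}" 0 "2 * pi" "\<lambda>r \<theta>. g (r * cos \<theta>)"] by simp
  qed
  have T0: "T 0 = 2 * pi / sqrt c"
    by (simp add: T_def k_def[abs_def] g0)
  have "\<exists>\<Theta>. T r > 0 \<and> (\<forall>t. (\<Theta> has_real_derivative 1 / k r (\<Theta> t)) (at t)) \<and>
      (\<forall>t. \<Theta> (t + T r) = \<Theta> t + 2 * pi)" if "r \<in> {0<..R}" for r
  proof -
    have "k r \<theta> > 0" for \<theta> using gpos[of "r * cos \<theta>"] rcos[of r \<theta>] that by (simp add: k_def)
    moreover have "k r (\<theta> + 2 * pi) = k r \<theta>" for \<theta> by (simp add: k_def)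
    ultimately show ?thesis
      using phase_function_exists[of "k r"] contk[of r UNIV] that unfolding T_def
      by (metis atLeastAtMost_iff greaterThanAtMost_iff less_imp_le)
  qed
  then obtain \<Theta> where Tpos: "\<And>r. r \<in> {0<..R} \<Longrightarrow> T r > 0"
    and \<Theta>: "\<And>r t. r \<in> {0<..R} \<Longrightarrow> (\<Theta> r has_real_derivative 1 / k r (\<Theta> r t)) (at t)"
    and \<Theta>T: "\<And>r t. r \<in> {0<..R} \<Longrightarrow> \<Theta> r (t + T r) = \<Theta> r t + 2 * pi"
    by metis
  define z where "z r t = Z (r * cos (\<Theta> r t))" for r t
  define v where "v r t = - (r * sin (\<Theta> r t))" for r t
  have zd: "(z r has_real_derivative v r t) (at t)"
    and vd: "(v r has_real_derivative - f (z r t)) (at t)" if r: "r \<in> {0<..R}" for r t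
  proof -
    have w: "\<bar>r * cos (\<Theta> r t)\<bar> \<le> R" using rcos[of r "\<Theta> r t"] r by auto
    have kpos: "k r (\<Theta> r t) > 0" using gpos[OF w] by (simp add: k_def)
    have wd: "((\<lambda>t. r * cos (\<Theta> r t)) has_real_derivative r * (- sin (\<Theta> r t) * (1 / k r (\<Theta> r t)))) (at t)"
      by (intro DERIV_cmult DERIV_chain2[OF DERIV_cos \<Theta>[OF r]])
    have "(z r has_real_derivative g (r * cos (\<Theta> r t)) * (r * (- sin (\<Theta> r t) * (1 / k r (\<Theta> r t))))) (at t)"
      unfolding z_def[abs_def] by (rule DERIV_chain2[OF Z(2)[OF w] wd])
    also have "g (r * cos (\<Theta> r t)) * (r * (- sin (\<Theta> r t) * (1 / k r (\<Theta> r t)))) = v r t"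
      using kpos by (simp add: k_def v_def)
    finally show "(z r has_real_derivative v r t) (at t)" .
    have "(v r has_real_derivative - (r * (cos (\<Theta> r t) * (1 / k r (\<Theta> r t))))) (at t)"
      unfolding v_def[abs_def] by (intro DERIV_minus DERIV_cmult DERIV_chain2[OF DERIV_sin \<Theta>[OF r]])
    also have "r * (cos (\<Theta> r t) * (1 / k r (\<Theta> r t))) = f (z r t)"
      using fg[OF w] kpos by (simp add: z_def k_def field_simps)
    finally show "(v r has_real_derivative - f (z r t)) (at t)" .
  qed
  have nonconst: "\<not> z r constant_on UNIV" if r: "r \<in> {0<..R}" for r
  proof
    assume "z r constant_on UNIV"
    then obtain x where "z r = (\<lambda>_. x)" by (auto simp: constant_on_def)
    then have "v r = (\<lambda>_. 0)" using zd[OF r] DERIV_unique DERIV_const by fastforce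
    then have "f (z r 0) = 0" using vd[OF r, of 0] DERIV_unique[OF DERIV_const] by fastforce
    then have "r * cos (\<Theta> r 0) = 0"
      using fg[of "r * cos (\<Theta> r 0)"] rcos[of r "\<Theta> r 0"] r by (simp add: z_def)
    moreover have "r * sin (\<Theta> r 0) = 0" using fun_cong[OF \<open>v r = (\<lambda>_. 0)\<close>, of 0] by (simp add: v_def)
    ultimately show False using r sin_zero_abs_cos_one by fastforce
  qed
  show thesis
  proof (rule that[of R T z v])
    show "is_period (z r) (T r)" if "r \<in> {0<..R}" for r
      using Tpos[OF that] \<Theta>T[OF that] by (simp add: is_period_def periodic_fun_simple_def z_def)
    show "\<bar>z r t - z0\<bar> \<le> e" if "r \<in> {0<..R}" for r t
      unfolding z_def using rcos[of r "\<Theta> r t"] that by (intro Z(1)) auto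
    assume const: "\<And>r. r \<in> {0<..R} \<Longrightarrow> T r = T 0"
    define g\<^sub>1 where "g\<^sub>1 = - b / (3 * c\<^sup>2)"
    define g\<^sub>2 where "g\<^sub>2 = (5 * b\<^sup>2 - 3 * c * d) / (24 * c\<^sup>2) / (c * sqrt c)"
    \<comment> \<open>Over a full turn \<open>cos\<close> integrates to 0 and its square to
      \<open>pi\<close>, so \<open>T r - T 0\<close> equals
      \<open>g\<^sub>2 * pi * r\<^sup>2\<close> up to an error of at most
      \<open>\<epsilon> * pi * r\<^sup>2\<close>. If \<open>T\<close> is constant, this bounds
      \<open>g\<^sub>2\<close> by \<open>\<epsilon>\<close>.\<close>
    have "\<bar>g\<^sub>2\<bar> \<le> \<epsilon>" if "\<epsilon> > 0" for \<epsilon>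
    proof -
      have "\<forall>\<^sub>F w in at 0. \<bar>(g w - 1 / sqrt c + b / (3 * c\<^sup>2) * w) / w\<^sup>2 - g\<^sub>2\<bar> < \<epsilon> / 2"
        using tendstoD[OF glim, of "\<epsilon> / 2"] \<open>\<epsilon> > 0\<close> by (simp add: dist_real_def g\<^sub>2_def)
      then obtain s where s: "s > 0"
        "\<And>w. w \<noteq> 0 \<Longrightarrow> \<bar>w\<bar> < s \<Longrightarrow> \<bar>(g w - 1 / sqrt c + b / (3 * c\<^sup>2) * w) / w\<^sup>2 - g\<^sub>2\<bar> < \<epsilon> / 2"
        by (auto simp: eventually_at dist_real_def)
      define r where "r = min R (s / 2)"
      have r: "r \<in> {0<..R}" "r < s" using s(1) R by (auto simp: r_def)
      have est: "\<bar>g w - g 0 - g\<^sub>1 * w - g\<^sub>2 * w\<^sup>2\<bar> \<le> \<epsilon> / 2 * r\<^sup>2" if w: "\<bar>w\<bar> \<le> r" for w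
      proof (cases "w = 0")
        case False
        have "g w - g 0 - g\<^sub>1 * w - g\<^sub>2 * w\<^sup>2 = ((g w - 1 / sqrt c + b / (3 * c\<^sup>2) * w) / w\<^sup>2 - g\<^sub>2) * w\<^sup>2"
          using False by (simp add: g0 g\<^sub>1_def left_diff_distrib)
        have "\<bar>g w - g 0 - g\<^sub>1 * w - g\<^sub>2 * w\<^sup>2\<bar> \<le> \<epsilon> / 2 * w\<^sup>2"
          unfolding \<open>g w - g 0 - g\<^sub>1 * w - g\<^sub>2 * w\<^sup>2 = _\<close> abs_mult abs_power2 using s(2)[OF False] w r by (intro mult_right_mono) auto
        also have "\<dots> \<le> \<epsilon> / 2 * r\<^sup>2"
          using w \<open>\<epsilon> > 0\<close> abs_le_square_iff[of w r] r by (intro mult_left_mono) auto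
        finally show ?thesis .
      qed (use \<open>\<epsilon> > 0\<close> in simp)
      have i1: "(k r has_integral T r) {0..2 * pi}"
        unfolding T_def using r contk[of r "{0..2 * pi}"]
        by (intro integrable_integral integrable_continuous_interval) auto
      have i2: "((\<lambda>\<theta>. cos \<theta>) has_integral 0) {0..2 * pi}"
        using fundamental_theorem_of_calculus[of 0 "2 * pi" sin cos]
        by (simp add: has_field_derivative_at_within DERIV_sin flip: has_real_derivative_iff_has_vector_derivative)
      have i3: "((\<lambda>\<theta>. (cos \<theta>)\<^sup>2) has_integral pi) {0..2 * pi}"
      proof -
        have "((\<lambda>\<theta>. \<theta> / 2 + sin \<theta> * cos \<theta> / 2) has_real_derivative (cos \<theta>)\<^sup>2) (at \<theta> within A)" for \<theta> A
        proof -
          have "1 / 2 + ((cos \<theta>)\<^sup>2 - (sin \<theta>)\<^sup>2) / 2 = (cos \<theta>)\<^sup>2"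
            unfolding sin_squared_eq by (simp add: field_simps)
          moreover have "((\<lambda>\<theta>. \<theta> / 2 + sin \<theta> * cos \<theta> / 2) has_real_derivative
              1 / 2 + ((cos \<theta>)\<^sup>2 - (sin \<theta>)\<^sup>2) / 2) (at \<theta> within A)"
            by (auto intro!: derivative_eq_intros simp: power2_eq_square field_simps)
          ultimately show ?thesis by simp
        qed
        then show ?thesis
          using fundamental_theorem_of_calculus[of 0 "2 * pi" "\<lambda>\<theta>. \<theta> / 2 + sin \<theta> * cos \<theta> / 2" "\<lambda>\<theta>. (cos \<theta>)\<^sup>2"]
          by (simp flip: has_real_derivative_iff_has_vector_derivative)
      qed
      have i4: "((\<lambda>\<theta>. g 0) has_integral 2 * pi * g 0) {0..2 * pi}"
        using has_integral_const_real[of "g 0" 0 "2 * pi"] by simp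
      have "((\<lambda>\<theta>. k r \<theta> - g 0 - (g\<^sub>1 * r) * cos \<theta> - (g\<^sub>2 * r\<^sup>2) * (cos \<theta>)\<^sup>2) has_integral
          T r - 2 * pi * g 0 - (g\<^sub>1 * r) * 0 - (g\<^sub>2 * r\<^sup>2) * pi) {0..2 * pi}"
        by (intro has_integral_diff has_integral_mult_right i1 i2 i3 i4)
      moreover have "T r - 2 * pi * g 0 = 0" using const[OF r(1)] by (simp add: T0 g0)
      ultimately have int: "((\<lambda>\<theta>. k r \<theta> - g 0 - (g\<^sub>1 * r) * cos \<theta> - (g\<^sub>2 * r\<^sup>2) * (cos \<theta>)\<^sup>2) has_integral
          - (g\<^sub>2 * r\<^sup>2) * pi) {0..2 * pi}"
        by simp
      have "norm (- (g\<^sub>2 * r\<^sup>2) * pi) \<le> (\<epsilon> / 2 * r\<^sup>2) * measure lborel {0..2 * pi}"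
      proof (rule has_integral_bound_real[OF _ _ int])
        show "norm (k r \<theta> - g 0 - (g\<^sub>1 * r) * cos \<theta> - (g\<^sub>2 * r\<^sup>2) * (cos \<theta>)\<^sup>2) \<le> \<epsilon> / 2 * r\<^sup>2"
          if "\<theta> \<in> {0..2 * pi} - {}" for \<theta>
          using est[of "r * cos \<theta>"] rcos[of r \<theta>] r by (simp add: k_def power_mult_distrib mult.assoc)
      qed (use \<open>\<epsilon> > 0\<close> in auto)
      then have "\<bar>g\<^sub>2\<bar> * (r\<^sup>2 * pi) \<le> \<epsilon> * (r\<^sup>2 * pi)" by (simp add: abs_mult algebra_simps)
      then show ?thesis using r by simp
    qed
    then have "g\<^sub>2 = 0" by (metis abs_le_zero_iff field_le_epsilon add_0)
    then show "5 * b\<^sup>2 = 3 * c * d" using z0 by (simp add: g\<^sub>2_def)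
  qed (use R contT T0 nonconst zd vd in auto)
qed
section \<open>Lyapunov stability and harmonic oscillators\<close>

lemma solves_ode_on_iff:
  "solves_ode_on J I \<rho> \<Psi> K z v \<longleftrightarrow>
     (\<forall>t\<in>J. z t \<in> I \<and> (z has_real_derivative v t) (at t within J) \<and>
        (v has_real_derivative - potential_deriv \<rho> \<Psi> K (z t)) (at t within J))"
proof -
  have "w + \<rho> x = 1 / K\<^sup>2 * \<Psi> x \<longleftrightarrow> w = - potential_deriv \<rho> \<Psi> K x" for w x
    by (auto simp: potential_deriv_def)
  then show ?thesis by (simp add: solves_ode_on_def)
qed

text \<open>The energy serves as a Lyapunov function: near \<open>z0\<close> the potential is at
  least \<open>c / 4 * (x - z0)\<^sup>2\<close>, so a small energy keeps both the displacement and
  the velocity small.\<close>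

lemma nondeg_stable_imp_stable_equilibrium:
  assumes I: "open I" and cont: "continuous_on I (potential_deriv \<rho> \<Psi> K)"
    and diff: "(potential_deriv \<rho> \<Psi> K has_real_derivative c) (at z0)"
    and nd: "nondeg_stable_equilibrium I \<rho> \<Psi> K z0"
  shows "stable_equilibrium I \<rho> \<Psi> K z0"
proof -
  define f where "f = potential_deriv \<rho> \<Psi> K"
  have eq: "equilibrium I \<rho> \<Psi> K z0" and z0: "z0 \<in> I" "f z0 = 0"
    using nd by (auto simp: nondeg_stable_equilibrium_def equilibrium_def f_def)
  have c: "c > 0"
    using nd DERIV_imp_deriv[OF diff] by (simp add: nondeg_stable_equilibrium_def)
  have "\<exists>\<delta>>0. \<forall>T>0. \<forall>z v. solves_ode_on {0..<T} I \<rho> \<Psi> K z v \<and> dist (z 0, v 0) (z0, 0) < \<delta> \<longrightarrow>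
        (\<forall>t\<in>{0..<T}. dist (z t, v t) (z0, 0) < \<epsilon>)" if "\<epsilon> > 0" for \<epsilon>
  proof -
    have "((\<lambda>x. f x / (x - z0)) \<longlongrightarrow> c) (at z0)"
      using diff z0(2) by (simp add: has_field_derivative_iff f_def)
    then have "\<forall>\<^sub>F x in at z0. f x / (x - z0) > c / 2"
      by (rule order_tendstoD) (use c in simp)
    then obtain s where s: "s > 0" "\<And>x. x \<noteq> z0 \<Longrightarrow> \<bar>x - z0\<bar> < s \<Longrightarrow> f x / (x - z0) > c / 2"
      by (auto simp: eventually_at dist_real_def)
    obtain e where e: "e > 0" "ball z0 e \<subseteq> I" using I z0 open_contains_ball by blast
    define \<eta> where "\<eta> = min (\<epsilon> / 2) (min (s / 2) (e / 2))"
    have \<eta>: "\<eta> > 0" "\<eta> \<le> \<epsilon> / 2" "\<eta> < s" "\<eta> < e" using s(1) e(1) \<open>\<epsilon> > 0\<close> by (auto simp: \<eta>_def)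
    have sub: "{z0 - \<eta>..z0 + \<eta>} \<subseteq> I" using e(2) \<eta> by (force simp: dist_real_def subset_iff)
    obtain V where V: "\<And>x. x \<in> {z0 - \<eta>..z0 + \<eta>} \<Longrightarrow> (V has_real_derivative f x) (at x)" and V0: "V z0 = 0"
    proof (rule antiderivative_on_interval)
      show "continuous_on {z0 - \<eta>..z0 + \<eta>} f" using cont sub unfolding f_def by (rule continuous_on_subset)
    qed (use \<eta> in auto)
    have contV: "isCont V x" if "x \<in> {z0 - \<eta>..z0 + \<eta>}" for x using V[OF that] DERIV_isCont by blast
    have Vlow: "V x \<ge> c / 4 * (x - z0)\<^sup>2" if x: "x \<in> {z0 - \<eta>..z0 + \<eta>}" for x
    proof -
      have d: "((\<lambda>x. V x - c / 4 * (x - z0)\<^sup>2) has_real_derivative f s - c / 2 * (s - z0)) (at s)"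
        if "s \<in> {z0 - \<eta>..z0 + \<eta>}" for s
        using V[OF that] by (auto intro!: derivative_eq_intros)
      have fs: "f s \<ge> c / 2 * (s - z0)" if "z0 \<le> s" "s \<le> z0 + \<eta>" for s
        using s(2)[of s] that \<eta> z0 by (cases "s = z0") (auto simp: pos_less_divide_eq)
      have fs': "f s \<le> c / 2 * (s - z0)" if "s \<le> z0" "z0 - \<eta> \<le> s" for s
        using s(2)[of s] that \<eta> z0 by (cases "s = z0") (auto simp: neg_less_divide_eq)
      have "V z0 - c / 4 * (z0 - z0)\<^sup>2 \<le> V x - c / 4 * (x - z0)\<^sup>2"
      proof (cases "z0 \<le> x")
        case True
        show ?thesis
        proof (rule DERIV_nonneg_imp_nondecreasing[OF True, of "\<lambda>x. V x - c / 4 * (x - z0)\<^sup>2"])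
          fix s assume "z0 \<le> s" "s \<le> x"
          then show "\<exists>y. ((\<lambda>x. V x - c / 4 * (x - z0)\<^sup>2) has_real_derivative y) (at s) \<and> 0 \<le> y"
            using d[of s] fs[of s] x \<eta> by (intro exI[of _ "f s - c / 2 * (s - z0)"]) auto
        qed
      next
        case False
        then have "x \<le> z0" by simp
        then show ?thesis
        proof (rule DERIV_nonpos_imp_nonincreasing[of x z0 "\<lambda>x. V x - c / 4 * (x - z0)\<^sup>2"])
          fix s assume "x \<le> s" "s \<le> z0"
          then show "\<exists>y. ((\<lambda>x. V x - c / 4 * (x - z0)\<^sup>2) has_real_derivative y) (at s) \<and> y \<le> 0"
            using d[of s] fs'[of s] x \<eta> by (intro exI[of _ "f s - c / 2 * (s - z0)"]) auto
        qed
      qed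
      then show ?thesis by (simp add: V0)
    qed
    \<comment> \<open>The first bound on the energy prevents the displacement from reaching
      \<open>\<eta>\<close>, the second keeps the speed below \<open>\<eta>\<close>; together they
      stay within \<open>\<epsilon>\<close> because
      \<open>\<eta> \<le> \<epsilon> / 2\<close>.\<close>
    define \<kappa> where "\<kappa> = min (c / 4 * \<eta>\<^sup>2) (\<eta>\<^sup>2 / 2)"
    have \<kappa>: "\<kappa> > 0" using \<eta> c by (simp add: \<kappa>_def)
    have "isCont (\<lambda>p. V (fst p)) (z0, 0::real)"
      by (rule isCont_o2[where f = fst and g = V]) (use contV[of z0] \<eta> in \<open>auto intro: isCont_fst\<close>)
    then have "isCont (\<lambda>p. (snd p)\<^sup>2 / 2 + V (fst p)) (z0, 0::real)"
      by (intro continuous_intros) auto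
    then obtain \<delta>' where \<delta>': "\<delta>' > 0"
      "\<And>p. dist p (z0, 0::real) < \<delta>' \<Longrightarrow> dist ((snd p)\<^sup>2 / 2 + V (fst p)) 0 < \<kappa>"
      using \<kappa> unfolding continuous_at_eps_delta by (auto simp: V0)
    define \<delta> where "\<delta> = min \<delta>' \<eta>"
    have "dist (z t, v t) (z0, 0) < \<epsilon>"
      if sol: "solves_ode_on {0..<T} I \<rho> \<Psi> K z v" and init: "dist (z 0, v 0) (z0, 0) < \<delta>" and t: "t \<in> {0..<T}" for T z v t
    proof -
      have zd: "(z has_real_derivative v s) (at s within {0..<T})"
        "(v has_real_derivative - f (z s)) (at s within {0..<T})" if "s \<in> {0..<T}" for s
        using sol that by (auto simp: solves_ode_on_iff f_def)
      have E0: "(v 0)\<^sup>2 / 2 + V (z 0) < \<kappa>"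
        using \<delta>'(2)[of "(z 0, v 0)"] init by (auto simp: \<delta>_def dist_real_def)
      have zin: "\<bar>z 0 - z0\<bar> < \<eta>"
        using init dist_fst_le[of "(z 0, v 0)" "(z0, 0)"] by (simp add: \<delta>_def dist_real_def)
      have contz: "continuous_on {0..<T} z"
        using zd DERIV_continuous unfolding continuous_on_eq_continuous_within by blast
      have energy: "(v s)\<^sup>2 / 2 + V (z s) < \<kappa>" if s: "s \<in> {0..<T}" "\<And>u. u \<in> {0..s} \<Longrightarrow> z u \<in> {z0 - \<eta>..z0 + \<eta>}" for s
      proof -
        have sub: "{0..s} \<subseteq> {0..<T}" using s(1) by auto
        have "\<exists>k. \<forall>u\<in>{0..s}. (v u)\<^sup>2 / 2 + V (z u) = k"
        proof (rule has_field_derivative_zero_constant)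
          fix u assume u: "u \<in> {0..s}"
          have z': "(z has_real_derivative v u) (at u within {0..s})"
            and v': "(v has_real_derivative - f (z u)) (at u within {0..s})"
            using zd[of u] u sub DERIV_subset by blast+
          have "((\<lambda>u. V (z u)) has_real_derivative f (z u) * v u) (at u within {0..s})"
            using DERIV_chain[OF V[OF s(2)[OF u]] z'] by (simp add: o_def)
          then show "((\<lambda>u. (v u)\<^sup>2 / 2 + V (z u)) has_real_derivative 0) (at u within {0..s})"
            using v' by (auto intro!: derivative_eq_intros)
        qed simp
        then have "(v s)\<^sup>2 / 2 + V (z s) = (v 0)\<^sup>2 / 2 + V (z 0)" using s(1) by force
        then show ?thesis using E0 by simp
      qed
      have inside: "\<bar>z s - z0\<bar> < \<eta>" if s: "s \<in> {0..<T}" for s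
      proof (rule ccontr)
        assume neg: "\<not> \<bar>z s - z0\<bar> < \<eta>"
        have conts: "continuous_on {0..s} (\<lambda>u. \<bar>z u - z0\<bar>)"
          using contz s by (intro continuous_intros continuous_on_subset[OF contz]) auto
        \<comment> \<open>The minimum of \<open>A\<close> is the first time at which the
          displacement is \<open>\<eta>\<close>. Up to then the solution lies where \<open>V\<close>
          is an antiderivative of the force, so conservation of energy applies.\<close>
        define A where "A = {u \<in> {0..s}. \<bar>z u - z0\<bar> = \<eta>}"
        have "A \<noteq> {}"
          using IVT'[of "\<lambda>u. \<bar>z u - z0\<bar>" 0 \<eta> s] zin neg s conts by (auto simp: A_def)
        moreover have "compact A"
        proof -
          have "closedin (top_of_set {0..s}) A"
            unfolding A_def using conts by (rule continuous_closedin_preimage_constant)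
          then show ?thesis using closedin_compact by blast
        qed
        ultimately obtain u where u: "u \<in> A" "\<And>w. w \<in> A \<Longrightarrow> u \<le> w"
          using compact_attains_inf by metis
        have "\<bar>z w - z0\<bar> \<le> \<eta>" if w: "w \<in> {0..u}" for w
        proof (rule ccontr)
          assume "\<not> \<bar>z w - z0\<bar> \<le> \<eta>"
          moreover have "continuous_on {0..w} (\<lambda>u. \<bar>z u - z0\<bar>)"
            using conts w u(1) by (rule_tac continuous_on_subset[OF conts]) (auto simp: A_def)
          ultimately obtain x where "0 \<le> x" "x \<le> w" "\<bar>z x - z0\<bar> = \<eta>"
            using IVT'[of "\<lambda>u. \<bar>z u - z0\<bar>" 0 \<eta> w] zin w by auto
          then have "x \<in> A" "x \<noteq> w" using w u(1) \<open>\<not> \<bar>z w - z0\<bar> \<le> \<eta>\<close> by (auto simp: A_def)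
          then show False using u(2)[of x] w \<open>x \<le> w\<close> by auto
        qed
        then have "z w \<in> {z0 - \<eta>..z0 + \<eta>}" if "w \<in> {0..u}" for w
          using that by (force simp: abs_le_iff)
        then have "(v u)\<^sup>2 / 2 + V (z u) < \<kappa>"
          using u(1) s by (intro energy) (auto simp: A_def)
        moreover have "z u \<in> {z0 - \<eta>..z0 + \<eta>}" "(z u - z0)\<^sup>2 = \<eta>\<^sup>2"
          using u(1) power2_abs[of "z u - z0"] by (auto simp: A_def abs_le_iff)
        then have "V (z u) \<ge> c / 4 * \<eta>\<^sup>2" using Vlow[of "z u"] by simp
        moreover have "\<kappa> \<le> c / 4 * \<eta>\<^sup>2" unfolding \<kappa>_def by (rule min.cobounded1)
        ultimately show False using zero_le_power2[of "v u"] by linarith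
      qed
      have zt: "z t \<in> {z0 - \<eta>..z0 + \<eta>}" using inside[OF t] by auto
      have "(v t)\<^sup>2 / 2 + V (z t) < \<kappa>"
      proof (rule energy[OF t])
        show "z u \<in> {z0 - \<eta>..z0 + \<eta>}" if "u \<in> {0..t}" for u
          using inside[of u] that t by auto
      qed
      moreover have "V (z t) \<ge> 0"
        by (rule order_trans[OF _ Vlow[OF zt]]) (use c in simp)
      moreover have "\<kappa> \<le> \<eta>\<^sup>2 / 2" unfolding \<kappa>_def by (rule min.cobounded2)
      ultimately have "(v t)\<^sup>2 < \<eta>\<^sup>2" by linarith
      then have "\<bar>v t\<bar> < \<eta>" using \<eta>(1) abs_square_less_1 power2_less_imp_less[of "\<bar>v t\<bar>" \<eta>] by simp
      have "dist (z t, v t) (z0, 0) \<le> dist (z t) z0 + dist (v t) 0"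
        using norm_Pair_le[of "z t - z0" "v t"] by (simp add: dist_norm)
      also have "\<dots> < \<epsilon>" using inside[OF t] \<open>\<bar>v t\<bar> < \<eta>\<close> \<eta>(2) by (simp add: dist_real_def)
      finally show ?thesis .
    qed
    moreover have "\<delta> > 0" using \<delta>'(1) \<eta>(1) by (simp add: \<delta>_def)
    ultimately show ?thesis by blast
  qed
  then show ?thesis using eq by (simp add: stable_equilibrium_def)
qed

section \<open>Harmonic oscillators and minimal periods\<close>

lemma harmonic_oscillator_solution:
  fixes q p :: "real \<Rightarrow> real"
  assumes "\<omega> > 0" and q: "\<And>t. (q has_real_derivative p t) (at t)"
    and p: "\<And>t. (p has_real_derivative - (\<omega>\<^sup>2 * (q t - q\<^sub>0))) (at t)"
  obtains A B where "\<And>t. q t = q\<^sub>0 + A * cos (\<omega> * t) + B * sin (\<omega> * t)"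
proof -
  define A where "A = q 0 - q\<^sub>0"
  define B where "B = p 0 / \<omega>"
  define x where "x t = q t - (q\<^sub>0 + A * cos (\<omega> * t) + B * sin (\<omega> * t))" for t
  define y where "y t = p t - (- A * \<omega> * sin (\<omega> * t) + B * \<omega> * cos (\<omega> * t))" for t
  have xd: "(x has_real_derivative y t) (at t)" for t
    unfolding x_def y_def by (auto intro!: derivative_eq_intros q)
  have yd: "(y has_real_derivative - \<omega>\<^sup>2 * x t) (at t)" for t
    unfolding x_def y_def
    by (auto intro!: derivative_eq_intros p simp: algebra_simps power2_eq_square)
  have "((\<lambda>t. (y t)\<^sup>2 + \<omega>\<^sup>2 * (x t)\<^sup>2) has_real_derivative 0) (at t)" for t
    by (auto intro!: derivative_eq_intros xd yd)
  then have "(y t)\<^sup>2 + \<omega>\<^sup>2 * (x t)\<^sup>2 = (y 0)\<^sup>2 + \<omega>\<^sup>2 * (x 0)\<^sup>2" for t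
    using DERIV_isconst_all by blast
  moreover have "x 0 = 0" "y 0 = 0" using assms(1) by (auto simp: x_def y_def A_def B_def)
  ultimately have "(y t)\<^sup>2 + (\<omega> * x t)\<^sup>2 = 0" for t by (simp add: power_mult_distrib)
  then have "x t = 0" for t using assms(1) by (simp add: sum_power2_eq_zero_iff)
  then show thesis using that[of A B] by (simp add: x_def)
qed

lemma harmonic_oscillator_minimal_period:
  fixes q p :: "real \<Rightarrow> real"
  assumes "\<omega> > 0" and q: "\<And>t. (q has_real_derivative p t) (at t)"
    and p: "\<And>t. (p has_real_derivative - (\<omega>\<^sup>2 * (q t - q\<^sub>0))) (at t)"
    and nc: "\<not> q constant_on UNIV"
  shows "is_minimal_period q (2 * pi / \<omega>)"
proof -
  obtain A B where AB: "\<And>t. q t = q\<^sub>0 + A * cos (\<omega> * t) + B * sin (\<omega> * t)"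
    using harmonic_oscillator_solution[OF assms(1-3)] by metis
  have AB0: "A\<^sup>2 + B\<^sup>2 \<noteq> 0"
  proof
    assume "A\<^sup>2 + B\<^sup>2 = 0"
    then have "A = 0" "B = 0" by (auto simp: sum_power2_eq_zero_iff)
    then show False using nc AB by (auto simp: constant_on_def)
  qed
  have "q (t + 2 * pi / \<omega>) = q t" for t
    using assms(1) by (simp add: AB distrib_left)
  moreover have "2 * pi / \<omega> \<le> T" if "is_period q T" for T
  proof -
    have T: "T > 0" "\<And>t. q (t + T) = q t" using that by (auto simp: is_period_def periodic_fun_simple_def)
    \<comment> \<open>Periodicity at time 0 and at a quarter of a turn gives two linear equations in
      \<open>C - 1\<close> and \<open>S\<close>. The determinant is
      \<open>A\<^sup>2 + B\<^sup>2\<close> up to sign, so \<open>C = 1\<close> and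
      \<open>\<omega> * T\<close> is a multiple of \<open>2 * pi\<close>.\<close>
    define C S where "C = cos (\<omega> * T)" and "S = sin (\<omega> * T)"
    have 1: "A * (C - 1) + B * S = 0" using T(2)[of 0] by (simp add: AB C_def S_def algebra_simps)
    have 2: "B * (C - 1) - A * S = 0"
      using T(2)[of "pi / 2 / \<omega>"] assms(1) by (simp add: AB distrib_left cos_add sin_add C_def S_def algebra_simps)
    have "(A\<^sup>2 + B\<^sup>2) * (C - 1) = A * (A * (C - 1) + B * S) + B * (B * (C - 1) - A * S)"
      by (simp add: power2_eq_square algebra_simps)
    then have "(A\<^sup>2 + B\<^sup>2) * (C - 1) = 0" unfolding 1 2 by simp
    then have "C = 1" using AB0 by (simp only: mult_eq_0_iff) simp
    then obtain n :: int where n: "\<omega> * T = of_int n * 2 * pi"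
      using cos_one_2pi_int by (auto simp: C_def)
    have "of_int n * 2 * pi > 0" using n[symmetric] T(1) assms(1) by simp
    then have "n \<ge> 1" by (simp add: zero_less_mult_iff)
    then have "2 * pi \<le> \<omega> * T" unfolding n by simp
    then show ?thesis using assms(1) by (simp add: pos_divide_le_eq mult.commute)
  qed
  ultimately show ?thesis
    using assms(1) by (auto simp: is_minimal_period_def is_period_def periodic_fun_simple_def)
qed

text \<open>A nonzero remainder of \<open>T'\<close> modulo \<open>T\<close> would be a period
  smaller than \<open>T\<close>.\<close>

lemma period_commensurable_with_minimal_period:
  assumes min: "is_minimal_period z T" and per: "is_period z T'"
  shows "T' / T \<in> \<rat>"
proof -
  have T: "T > 0" "periodic_fun_simple z T" and T': "T' > 0" "periodic_fun_simple z T'"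
    using assms by (auto simp: is_minimal_period_def is_period_def)
  define n where "n = \<lfloor>T' / T\<rfloor>"
  define r where "r = T' - of_int n * T"
  have r: "0 \<le> r" "r < T"
    using floor_divide_lower[OF T(1), of T'] floor_divide_upper[OF T(1), of T']
    by (auto simp: r_def n_def algebra_simps)
  interpret T: periodic_fun_simple z T by (rule T(2))
  interpret T': periodic_fun_simple z T' by (rule T'(2))
  have "z (t + r) = z t" for t
    using T.minus_of_int[of "t + T'" n] T'.plus_period[of t] by (simp add: r_def algebra_simps)
  then have "is_period z r" if "r > 0"
    using that by (simp add: is_period_def periodic_fun_simple_def)
  then have "\<not> r > 0"
    using min r(2) by (force simp: is_minimal_period_def)
  then have "T' = of_int n * T" using r by (simp add: r_def)
  then have "T' / T = of_int n" using T(1) by simp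
  then show ?thesis by simp
qed
section \<open>From commensurable periods to differential equations\<close>

lemma C_infinity_on_DERIV:
  assumes "C_infinity_on I f" "x \<in> I"
  shows "((deriv ^^ n) f has_real_derivative (deriv ^^ Suc n) f x) (at x)"
  using assms by (simp add: C_infinity_on_def DERIV_deriv_iff_field_differentiable)


section \<open>Derivatives of the potential and equilibria\<close>

locale smooth_oscillator =
  fixes I :: "real set" and \<rho> \<Psi> :: "real \<Rightarrow> real"
  assumes open_I: "open I" and connected_I: "connected I"
    and smooth_\<rho>: "C_infinity_on I \<rho>" and smooth_\<Psi>: "C_infinity_on I \<Psi>"
begin

text \<open>The index is one less than the order of differentiation of the potential:
  \<open>U' 1\<close>, \<open>U' 2\<close> and \<open>U' 3\<close> are its second, third and fourth
  derivatives.\<close>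

definition U' :: "nat \<Rightarrow> real \<Rightarrow> real \<Rightarrow> real" where
  "U' n K x = (deriv ^^ n) \<rho> x - 1 / K\<^sup>2 * (deriv ^^ n) \<Psi> x"

lemma potential_deriv_eq: "potential_deriv \<rho> \<Psi> K = U' 0 K"
  by (simp add: potential_deriv_def U'_def fun_eq_iff)

lemmas \<rho>_DERIV = C_infinity_on_DERIV[OF smooth_\<rho>]
lemmas \<Psi>_DERIV = C_infinity_on_DERIV[OF smooth_\<Psi>]

lemma U'_DERIV: "x \<in> I \<Longrightarrow> (U' n K has_real_derivative U' (Suc n) K x) (at x)"
  unfolding U'_def[abs_def] by (intro DERIV_diff DERIV_cmult \<rho>_DERIV \<Psi>_DERIV)

lemma isCont_\<rho>: "x \<in> I \<Longrightarrow> isCont ((deriv ^^ n) \<rho>) x"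
  and isCont_\<Psi>: "x \<in> I \<Longrightarrow> isCont ((deriv ^^ n) \<Psi>) x"
  and isCont_U': "x \<in> I \<Longrightarrow> isCont (U' n K) x"
  using \<rho>_DERIV \<Psi>_DERIV U'_DERIV DERIV_isCont by blast+

lemma continuous_on_U': "A \<subseteq> I \<Longrightarrow> continuous_on A (U' n K)"
  using isCont_U' by (meson continuous_at_imp_continuous_on subsetD)

lemma nondeg_iff: "nondeg_stable_equilibrium I \<rho> \<Psi> K x \<longleftrightarrow> x \<in> I \<and> U' 0 K x = 0 \<and> U' 1 K x > 0"
  using DERIV_imp_deriv[OF U'_DERIV[of x 0 K]]
  by (auto simp: nondeg_stable_equilibrium_def equilibrium_def potential_deriv_eq)

lemma nondeg_imp_stable:
  assumes "nondeg_stable_equilibrium I \<rho> \<Psi> K x"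
  shows "stable_equilibrium I \<rho> \<Psi> K x"
proof (rule nondeg_stable_imp_stable_equilibrium[OF open_I _ _ assms])
  show "continuous_on I (potential_deriv \<rho> \<Psi> K)"
    unfolding potential_deriv_eq by (rule continuous_on_U') simp
  show "(potential_deriv \<rho> \<Psi> K has_real_derivative U' 1 K x) (at x)"
    unfolding potential_deriv_eq using U'_DERIV[of x 0 K] assms by (simp add: nondeg_iff)
qed

section \<open>Bounded solutions versus stable equilibria\<close>

lemma bounded_nonconstant_solution_iff:
  "bounded_nonconstant_solution I \<rho> \<Psi> K z \<longleftrightarrow>
     (\<exists>v. \<forall>t. z t \<in> I \<and> (z has_real_derivative v t) (at t) \<and> (v has_real_derivative - U' 0 K (z t)) (at t)) \<and>
     (\<exists>C. compact C \<and> C \<subseteq> I \<and> range z \<subseteq> C) \<and> \<not> z constant_on UNIV"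
  by (simp add: bounded_nonconstant_solution_def solves_ode_on_iff potential_deriv_eq)

lemma bounded_nonconstant_solutionI:
  assumes "\<And>t. z t \<in> {c..d}" "{c..d} \<subseteq> I" "\<And>t. (z has_real_derivative v t) (at t)"
    "\<And>t. (v has_real_derivative - U' 0 K (z t)) (at t)" "\<not> z constant_on UNIV"
  shows "bounded_nonconstant_solution I \<rho> \<Psi> K z"
  unfolding bounded_nonconstant_solution_iff using assms
  by (intro conjI exI[of _ v] exI[of _ "{c..d}"]) auto

text \<open>The semilocal condition applies to \<open>z\<close> itself and makes it periodic. Its
  range is therefore the image of one period, a compact interval whose ends are attained, and the
  argument for a nondegenerate minimum can be run on this interval.\<close>

lemma semilocal_imp_nondeg:
  assumes bns: "bounded_nonconstant_solution I \<rho> \<Psi> K z" and all: "cond_all_semiloc I \<rho> \<Psi> K z"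
  shows "\<exists>z0. nondeg_stable_equilibrium I \<rho> \<Psi> K z0"
proof -
  obtain v where z: "\<And>t. z t \<in> I" "\<And>t. (z has_real_derivative v t) (at t)"
    "\<And>t. (v has_real_derivative - U' 0 K (z t)) (at t)" and nc: "\<not> z constant_on UNIV"
    using bns unfolding bounded_nonconstant_solution_iff by metis
  obtain T where T: "T > 0" "periodic_fun_simple z T"
    using all bns by (auto simp: cond_all_semiloc_def periodic_commensurable_def is_period_def)
  have contz: "continuous_on A z" for A
    using z(2) by (meson DERIV_isCont continuous_at_imp_continuous_on)
  interpret periodic_fun_simple z T by (rule T(2))
  have "range z = z ` {0..T}"
  proof
    show "range z \<subseteq> z ` {0..T}"
    proof
      fix x assume "x \<in> range z"
      then obtain t where t: "x = z t" by auto
      define s where "s = t - of_int \<lfloor>t / T\<rfloor> * T"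
      have "s \<in> {0..T}"
        using floor_divide_lower[OF T(1), of t] floor_divide_upper[OF T(1), of t]
        by (auto simp: s_def algebra_simps)
      moreover have "z s = x" unfolding s_def t by (rule minus_of_int)
      ultimately show "x \<in> z ` {0..T}" by blast
    qed
  qed auto
  then have "compact (range z)" "connected (range z)"
    using compact_continuous_image[OF contz, of "{0..T}"] connected_continuous_image[OF contz, of "{0..T}"] by auto
  then obtain c d where cd: "range z = {c..d}" using connected_compact_interval_1 by blast
  have "c < d"
  proof (rule ccontr)
    assume "\<not> c < d"
    then have "z t = c" for t using cd by (metis atLeastAtMost_iff antisym_conv2 order_trans not_less rangeI)
    then show False using nc by (auto simp: constant_on_def)
  qed
  then obtain ta tb where ends: "z ta = c" "z tb = d" using cd by (metis atLeastAtMost_iff less_imp_le order_refl rangeE)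
  have sub: "{c..d} \<subseteq> I" using z(1) unfolding cd[symmetric] by auto
  have "\<exists>m. c < m \<and> m < d \<and> U' 0 K m = 0 \<and> U' 1 K m > 0"
  proof (rule commensurable_imp_nondegenerate_minimum[OF \<open>c < d\<close> _ _ _ z(2,3) ends])
    show "periodic_commensurable {y. bounded_nonconstant_solution I \<rho> \<Psi> K y \<and> range y \<subseteq> range z}"
      using all by (simp add: cond_all_semiloc_def)
    show "y \<in> {y. bounded_nonconstant_solution I \<rho> \<Psi> K y \<and> range y \<subseteq> range z}"
      if "\<forall>t. y t \<in> {c..d} \<and> (y has_real_derivative w t) (at t) \<and> (w has_real_derivative - U' 0 K (y t)) (at t)"
        "\<not> y constant_on UNIV" for y w
      using that sub cd bounded_nonconstant_solutionI[of y c d w K] by auto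
    show "(U' 0 K has_real_derivative U' 1 K x) (at x)" if "x \<in> {c..d}" for x
      using U'_DERIV[of x 0 K] that sub by auto
    show "continuous_on {c..d} (U' 1 K)" using sub by (rule continuous_on_U')
    show "z t \<in> {c..d}" for t using cd by auto
  qed
  then obtain m where "m \<in> {c..d}" "U' 0 K m = 0" "U' 1 K m > 0"
    by (metis less_imp_le atLeastAtMost_iff)
  then show ?thesis using sub nondeg_iff by blast
qed

text \<open>Start at \<open>z0\<close> with a small nonzero velocity. Stability speaks only about
  solutions that are already given and about positive times. So the solution is taken for the
  clamped force, which is global, and negative times are handled by reversing time; up to the first
  time at distance \<open>\<epsilon>\<close> it solves the original equation.\<close>

lemma stable_imp_bounded_nonconstant_solution:
  assumes stable: "stable_equilibrium I \<rho> \<Psi> K z0" and e: "e > 0"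
  obtains z where "bounded_nonconstant_solution I \<rho> \<Psi> K z" "range z \<subseteq> {z0 - e..z0 + e}"
proof -
  have z0: "z0 \<in> I" using stable by (auto simp: stable_equilibrium_def equilibrium_def)
  obtain e' where e': "e' > 0" "ball z0 e' \<subseteq> I" using open_I z0 open_contains_ball by blast
  define \<epsilon> where "\<epsilon> = min e (e' / 2)"
  have \<epsilon>: "\<epsilon> > 0" "\<epsilon> \<le> e" "\<epsilon> < e'" using e e' by (auto simp: \<epsilon>_def)
  define c d where "c = z0 - \<epsilon>" and "d = z0 + \<epsilon>"
  have cd: "c \<le> d" "{c..d} \<subseteq> I" using e'(2) \<epsilon> by (force simp: c_def d_def dist_real_def subset_iff)+
  obtain \<delta> where \<delta>: "\<delta> > 0"
    "\<And>T z v t. T > 0 \<Longrightarrow> solves_ode_on {0..<T} I \<rho> \<Psi> K z v \<Longrightarrow> dist (z 0, v 0) (z0, 0) < \<delta> \<Longrightarrow> t \<in> {0..<T} \<Longrightarrow>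
        dist (z t, v t) (z0, 0) < \<epsilon> / 2"
    using stable half_gt_zero[OF \<epsilon>(1)] unfolding stable_equilibrium_def by metis
  define F where "F x = - U' 0 K (max c (min d x))" for x
  have F: "F x = - U' 0 K x" if "x \<in> {c..d}" for x using that by (auto simp: F_def)
  obtain L M where "\<And>x y. \<bar>U' 0 K (max c (min d x)) - U' 0 K (max c (min d y))\<bar> \<le> L * \<bar>x - y\<bar>"
    "\<And>x. \<bar>U' 0 K (max c (min d x))\<bar> \<le> M"
    using clamped_lipschitz[OF cd(1), of "U' 0 K" "U' 1 K"] U'_DERIV[of _ 0 K] cd(2) continuous_on_U'[OF cd(2)]
    by (metis One_nat_def subsetD)
  then have lip: "\<And>x y. \<bar>F x - F y\<bar> \<le> L * \<bar>x - y\<bar>" and bdd: "\<And>x. \<bar>F x\<bar> \<le> M"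
    by (auto simp: F_def abs_minus_commute)
  have fwd: "\<bar>z t - z0\<bar> < \<epsilon>"
    if sol: "newton_solution F z v" and init: "z 0 = z0" "\<bar>v 0\<bar> < \<delta>" and "t \<ge> 0" for z v t
  proof (rule ccontr)
    assume neg: "\<not> \<bar>z t - z0\<bar> < \<epsilon>"
    have contz: "continuous_on A z" for A
      using sol by (meson DERIV_isCont continuous_at_imp_continuous_on newton_solution_def)
    define A where "A = {u \<in> {0..t}. \<bar>z u - z0\<bar> = \<epsilon>}"
    have contd: "continuous_on B (\<lambda>u. \<bar>z u - z0\<bar>)" for B
      by (intro continuous_intros contz)
    have "A \<noteq> {}"
      using IVT'[of "\<lambda>u. \<bar>z u - z0\<bar>" 0 \<epsilon> t, OF _ _ _ contd] neg \<open>t \<ge> 0\<close> init(1) \<epsilon>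
      by (auto simp: A_def)
    moreover have "compact A"
    proof -
      have "closedin (top_of_set {0..t}) A"
        unfolding A_def by (intro continuous_closedin_preimage_constant continuous_intros contz)
      then show ?thesis using closedin_compact by blast
    qed
    ultimately obtain u where u: "u \<in> A" "\<And>w. w \<in> A \<Longrightarrow> u \<le> w"
      using compact_attains_inf by metis
    have inside: "\<bar>z w - z0\<bar> \<le> \<epsilon>" if w: "w \<in> {0..<u}" for w
    proof (rule ccontr)
      assume *: "\<not> \<bar>z w - z0\<bar> \<le> \<epsilon>"
      then obtain x where "0 \<le> x" "x \<le> w" "\<bar>z x - z0\<bar> = \<epsilon>"
        using IVT'[of "\<lambda>u. \<bar>z u - z0\<bar>" 0 \<epsilon> w, OF _ _ _ contd] init(1) \<epsilon> w by auto
      then have "x \<in> A" using w u(1) by (auto simp: A_def)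
      then show False using u(2)[of x] w \<open>x \<le> w\<close> by auto
    qed
    have "u \<noteq> 0" using u(1) init(1) \<epsilon> by (auto simp: A_def)
    then have "u > 0" using u(1) by (auto simp: A_def)
    have ode: "solves_ode_on {0..<u} I \<rho> \<Psi> K z v"
      unfolding solves_ode_on_iff potential_deriv_eq
    proof (intro ballI conjI)
      fix s assume "s \<in> {0..<u}"
      then have "z s \<in> {c..d}" using inside[of s] by (auto simp: c_def d_def abs_le_iff)
      then show "z s \<in> I" "(v has_real_derivative - U' 0 K (z s)) (at s within {0..<u})"
        using cd(2) F[of "z s"] has_field_derivative_at_within[of v "F (z s)" s "{0..<u}"]
          sol[unfolded newton_solution_def, rule_format, of s]
        by auto
      show "(z has_real_derivative v s) (at s within {0..<u})"
        using has_field_derivative_at_within[of z "v s" s "{0..<u}"]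
          sol[unfolded newton_solution_def, rule_format, of s]
        by blast
    qed
    \<comment> \<open>Stability was invoked with \<open>\<epsilon> / 2\<close>, so that the strict
      estimate before time \<open>u\<close> still contradicts distance \<open>\<epsilon>\<close> at
      \<open>u\<close> in the limit.\<close>
    have "\<bar>z s - z0\<bar> \<le> \<epsilon> / 2" if "s \<in> {0..<u}" for s
    proof -
      have "dist (z s, v s) (z0, 0) < \<epsilon> / 2"
        by (rule \<delta>(2)[OF \<open>u > 0\<close> ode _ that]) (use init in \<open>simp add: dist_Pair_Pair dist_real_def\<close>)
      then show ?thesis using dist_fst_le[of "(z s, v s)" "(z0, 0)"] by (simp add: dist_real_def)
    qed
    then have "\<bar>z u - z0\<bar> \<le> \<epsilon> / 2"
      using continuous_le_on_closure[of "{0..<u}" "\<lambda>s. \<bar>z s - z0\<bar>" u "\<epsilon> / 2"] contd \<open>u > 0\<close> by auto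
    then show False using u(1) \<epsilon> by (auto simp: A_def)
  qed
  obtain z v where sol: "newton_solution F z v" and init: "z 0 = z0" "v 0 = \<delta> / 2"
    using newton_solution_exists[OF lip bdd, of z0 "\<delta> / 2"] by blast
  have zin: "\<bar>z t - z0\<bar> < \<epsilon>" for t
  proof (cases "t \<ge> 0")
    case True
    then show ?thesis using fwd[OF sol init(1)] init(2) \<delta>(1) by simp
  next
    case False
    then show ?thesis
      using fwd[OF newton_solution_reverse[OF sol], of "- t"] init \<delta>(1) by simp
  qed
  have zcd: "z t \<in> {c..d}" for t using zin[of t] unfolding c_def d_def by auto
  have "bounded_nonconstant_solution I \<rho> \<Psi> K z"
  proof (rule bounded_nonconstant_solutionI[OF zcd cd(2)])
    show "(z has_real_derivative v t) (at t)" "(v has_real_derivative - U' 0 K (z t)) (at t)" for t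
      using sol F[OF zcd] by (auto simp: newton_solution_def)
    show "\<not> z constant_on UNIV"
    proof
      assume "z constant_on UNIV"
      then obtain x where "z = (\<lambda>_. x)" by (auto simp: constant_on_def)
      then have "v 0 = 0" using sol DERIV_unique DERIV_const unfolding newton_solution_def by metis
      then show False using init \<delta>(1) by simp
    qed
  qed
  moreover have "{c..d} \<subseteq> {z0 - e..z0 + e}" using \<epsilon> by (auto simp: c_def d_def)
  then have "range z \<subseteq> {z0 - e..z0 + e}" using zcd by blast
  ultimately show thesis by (rule that)
qed

text \<open>The periods depend continuously on the amplitude and are rational multiples of
  \<open>T\<^sub>0\<close>, so they are constant and equal their limit at amplitude 0. Constancy
  yields the first conclusion, the limit the second. The external reference period
  \<open>T\<^sub>0\<close> allows equilibria for different \<open>K\<close> to be compared.\<close>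

lemma nondeg_small_oscillations:
  assumes nd: "nondeg_stable_equilibrium I \<rho> \<Psi> K x" and "e > 0"
    and S: "\<And>z. bounded_nonconstant_solution I \<rho> \<Psi> K z \<Longrightarrow> range z \<subseteq> {x - e..x + e} \<Longrightarrow> z \<in> S"
    and comm: "periodic_commensurable S" and z0: "z\<^sub>0 \<in> S" "is_period z\<^sub>0 T\<^sub>0"
  shows "5 * (U' 2 K x)\<^sup>2 = 3 * U' 1 K x * U' 3 K x" "2 * pi / sqrt (U' 1 K x) / T\<^sub>0 \<in> \<rat>"
proof -
  have x: "x \<in> I" "U' 0 K x = 0" "U' 1 K x > 0" using nd by (auto simp: nondeg_iff)
  obtain e' where e': "e' > 0" "ball x e' \<subseteq> I" using open_I x(1) open_contains_ball by blast
  define \<epsilon> where "\<epsilon> = min e (e' / 2)"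
  have \<epsilon>: "\<epsilon> > 0" "\<epsilon> \<le> e" "\<epsilon> < e'" using \<open>e > 0\<close> e' by (auto simp: \<epsilon>_def)
  have sub: "y \<in> I" if "\<bar>y - x\<bar> \<le> \<epsilon>" for y
    using e'(2) that \<epsilon>(3) by (auto simp: subset_iff dist_real_def abs_minus_commute)
  note T0 = \<open>is_period z\<^sub>0 T\<^sub>0\<close>
  have "T\<^sub>0 > 0" using T0 by (simp add: is_period_def)
  have "5 * (U' 2 K x)\<^sup>2 = 3 * U' 1 K x * U' 3 K x \<and> 2 * pi / sqrt (U' 1 K x) / T\<^sub>0 \<in> \<rat>"
  proof (rule small_oscillations[of \<epsilon> x "U' 0 K" "U' 1 K" "U' 2 K" "U' 3 K"
        "U' 1 K x" "U' 2 K x" "U' 3 K x"])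
    fix R :: real and T :: "real \<Rightarrow> real" and z v :: "real \<Rightarrow> real \<Rightarrow> real"
    assume R: "R > 0" and contT: "continuous_on {0..R} T" and T: "T 0 = 2 * pi / sqrt (U' 1 K x)"
      and per: "\<And>r. r \<in> {0<..R} \<Longrightarrow> is_period (z r) (T r)"
      and nc: "\<And>r. r \<in> {0<..R} \<Longrightarrow> \<not> z r constant_on UNIV"
      and zr: "\<And>r t. r \<in> {0<..R} \<Longrightarrow> \<bar>z r t - x\<bar> \<le> \<epsilon>"
      and zd: "\<And>r t. r \<in> {0<..R} \<Longrightarrow> (z r has_real_derivative v r t) (at t)"
      and vd: "\<And>r t. r \<in> {0<..R} \<Longrightarrow> (v r has_real_derivative - U' 0 K (z r t)) (at t)"
      and const: "(\<And>r. r \<in> {0<..R} \<Longrightarrow> T r = T 0) \<Longrightarrow> 5 * (U' 2 K x)\<^sup>2 = 3 * U' 1 K x * U' 3 K x"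
    have zS: "z r \<in> S" if r: "r \<in> {0<..R}" for r
    proof (rule S)
      show "bounded_nonconstant_solution I \<rho> \<Psi> K (z r)"
      proof (rule bounded_nonconstant_solutionI[of "z r" "x - \<epsilon>" "x + \<epsilon>" "v r"])
        show "{x - \<epsilon>..x + \<epsilon>} \<subseteq> I" using sub by (force simp: abs_le_iff)
        show "z r t \<in> {x - \<epsilon>..x + \<epsilon>}" for t using zr[OF r, of t] by (auto simp: abs_le_iff)
      qed (use zd[OF r] vd[OF r] nc[OF r] in auto)
      show "range (z r) \<subseteq> {x - e..x + e}"
      proof
        fix y assume "y \<in> range (z r)"
        then obtain t where "y = z r t" by auto
        then show "y \<in> {x - e..x + e}" using zr[OF r, of t] \<epsilon>(2) by (auto simp: abs_le_iff)
      qed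
    qed
    have rat: "T r / T\<^sub>0 \<in> \<rat>" if "r \<in> {0<..R}" for r
      using comm zS[OF that] per[OF that] z0 unfolding periodic_commensurable_def by blast
    have T_eq: "T r = T 0" if r: "r \<in> {0<..R}" for r
    proof (rule ccontr)
      assume "T r \<noteq> T 0"
      then have "min (T r) (T 0) < max (T r) (T 0)" by auto
      then obtain s where s: "min (T r) (T 0) < s" "s < max (T r) (T 0)" "s / T\<^sub>0 \<notin> \<rat>"
        using irrational_multiple_between[of "min (T r) (T 0)" "max (T r) (T 0)" T\<^sub>0] \<open>T\<^sub>0 > 0\<close>
        by (metis less_irrefl)
      have conn: "connected (T ` {0..R})" by (rule connected_continuous_image[OF contT connected_Icc])
      have "T r \<in> T ` {0..R}" "T 0 \<in> T ` {0..R}" using r by auto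
      then have "s \<in> T ` {0..R}"
        using connectedD_interval[OF conn, of "min (T r) (T 0)" "max (T r) (T 0)" s] s
        by (auto simp: min_def max_def split: if_splits)
      then obtain r' where r': "r' \<in> {0..R}" "T r' = s" by auto
      \<comment> \<open>\<open>T 0\<close> is only a limit of periods and not yet known to be a
        rational multiple of \<open>T\<^sub>0\<close>; the strict bounds on \<open>s\<close> exclude
        it.\<close>
      have "r' \<in> {0<..R} \<or> r' = 0" using r'(1) by auto
      then show False
      proof
        assume "r' = 0"
        then have "s = T 0" using r' by simp
        then show False using s by (auto simp: min_def max_def split: if_splits)
      qed (use rat r' s in blast)
    qed
    moreover from this have "5 * (U' 2 K x)\<^sup>2 = 3 * U' 1 K x * U' 3 K x" by (rule const)
    ultimately show "5 * (U' 2 K x)\<^sup>2 = 3 * U' 1 K x * U' 3 K x \<and> 2 * pi / sqrt (U' 1 K x) / T\<^sub>0 \<in> \<rat>"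
      using rat[of R] T R by (metis greaterThanAtMost_iff order_refl)
  next
    show "(U' 0 K has_real_derivative U' 1 K y) (at y)"
      "(U' 1 K has_real_derivative U' 2 K y) (at y)"
      "(U' 2 K has_real_derivative U' 3 K y) (at y)" if "\<bar>y - x\<bar> \<le> \<epsilon>" for y
      using U'_DERIV[OF sub[OF that], of 0 K] U'_DERIV[OF sub[OF that], of 1 K]
        U'_DERIV[OF sub[OF that], of 2 K] by (simp_all add: numeral_2_eq_2 numeral_3_eq_3)
    show "isCont (U' 3 K) x" using isCont_U'[OF x(1)] .
  qed (use \<epsilon> x in auto)
  then show "5 * (U' 2 K x)\<^sup>2 = 3 * U' 1 K x * U' 3 K x" "2 * pi / sqrt (U' 1 K x) / T\<^sub>0 \<in> \<rat>"
    by auto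
qed

end

section \<open>Local constancy of the frequency\<close>

lemma rational_multiples_constant:
  fixes \<phi> :: "'a::topological_space \<Rightarrow> real"
  assumes "connected S" "continuous_on S \<phi>" "T \<noteq> 0" and rat: "\<And>x. x \<in> S \<Longrightarrow> \<phi> x / T \<in> \<rat>"
    and xy: "x \<in> S" "y \<in> S"
  shows "\<phi> x = \<phi> y"
proof -
  have "\<not> \<phi> x < \<phi> y" if xy: "x \<in> S" "y \<in> S" for x y
  proof
    assume "\<phi> x < \<phi> y"
    then obtain s where s: "\<phi> x < s" "s < \<phi> y" "s / T \<notin> \<rat>"
      using irrational_multiple_between[OF _ \<open>T \<noteq> 0\<close>] by metis
    have "connected (\<phi> ` S)" using assms(1,2) by (rule connected_continuous_image[rotated])
    then have "s \<in> \<phi> ` S" using connectedD_interval[of "\<phi> ` S" "\<phi> x" "\<phi> y" s] xy s by auto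
    then show False using rat s(3) by auto
  qed
  then show ?thesis using xy by (meson linorder_neqE_linordered_idom)
qed

text \<open>For differentiating an identity that is known only on an open set.\<close>

lemma DERIV_zero_if_locally_zero:
  assumes "(f has_real_derivative D) (at x)" "open J" "x \<in> J" "\<And>y. y \<in> J \<Longrightarrow> f y = 0"
  shows "D = 0"
proof -
  have "((\<lambda>_. 0) has_real_derivative D) (at x)"
    using has_field_derivative_transform_within_open[OF assms(1-3)] assms(4) by simp
  then show ?thesis using DERIV_unique DERIV_const by blast
qed

context smooth_oscillator
begin

lemma isCont_deriv:
  assumes "x \<in> I"
  shows "isCont \<rho> x" "isCont \<Psi> x" "isCont (deriv \<rho>) x" "isCont (deriv \<Psi>) x"
  using isCont_\<rho>[OF assms, of 0] isCont_\<Psi>[OF assms, of 0] isCont_\<rho>[OF assms, of 1] isCont_\<Psi>[OF assms, of 1]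
  by simp_all

lemma U'_at_equilibrium:
  assumes "\<rho> x * \<Psi> x > 0" "K\<^sup>2 = \<Psi> x / \<rho> x"
  shows "U' n K x = (deriv ^^ n) \<rho> x - \<rho> x / \<Psi> x * (deriv ^^ n) \<Psi> x"
  using assms by (simp add: U'_def)

text \<open>The squared frequency of small oscillations about the equilibrium \<open>x\<close>.\<close>

definition freq2 :: "real \<Rightarrow> real" where
  "freq2 x = deriv \<rho> x - \<rho> x / \<Psi> x * deriv \<Psi> x"

lemma nondeg_if_freq2_pos:
  assumes "x \<in> I" "\<rho> x * \<Psi> x > 0" "K\<^sup>2 = \<Psi> x / \<rho> x" "freq2 x > 0"
  shows "nondeg_stable_equilibrium I \<rho> \<Psi> K x"
  using assms(1,2,4) unfolding nondeg_iff U'_at_equilibrium[OF assms(2,3)] freq2_def by auto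

lemma nondeg_imp_freq2_pos:
  assumes "nondeg_stable_equilibrium I \<rho> \<Psi> K x" "K \<noteq> 0" "\<rho> x \<noteq> 0"
  shows "x \<in> I" "\<rho> x * \<Psi> x > 0" "K\<^sup>2 = \<Psi> x / \<rho> x" "freq2 x > 0"
proof -
  have x: "x \<in> I" "U' 0 K x = 0" "U' 1 K x > 0" using assms(1) by (auto simp: nondeg_iff)
  show "x \<in> I" by fact
  have \<Psi>: "\<Psi> x = K\<^sup>2 * \<rho> x" using x(2) assms(2) by (simp add: U'_def field_simps)
  have "\<rho> x * \<Psi> x = (K * \<rho> x)\<^sup>2" unfolding \<Psi> by (simp add: power2_eq_square)
  then show pos: "\<rho> x * \<Psi> x > 0" using assms by simp
  show K2: "K\<^sup>2 = \<Psi> x / \<rho> x" unfolding \<Psi> using assms(3) by simp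
  show "freq2 x > 0" using x(3) unfolding U'_at_equilibrium[OF pos K2] by (simp add: freq2_def)
qed

text \<open>Every \<open>x\<close> near \<open>z\<^sub>0\<close> is a nondegenerate equilibrium for
  some parameter near \<open>K\<^sub>0\<close>. The local condition makes the small oscillations
  about all these points commensurable with one period \<open>T\<close>, so the limit periods
  \<open>2 * pi / sqrt (freq2 x)\<close> are rational multiples of \<open>T\<close>; being
  continuous in \<open>x\<close>, they are constant.\<close>

lemma freq2_locally_constant:
  assumes nd: "nondeg_stable_equilibrium I \<rho> \<Psi> K\<^sub>0 z\<^sub>0" and K0: "K\<^sub>0 \<noteq> 0" and near: "commensurable_near I \<rho> \<Psi> K\<^sub>0 z\<^sub>0"
    and nz: "\<rho> z\<^sub>0 \<noteq> 0"
  shows "\<exists>e>0. \<forall>x. \<bar>x - z\<^sub>0\<bar> < e \<longrightarrow> x \<in> I \<and> \<rho> x * \<Psi> x > 0 \<and> freq2 x = freq2 z\<^sub>0"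
    and "5 * (U' 2 K\<^sub>0 z\<^sub>0)\<^sup>2 = 3 * U' 1 K\<^sub>0 z\<^sub>0 * U' 3 K\<^sub>0 z\<^sub>0"
proof -
  note z0 = nondeg_imp_freq2_pos[OF nd K0 nz]
  obtain \<epsilon> \<delta> where \<epsilon>: "\<epsilon> > 0" and \<delta>: "\<delta> > 0" and comm: "periodic_commensurable
        {z. \<exists>K. K \<noteq> 0 \<and> K \<in> {K\<^sub>0 - \<delta> <..< K\<^sub>0 + \<delta>} \<and>
              bounded_nonconstant_solution I \<rho> \<Psi> K z \<and> range z \<subseteq> {z\<^sub>0 - \<epsilon> .. z\<^sub>0 + \<epsilon>}}" (is "periodic_commensurable ?S")
    using near unfolding commensurable_near_def by (elim exE conjE) (rule that)
  obtain z1 where z1: "bounded_nonconstant_solution I \<rho> \<Psi> K\<^sub>0 z1" "range z1 \<subseteq> {z\<^sub>0 - \<epsilon>..z\<^sub>0 + \<epsilon>}"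
    using stable_imp_bounded_nonconstant_solution[OF nondeg_imp_stable[OF nd] \<epsilon>] by metis
  have z1S: "z1 \<in> ?S" using z1 K0 \<delta> by auto
  then obtain T where T: "is_period z1 T" using comm by (auto simp: periodic_commensurable_def)
  have T0: "T > 0" using T by (simp add: is_period_def)
  have osc: "5 * (U' 2 K x)\<^sup>2 = 3 * U' 1 K x * U' 3 K x" "2 * pi / sqrt (U' 1 K x) / T \<in> \<rat>"
    if x: "nondeg_stable_equilibrium I \<rho> \<Psi> K x" "K \<noteq> 0" "\<bar>K - K\<^sub>0\<bar> < \<delta>" "\<bar>x - z\<^sub>0\<bar> < \<epsilon>" for x K
  proof -
    have S: "z \<in> ?S" if "bounded_nonconstant_solution I \<rho> \<Psi> K z" "range z \<subseteq> {x - (\<epsilon> - \<bar>x - z\<^sub>0\<bar>)..x + (\<epsilon> - \<bar>x - z\<^sub>0\<bar>)}" for z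
    proof -
      have "{x - (\<epsilon> - \<bar>x - z\<^sub>0\<bar>)..x + (\<epsilon> - \<bar>x - z\<^sub>0\<bar>)} \<subseteq> {z\<^sub>0 - \<epsilon>..z\<^sub>0 + \<epsilon>}" by auto
      then show ?thesis using that x by (auto intro!: exI[of _ K])
    qed
    have pos: "\<epsilon> - \<bar>x - z\<^sub>0\<bar> > 0" using x(4) by simp
    show "5 * (U' 2 K x)\<^sup>2 = 3 * U' 1 K x * U' 3 K x" "2 * pi / sqrt (U' 1 K x) / T \<in> \<rat>"
      by (rule nondeg_small_oscillations[OF x(1) pos _ comm z1S T], erule (1) S)+
  qed
  show "5 * (U' 2 K\<^sub>0 z\<^sub>0)\<^sup>2 = 3 * U' 1 K\<^sub>0 z\<^sub>0 * U' 3 K\<^sub>0 z\<^sub>0"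
    using osc(1)[OF nd K0] \<epsilon> \<delta> by simp
  \<comment> \<open>The parameter for which \<open>x\<close> is an equilibrium, on the branch of the
    square root that passes through \<open>K\<^sub>0\<close>.\<close>
  define K where "K x = sgn K\<^sub>0 * sqrt (\<Psi> x / \<rho> x)" for x
  have KK: "(K x)\<^sup>2 = \<Psi> x / \<rho> x" if "\<rho> x * \<Psi> x > 0" for x
  proof -
    have "\<Psi> x / \<rho> x > 0" using that by (simp add: zero_less_divide_iff zero_less_mult_iff conj_commute disj_commute)
    moreover have "(sgn K\<^sub>0)\<^sup>2 = 1" using K0 by (simp add: sgn_if)
    ultimately show ?thesis by (simp add: K_def power_mult_distrib)
  qed
  have Kz0: "K z\<^sub>0 = K\<^sub>0"
    unfolding K_def z0(3)[symmetric] by (simp add: sgn_mult_abs)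
  note cont = isCont_deriv[OF z0(1)]
  have nz\<Psi>: "\<Psi> z\<^sub>0 \<noteq> 0" using z0(2) by auto
  have "isCont K z\<^sub>0" "isCont freq2 z\<^sub>0" "isCont (\<lambda>x. \<rho> x * \<Psi> x) z\<^sub>0"
    unfolding K_def[abs_def] freq2_def[abs_def] using nz nz\<Psi> by (intro continuous_intros cont; simp)+
  then have lim: "(K \<longlongrightarrow> K\<^sub>0) (nhds z\<^sub>0)" "(freq2 \<longlongrightarrow> freq2 z\<^sub>0) (nhds z\<^sub>0)"
    "((\<lambda>x. \<rho> x * \<Psi> x) \<longlongrightarrow> \<rho> z\<^sub>0 * \<Psi> z\<^sub>0) (nhds z\<^sub>0)"
    using tendsto_at_iff_tendsto_nhds[of K z\<^sub>0] tendsto_at_iff_tendsto_nhds[of freq2 z\<^sub>0]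
      tendsto_at_iff_tendsto_nhds[of "\<lambda>x. \<rho> x * \<Psi> x" z\<^sub>0]
    by (simp_all add: isCont_def Kz0)
  have "\<forall>\<^sub>F x in nhds z\<^sub>0. \<bar>K x - K\<^sub>0\<bar> < \<delta>"
    using tendstoD[OF lim(1) \<delta>] by (simp add: dist_real_def)
  moreover have "\<forall>\<^sub>F x in nhds z\<^sub>0. freq2 x > 0" "\<forall>\<^sub>F x in nhds z\<^sub>0. \<rho> x * \<Psi> x > 0"
    using order_tendstoD(1)[OF lim(2) z0(4)] order_tendstoD(1)[OF lim(3) z0(2)] .
  moreover have "\<forall>\<^sub>F x in nhds z\<^sub>0. x \<in> I" using open_I z0(1) by (rule eventually_nhds_in_open)
  moreover have "\<forall>\<^sub>F x in nhds z\<^sub>0. \<bar>x - z\<^sub>0\<bar> < \<epsilon>"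
    using \<epsilon> unfolding eventually_nhds_metric by (auto simp: dist_real_def)
  ultimately have "\<forall>\<^sub>F x in nhds z\<^sub>0. \<bar>K x - K\<^sub>0\<bar> < \<delta> \<and> freq2 x > 0 \<and> \<rho> x * \<Psi> x > 0 \<and> x \<in> I \<and> \<bar>x - z\<^sub>0\<bar> < \<epsilon>"
    by eventually_elim simp
  then obtain e where e: "e > 0" "\<And>x. \<bar>x - z\<^sub>0\<bar> < e \<Longrightarrow> \<bar>K x - K\<^sub>0\<bar> < \<delta> \<and> freq2 x > 0 \<and> \<rho> x * \<Psi> x > 0 \<and> x \<in> I \<and> \<bar>x - z\<^sub>0\<bar> < \<epsilon>"
    unfolding eventually_nhds_metric dist_real_def by auto
  define \<phi> where "\<phi> x = 2 * pi / sqrt (freq2 x)" for x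
  have "\<phi> x / T \<in> \<rat>" if "x \<in> ball z\<^sub>0 e" for x
  proof -
    have x: "\<bar>K x - K\<^sub>0\<bar> < \<delta>" "freq2 x > 0" "\<rho> x * \<Psi> x > 0" "x \<in> I" "\<bar>x - z\<^sub>0\<bar> < \<epsilon>"
      using e(2)[of x] that by (auto simp: dist_real_def abs_minus_commute)
    have "K x \<noteq> 0" using KK[OF x(3)] x(3) by auto
    then show ?thesis
      using osc(2)[OF nondeg_if_freq2_pos[OF x(4,3) KK[OF x(3)] x(2)] _ x(1,5)] U'_at_equilibrium[OF x(3) KK[OF x(3)], of 1]
      by (simp add: \<phi>_def freq2_def)
  qed
  moreover have "continuous_on (ball z\<^sub>0 e) \<phi>"
  proof (intro continuous_at_imp_continuous_on ballI)
    fix x assume "x \<in> ball z\<^sub>0 e"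
    then have x: "freq2 x > 0" "\<rho> x * \<Psi> x > 0" "x \<in> I"
      using e(2)[of x] by (auto simp: dist_real_def abs_minus_commute)
    then have "isCont freq2 x"
      unfolding freq2_def[abs_def] by (intro continuous_intros isCont_deriv) auto
    then show "isCont \<phi> x" unfolding \<phi>_def using x(1) by (intro continuous_intros) auto
  qed
  ultimately have \<phi>: "\<phi> x = \<phi> z\<^sub>0" if "x \<in> ball z\<^sub>0 e" for x
    using rational_multiples_constant[of "ball z\<^sub>0 e" \<phi> T x z\<^sub>0] T0 that e(1) by simp
  have "freq2 x = freq2 z\<^sub>0" if "\<bar>x - z\<^sub>0\<bar> < e" for x
  proof -
    have "freq2 x > 0" using e(2)[OF that] by simp
    moreover have "\<phi> x = \<phi> z\<^sub>0" using that by (intro \<phi>) (auto simp: dist_real_def abs_minus_commute)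
    ultimately show ?thesis using z0(4) by (simp add: \<phi>_def)
  qed
  then show "\<exists>e>0. \<forall>x. \<bar>x - z\<^sub>0\<bar> < e \<longrightarrow> x \<in> I \<and> \<rho> x * \<Psi> x > 0 \<and> freq2 x = freq2 z\<^sub>0"
    using e by blast
qed

end

text \<open>Twice differentiating the reciprocal of the real cube root of \<open>\<psi>\<close>
  gives 0 by the equation; the odd root admits either sign of \<open>\<psi>\<close>. The conclusion
  is a product equal to 1, a closed condition which still excludes zeros of \<open>\<psi>\<close> at
  limit points.\<close>

lemma cubic_reciprocal_if_second_order_ode:
  fixes \<psi> \<psi>1 \<psi>2 :: "real \<Rightarrow> real"
  assumes "open J" "convex J"
    and \<psi>: "\<And>x. x \<in> J \<Longrightarrow> (\<psi> has_real_derivative \<psi>1 x) (at x)"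
    and \<psi>1: "\<And>x. x \<in> J \<Longrightarrow> (\<psi>1 has_real_derivative \<psi>2 x) (at x)"
    and nz: "\<And>x. x \<in> J \<Longrightarrow> \<psi> x \<noteq> 0"
    and ode: "\<And>x. x \<in> J \<Longrightarrow> 3 * \<psi> x * \<psi>2 x = 4 * (\<psi>1 x)\<^sup>2"
  shows "\<exists>\<alpha> \<beta>. \<forall>x\<in>J. \<psi> x * (\<alpha> * x + \<beta>) ^ 3 = 1"
proof -
  define s where "s x = root 3 (\<psi> x)" for x
  have s3: "s x ^ 3 = \<psi> x" for x by (simp add: s_def odd_real_root_pow)
  have snz: "s x \<noteq> 0" if "x \<in> J" for x using nz[OF that] by (simp add: s_def)
  have sd: "(s has_real_derivative \<psi>1 x / (3 * (s x)\<^sup>2)) (at x)" if x: "x \<in> J" for x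
  proof -
    have odd3: "odd (3::nat)" by simp
    have "((\<lambda>x. root 3 (\<psi> x)) has_real_derivative
        inverse (real 3 * root 3 (\<psi> x) ^ (3 - Suc 0)) * \<psi>1 x) (at x)"
      by (rule DERIV_chain2[OF DERIV_odd_real_root[OF odd3 nz[OF x]] \<psi>[OF x]])
    moreover have "inverse (real 3 * root 3 (\<psi> x) ^ (3 - Suc 0)) * \<psi>1 x = \<psi>1 x / (3 * (s x)\<^sup>2)"
    proof -
      have "(3::nat) - Suc 0 = 2" by simp
      then show ?thesis by (simp only: s_def divide_inverse) (simp add: mult.commute)
    qed
    moreover have "(\<lambda>x. root 3 (\<psi> x)) = s" by (simp add: s_def fun_eq_iff)
    ultimately show ?thesis by metis
  qed
  define h1 where "h1 x = - (\<psi>1 x / (3 * s x ^ 4))" for x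
  have hd: "((\<lambda>x. 1 / s x) has_real_derivative h1 x) (at x)" if x: "x \<in> J" for x
    using snz[OF x] by (auto intro!: derivative_eq_intros sd[OF x] simp: h1_def field_simps eval_nat_numeral)
  have h1d: "(h1 has_real_derivative 0) (at x)" if x: "x \<in> J" for x
  proof -
    have "(h1 has_real_derivative - ((\<psi>2 x * (3 * s x ^ 4) - \<psi>1 x * (3 * (4 * s x ^ 3 * (\<psi>1 x / (3 * (s x)\<^sup>2))))) / (3 * s x ^ 4)\<^sup>2)) (at x)"
      unfolding h1_def[abs_def] using snz[OF x]
      by (auto intro!: derivative_eq_intros sd[OF x] \<psi>1[OF x] simp: power2_eq_square)
    moreover have "\<psi>2 x * (3 * s x ^ 4) - \<psi>1 x * (3 * (4 * s x ^ 3 * (\<psi>1 x / (3 * (s x)\<^sup>2)))) = 0"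
    proof -
      have "\<psi>2 x * (3 * s x ^ 4) - \<psi>1 x * (3 * (4 * s x ^ 3 * (\<psi>1 x / (3 * (s x)\<^sup>2)))) =
          s x * (3 * s x ^ 3 * \<psi>2 x - 4 * (\<psi>1 x)\<^sup>2)"
        using snz[OF x] by (simp add: field_simps eval_nat_numeral)
      then show ?thesis using ode[OF x] by (simp add: s3)
    qed
    ultimately show ?thesis by simp
  qed
  obtain \<alpha> where \<alpha>: "\<And>x. x \<in> J \<Longrightarrow> h1 x = \<alpha>"
    using has_field_derivative_zero_constant[OF \<open>convex J\<close>, of h1] h1d has_field_derivative_at_within by metis
  have "((\<lambda>x. 1 / s x - \<alpha> * x) has_real_derivative 0) (at x)" if x: "x \<in> J" for x
    using DERIV_diff[OF hd[OF x] DERIV_cmult[OF DERIV_ident, of \<alpha>]] \<alpha>[OF x] by simp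
  then obtain \<beta> where \<beta>: "\<And>x. x \<in> J \<Longrightarrow> 1 / s x - \<alpha> * x = \<beta>"
    using has_field_derivative_zero_constant[OF \<open>convex J\<close>, of "\<lambda>x. 1 / s x - \<alpha> * x"]
      has_field_derivative_at_within by metis
  have "\<psi> x * (\<alpha> * x + \<beta>) ^ 3 = 1" if x: "x \<in> J" for x
  proof -
    have "\<alpha> * x + \<beta> = 1 / s x" using \<beta>[OF x] by simp
    then have "\<psi> x * (\<alpha> * x + \<beta>) ^ 3 = s x ^ 3 * (1 / s x) ^ 3" by (simp only: s3)
    also have "\<dots> = 1" using snz[OF x] by (simp add: power_divide)
    finally show ?thesis .
  qed
  then show ?thesis by blast
qed

section \<open>The equation for the closing function and its extension to the whole interval\<close>

context smooth_oscillator
begin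

text \<open>Differentiating the linear relation twice expresses the derivatives of the potential at
  \<open>x\<close> through \<open>\<Psi>\<close> alone: \<open>\<Psi> * U' 1 = c * \<Psi>\<close>,
  \<open>\<Psi> * U' 2 = c * \<Psi>'\<close> and \<open>\<Psi>\<^sup>2 * U' 3 = c * (2 * \<Psi> *
  \<Psi>'' - \<Psi>'\<^sup>2)\<close>. Substituted into \<open>iso\<close>, this leaves \<open>5 *
  \<Psi>'\<^sup>2 = 3 * (2 * \<Psi> * \<Psi>'' - \<Psi>'\<^sup>2)\<close>.\<close>

lemma second_order_ode_if_freq2_constant:
  assumes J: "open J" "J \<subseteq> I" and c: "c > 0"
    and lin: "\<And>y. y \<in> J \<Longrightarrow> deriv \<rho> y * \<Psi> y - \<rho> y * deriv \<Psi> y = c * \<Psi> y"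
    and x: "x \<in> J" and pos: "\<rho> x * \<Psi> x > 0" and K: "K\<^sup>2 = \<Psi> x / \<rho> x"
    and iso: "5 * (U' 2 K x)\<^sup>2 = 3 * U' 1 K x * U' 3 K x"
  shows "3 * \<Psi> x * (deriv ^^ 2) \<Psi> x = 4 * (deriv \<Psi> x)\<^sup>2"
proof -
  define r where "r n y = (deriv ^^ n) \<rho> y" for n y
  define p where "p n y = (deriv ^^ n) \<Psi> y" for n y
  have rd: "(r n has_real_derivative r (Suc n) y) (at y)" and pd: "(p n has_real_derivative p (Suc n) y) (at y)"
    if "y \<in> J" for n y
    using \<rho>_DERIV[of y n] \<Psi>_DERIV[of y n] that J(2) by (auto simp: r_def[abs_def] p_def[abs_def])
  have 0: "r 1 y * p 0 y - r 0 y * p 1 y - c * p 0 y = 0" if "y \<in> J" for y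
    using lin[OF that] by (simp add: r_def p_def)
  have 1: "r 2 y * p 0 y - r 0 y * p 2 y - c * p 1 y = 0" if y: "y \<in> J" for y
  proof (rule DERIV_zero_if_locally_zero[OF _ J(1) y 0])
    show "((\<lambda>y. r 1 y * p 0 y - r 0 y * p 1 y - c * p 0 y) has_real_derivative
        r 2 y * p 0 y - r 0 y * p 2 y - c * p 1 y) (at y)"
      using rd[OF y, of 0] rd[OF y, of 1] pd[OF y, of 0] pd[OF y, of 1]
      by (auto intro!: derivative_eq_intros simp: numeral_2_eq_2)
  qed
  have 2: "r 3 x * p 0 x + r 2 x * p 1 x - r 1 x * p 2 x - r 0 x * p 3 x - c * p 2 x = 0"
  proof (rule DERIV_zero_if_locally_zero[OF _ J(1) x 1])
    show "((\<lambda>y. r 2 y * p 0 y - r 0 y * p 2 y - c * p 1 y) has_real_derivative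
        r 3 x * p 0 x + r 2 x * p 1 x - r 1 x * p 2 x - r 0 x * p 3 x - c * p 2 x) (at x)"
      using rd[OF x, of 0] rd[OF x, of 2] pd[OF x, of 0] pd[OF x, of 1] pd[OF x, of 2]
      by (auto intro!: derivative_eq_intros simp: numeral_2_eq_2 numeral_3_eq_3)
  qed
  have nz: "p 0 x \<noteq> 0" using pos by (auto simp: p_def)
  have U: "p 0 x * U' n K x = r n x * p 0 x - r 0 x * p n x" for n
    unfolding U'_at_equilibrium[OF pos K] using nz by (simp add: r_def p_def field_simps)
  have U1: "p 0 x * U' 1 K x = c * p 0 x" using U[of 1] 0[OF x] by simp
  have U2: "p 0 x * U' 2 K x = c * p 1 x" using U[of 2] 1[OF x] by simp
  have U3: "p 0 x * (p 0 x * U' 3 K x) = c * (2 * p 0 x * p 2 x - (p 1 x)\<^sup>2)"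
  proof -
    have "p 0 x * U' 3 K x = c * p 2 x - r 2 x * p 1 x + r 1 x * p 2 x"
      using U[of 3] 2 by simp
    then have "p 0 x * (p 0 x * U' 3 K x) = p 0 x * (c * p 2 x - r 2 x * p 1 x + r 1 x * p 2 x)"
      by (rule arg_cong)
    also have "\<dots> = c * p 2 x * p 0 x - (r 2 x * p 0 x) * p 1 x + (r 1 x * p 0 x) * p 2 x"
      by (simp add: algebra_simps)
    also have "r 2 x * p 0 x = r 0 x * p 2 x + c * p 1 x" using 1[OF x] by simp
    also have "r 1 x * p 0 x = r 0 x * p 1 x + c * p 0 x" using 0[OF x] by simp
    finally show ?thesis by (simp add: algebra_simps power2_eq_square)
  qed
  have "5 * (p 0 x * U' 2 K x)\<^sup>2 * p 0 x = (p 0 x) ^ 3 * (5 * (U' 2 K x)\<^sup>2)"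
    by (simp add: power2_eq_square power3_eq_cube)
  also have "\<dots> = 3 * (p 0 x * U' 1 K x) * (p 0 x * (p 0 x * U' 3 K x))"
    unfolding iso by (simp add: power3_eq_cube)
  finally have "c\<^sup>2 * p 0 x * (5 * (p 1 x)\<^sup>2) = c\<^sup>2 * p 0 x * (3 * (2 * p 0 x * p 2 x - (p 1 x)\<^sup>2))"
    unfolding U1 U2 U3 by (simp add: power2_eq_square mult_ac)
  then have "5 * (p 1 x)\<^sup>2 = 3 * (2 * p 0 x * p 2 x - (p 1 x)\<^sup>2)" using c nz by simp
  then show ?thesis by (simp add: p_def)
qed

text \<open>The identities are first derived on one component of the set \<open>O'\<close> of points
  that are nondegenerate equilibria for some \<open>K\<close>. They then survive at limit points in
  \<open>I\<close> and force these into \<open>O'\<close> again, so by connectedness the component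
  is all of \<open>I\<close>.\<close>

lemma locally_closing_structure:
  assumes lc: "locally_closing I \<rho> \<Psi>" and nz: "\<And>x. x \<in> I \<Longrightarrow> \<rho> x \<noteq> 0"
  obtains c \<alpha> \<beta> where "c > 0" "\<And>x. x \<in> I \<Longrightarrow> \<rho> x * \<Psi> x > 0"
    "\<And>x. x \<in> I \<Longrightarrow> deriv \<rho> x * \<Psi> x - \<rho> x * deriv \<Psi> x = c * \<Psi> x"
    "\<And>x. x \<in> I \<Longrightarrow> \<Psi> x * (\<alpha> * x + \<beta>) ^ 3 = 1"
proof -
  define O' where "O' = {x \<in> I. \<rho> x * \<Psi> x > 0 \<and> freq2 x > 0}"
  have O': "x \<in> I" "\<rho> x * \<Psi> x > 0" "freq2 x > 0" if "x \<in> O'" for x using that by (auto simp: O'_def)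
  have local: "\<exists>K. K\<^sup>2 = \<Psi> x / \<rho> x \<and> 5 * (U' 2 K x)\<^sup>2 = 3 * U' 1 K x * U' 3 K x"
    "\<exists>e>0. \<forall>y. \<bar>y - x\<bar> < e \<longrightarrow> y \<in> O' \<and> freq2 y = freq2 x" if x: "x \<in> O'" for x
  proof -
    define K where "K = sqrt (\<Psi> x / \<rho> x)"
    have "\<Psi> x / \<rho> x > 0" using O'(2)[OF x] by (auto simp: zero_less_divide_iff zero_less_mult_iff)
    then have K: "K\<^sup>2 = \<Psi> x / \<rho> x" "K \<noteq> 0" by (auto simp: K_def)
    have nd: "nondeg_stable_equilibrium I \<rho> \<Psi> K x"
      using nondeg_if_freq2_pos[OF O'(1,2)[OF x] K(1) O'(3)[OF x]] .
    then have near: "commensurable_near I \<rho> \<Psi> K x"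
      using lc K(2) by (auto simp: locally_closing_def cond_all_loc_def)
    note f = freq2_locally_constant[OF nd K(2) near nz[OF O'(1)[OF x]]]
    show "\<exists>K. K\<^sup>2 = \<Psi> x / \<rho> x \<and> 5 * (U' 2 K x)\<^sup>2 = 3 * U' 1 K x * U' 3 K x"
      using f(2) K(1) by blast
    show "\<exists>e>0. \<forall>y. \<bar>y - x\<bar> < e \<longrightarrow> y \<in> O' \<and> freq2 y = freq2 x"
    proof -
      obtain e where e: "e > 0"
        "\<And>y. \<bar>y - x\<bar> < e \<Longrightarrow> y \<in> I \<and> \<rho> y * \<Psi> y > 0 \<and> freq2 y = freq2 x"
        using f(1) by blast
      have "y \<in> O' \<and> freq2 y = freq2 x" if "\<bar>y - x\<bar> < e" for y
      proof -
        have "freq2 y > 0" using e(2)[OF that] O'(3)[OF x] by argo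
        then show ?thesis using e(2)[OF that] unfolding O'_def by blast
      qed
      then show ?thesis using e(1) by blast
    qed
  qed
  have "open O'"
    unfolding open_dist dist_real_def using local(2) by blast
  obtain K\<^sub>1 z\<^sub>1 where "K\<^sub>1 \<noteq> 0" "nondeg_stable_equilibrium I \<rho> \<Psi> K\<^sub>1 z\<^sub>1"
    using lc by (auto simp: locally_closing_def cond_ex_loc_def)
  moreover from this have "z\<^sub>1 \<in> I" by (simp add: nondeg_iff)
  ultimately have z1: "z\<^sub>1 \<in> O'"
    using nondeg_imp_freq2_pos[of K\<^sub>1 z\<^sub>1] nz[of z\<^sub>1] by (auto simp: O'_def)
  \<comment> \<open>\<open>freq2\<close> is only locally constant on \<open>O'\<close>; a single
    constant \<open>c\<close> requires a connected piece.\<close>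
  define J where "J = connected_component_set O' z\<^sub>1"
  have J: "open J" "connected J" "J \<subseteq> O'" "z\<^sub>1 \<in> J"
    using z1 \<open>open O'\<close> by (auto simp: J_def open_connected_component connected_component_subset)
  have "convex J" using J(2) by (simp add: is_interval_connected_1 is_interval_convex_1[symmetric])
  have JI: "J \<subseteq> I" using J(3) O'(1) by blast
  define c where "c = freq2 z\<^sub>1"
  have c: "c > 0" using O'(3)[OF z1] by (simp add: c_def)
  have "(freq2 has_real_derivative 0) (at x within J)" if x: "x \<in> J" for x
  proof -
    obtain e where e: "e > 0" "\<And>y. \<bar>y - x\<bar> < e \<Longrightarrow> freq2 y = freq2 x"
      using local(2)[of x] x J(3) by blast
    show ?thesis
    proof (rule has_field_derivative_transform_within[OF DERIV_const[of "freq2 x"] e(1) x])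
      show "freq2 x = freq2 y" if "y \<in> J" "dist y x < e" for y
        using e(2)[of y] that(2) unfolding dist_real_def by argo
    qed
  qed
  then obtain k where "\<And>x. x \<in> J \<Longrightarrow> freq2 x = k"
    using has_field_derivative_zero_constant[OF \<open>convex J\<close>, of freq2] by blast
  then have fc: "freq2 x = c" if "x \<in> J" for x using that J(4) by (simp add: c_def)
  have \<Psi>nz: "\<Psi> x \<noteq> 0" if "x \<in> O'" for x using O'(2)[OF that] by auto
  have lin: "deriv \<rho> x * \<Psi> x - \<rho> x * deriv \<Psi> x = c * \<Psi> x" if "x \<in> J" for x
    using fc[OF that] \<Psi>nz[of x] that J(3) by (auto simp: freq2_def field_simps)
  have ode: "3 * \<Psi> x * (deriv ^^ 2) \<Psi> x = 4 * (deriv \<Psi> x)\<^sup>2" if x: "x \<in> J" for x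
  proof -
    have xO: "x \<in> O'" using x J(3) by blast
    obtain K where K: "K\<^sup>2 = \<Psi> x / \<rho> x" "5 * (U' 2 K x)\<^sup>2 = 3 * U' 1 K x * U' 3 K x"
      using local(1)[OF xO] by blast
    show ?thesis
      by (rule second_order_ode_if_freq2_constant[OF J(1) JI c lin x O'(2)[OF xO] K])
  qed
  have "\<exists>\<alpha> \<beta>. \<forall>x\<in>J. \<Psi> x * (\<alpha> * x + \<beta>) ^ 3 = 1"
  proof (rule cubic_reciprocal_if_second_order_ode[OF J(1) \<open>convex J\<close>])
    fix x assume "x \<in> J"
    then show "(\<Psi> has_real_derivative deriv \<Psi> x) (at x)"
      "(deriv \<Psi> has_real_derivative (deriv ^^ 2) \<Psi> x) (at x)" "\<Psi> x \<noteq> 0"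
      "3 * \<Psi> x * (deriv ^^ 2) \<Psi> x = 4 * (deriv \<Psi> x)\<^sup>2"
      using \<Psi>_DERIV[of x 0] \<Psi>_DERIV[of x 1] JI \<Psi>nz J(3) ode by (auto simp: numeral_2_eq_2)
  qed
  then obtain \<alpha> \<beta> where \<alpha>\<beta>: "\<And>x. x \<in> J \<Longrightarrow> \<Psi> x * (\<alpha> * x + \<beta>) ^ 3 = 1" by blast
  \<comment> \<open>The identities valid on \<open>J\<close> are closed conditions and imply membership in \<open>O'\<close>; thus \<open>J\<close> is closed in \<open>I\<close>.\<close>
  define B where "B = {x \<in> I. (\<Psi> x * (\<alpha> * x + \<beta>) ^ 3, deriv \<rho> x * \<Psi> x - \<rho> x * deriv \<Psi> x - c * \<Psi> x) = (1, 0)}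
      \<inter> (I \<inter> (\<lambda>x. \<rho> x * \<Psi> x) -` {0..})"
  have B: "\<rho> x * \<Psi> x > 0" "\<Psi> x * (\<alpha> * x + \<beta>) ^ 3 = 1" "deriv \<rho> x * \<Psi> x - \<rho> x * deriv \<Psi> x = c * \<Psi> x" if "x \<in> B" for x
  proof -
    show *: "\<Psi> x * (\<alpha> * x + \<beta>) ^ 3 = 1" "deriv \<rho> x * \<Psi> x - \<rho> x * deriv \<Psi> x = c * \<Psi> x"
      using that by (auto simp: B_def)
    \<comment> \<open>\<open>B\<close> contains only the closed condition
      \<open>\<rho> x * \<Psi> x \<ge> 0\<close>; the cubic identity and \<open>nz\<close> make it
      strict.\<close>
    have "\<Psi> x \<noteq> 0" using *(1) by auto
    then have "\<rho> x * \<Psi> x \<noteq> 0" using nz[of x] that by (auto simp: B_def)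
    moreover have "\<rho> x * \<Psi> x \<ge> 0" using that by (auto simp: B_def)
    ultimately show "\<rho> x * \<Psi> x > 0" by argo
  qed
  have cont: "continuous_on I \<rho>" "continuous_on I \<Psi>" "continuous_on I (deriv \<rho>)" "continuous_on I (deriv \<Psi>)"
    using isCont_deriv by (auto intro: continuous_at_imp_continuous_on)
  have "closedin (top_of_set I) B"
    unfolding B_def
    by (intro closedin_Int[OF continuous_closedin_preimage_constant continuous_closedin_preimage]
        continuous_intros cont)
  moreover have "B \<subseteq> O'"
  proof
    fix x assume x: "x \<in> B"
    have "\<Psi> x \<noteq> 0" using B(1)[OF x] by auto
    then have "freq2 x = c" using B(3)[OF x] by (simp add: freq2_def field_simps)
    then show "x \<in> O'" using x B(1)[OF x] c by (auto simp: O'_def B_def)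
  qed
  moreover have "J \<subseteq> B"
    using \<alpha>\<beta> lin JI J(3) O'(2) by (auto simp: B_def less_imp_le)
  moreover have "closedin (top_of_set O') J" unfolding J_def by (rule closedin_connected_component)
  ultimately have "closedin (top_of_set I) J"
    using closedin_subset_trans closedin_trans by metis
  moreover have "openin (top_of_set I) J" using J(1) JI by (simp add: open_openin_trans openin_open_eq[OF open_I])
  ultimately have "J = I" using connected_clopen[of I] connected_I J(4) by blast
  then show thesis
    using that[of c \<alpha> \<beta>] c \<open>J \<subseteq> B\<close> B by blast
qed

end
section \<open>Explicit closing functions\<close>

lemma connected_imp_constant_sign:
  fixes f :: "real \<Rightarrow> real"
  assumes "connected I" "continuous_on I f" "\<And>x. x \<in> I \<Longrightarrow> f x \<noteq> 0"
  obtains s :: real where "s = 1 \<or> s = -1" "\<And>x. x \<in> I \<Longrightarrow> s * f x > 0"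
proof -
  have conn: "connected (f ` I)" using assms(1,2) by (rule connected_continuous_image[rotated])
  have "(\<forall>x\<in>I. f x > 0) \<or> (\<forall>x\<in>I. f x < 0)"
  proof (rule ccontr)
    assume "\<not> ?thesis"
    then obtain x y where "x \<in> I" "f x \<le> 0" "y \<in> I" "0 \<le> f y" by (meson not_less)
    then have "0 \<in> f ` I" using connectedD_interval[OF conn, of "f x" "f y" 0] by auto
    then show False using assms(3) by force
  qed
  then show thesis using that[of 1] that[of "-1"] by auto
qed

text \<open>The equation is then a harmonic oscillator of angular frequency \<open>sqrt k\<close>,
  and \<open>K\<close> merely moves its centre.\<close>

definition harmonic_pair :: "real set \<Rightarrow> (real \<Rightarrow> real) \<Rightarrow> (real \<Rightarrow> real) \<Rightarrow> real \<Rightarrow> real \<Rightarrow> real \<Rightarrow> bool" where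
  "harmonic_pair I \<rho> \<Psi> k A e \<longleftrightarrow> k > 0 \<and> (\<forall>x\<in>I. \<Psi> x = A \<and> \<rho> x = k * x + e \<and> A * \<rho> x > 0)"

text \<open>In \<open>u = x - \<zeta>\<close> the force is linear plus an inverse cube, the isotonic
  oscillator. \<open>D = 0\<close> is allowed: \<open>\<rho>\<close> is then linear and
  \<open>\<Psi>\<close> is the second closing function of the case of constant
  \<open>\<rho>'\<close>.\<close>

definition isotonic_pair :: "real set \<Rightarrow> (real \<Rightarrow> real) \<Rightarrow> (real \<Rightarrow> real) \<Rightarrow> real \<Rightarrow> real \<Rightarrow> real \<Rightarrow> real \<Rightarrow> bool" where
  "isotonic_pair I \<rho> \<Psi> \<kappa> A \<zeta> D \<longleftrightarrow> \<kappa> > 0 \<and> \<zeta> \<notin> I \<and> (\<forall>x\<in>I. \<Psi> x = A / (x - \<zeta>) ^ 3 \<and>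
     \<rho> x = \<kappa> * ((x - \<zeta>) ^ 4 + D) / (x - \<zeta>) ^ 3 \<and> A * ((x - \<zeta>) ^ 4 + D) > 0)"

lemma isotonic_pair_product_pos:
  assumes "isotonic_pair I \<rho> \<Psi> \<kappa> A \<zeta> D" "x \<in> I"
  shows "\<rho> x * \<Psi> x > 0"
proof -
  define u where "u = x - \<zeta>"
  have u: "u \<noteq> 0" using assms by (auto simp: u_def isotonic_pair_def)
  have eq: "\<rho> x * \<Psi> x = \<kappa> * (A * (u ^ 4 + D)) / (u ^ 3 * u ^ 3)"
    using assms by (simp add: isotonic_pair_def u_def)
  have uu: "u ^ 3 * u ^ 3 > 0" using u by (simp add: zero_less_mult_iff not_less_iff_gr_or_eq)
  have "\<kappa> > 0" "A * (u ^ 4 + D) > 0" using assms by (auto simp: isotonic_pair_def u_def)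
  then show ?thesis unfolding eq by (rule divide_pos_pos[OF mult_pos_pos uu])
qed

context smooth_oscillator
begin

lemma convex_I: "convex I"
  using connected_I by (simp add: is_interval_connected_1 is_interval_convex_1[symmetric])

lemma DERIV_\<rho>\<Psi>:
  assumes "x \<in> I"
  shows "(\<rho> has_real_derivative deriv \<rho> x) (at x)" "(\<Psi> has_real_derivative deriv \<Psi> x) (at x)"
  using \<rho>_DERIV[OF assms, of 0] \<Psi>_DERIV[OF assms, of 0] by simp_all

text \<open>The slope \<open>\<alpha>\<close> of the affine function decides: slope 0 makes
  \<open>\<Psi>\<close> constant and \<open>\<rho>\<close> linear, otherwise \<open>\<zeta>\<close>
  is the zero of the affine function. It lies outside \<open>I\<close> because the cubic identity
  fails there.\<close>

lemma locally_closing_imp_pair: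
  assumes "locally_closing I \<rho> \<Psi>" and nz: "\<And>x. x \<in> I \<Longrightarrow> \<rho> x \<noteq> 0"
  shows "(\<exists>k A e. harmonic_pair I \<rho> \<Psi> k A e) \<or> (\<exists>\<kappa> A \<zeta> D. isotonic_pair I \<rho> \<Psi> \<kappa> A \<zeta> D)"
proof -
  obtain c \<alpha> \<beta> where c: "c > 0" and pos: "\<And>x. x \<in> I \<Longrightarrow> \<rho> x * \<Psi> x > 0"
    and lin: "\<And>x. x \<in> I \<Longrightarrow> deriv \<rho> x * \<Psi> x - \<rho> x * deriv \<Psi> x = c * \<Psi> x"
    and cub: "\<And>x. x \<in> I \<Longrightarrow> \<Psi> x * (\<alpha> * x + \<beta>) ^ 3 = 1"
    using locally_closing_structure[OF assms] by blast
  have \<Psi>nz: "\<Psi> x \<noteq> 0" if "x \<in> I" for x using pos[OF that] by auto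
  show ?thesis
  proof (cases "\<alpha> = 0")
    case True
    define A where "A = 1 / \<beta> ^ 3"
    have \<Psi>: "\<Psi> x = A" if "x \<in> I" for x
      using cub[OF that] True by (auto simp: A_def eq_divide_eq)
    have "deriv \<Psi> x = 0" if x: "x \<in> I" for x
    proof (rule DERIV_zero_if_locally_zero[OF _ open_I x])
      show "((\<lambda>x. \<Psi> x - A) has_real_derivative deriv \<Psi> x) (at x)"
        using DERIV_diff[OF DERIV_\<rho>\<Psi>(2)[OF x] DERIV_const[of A]] by simp
    qed (simp add: \<Psi>)
    then have "deriv \<rho> x = c" if "x \<in> I" for x using lin[OF that] \<Psi>nz[OF that] that by simp
    then have "((\<lambda>x. \<rho> x - c * x) has_real_derivative 0) (at x)" if "x \<in> I" for x
      using DERIV_diff[OF DERIV_\<rho>\<Psi>(1)[OF that] DERIV_cmult[OF DERIV_ident, of c]] that by simp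
    then obtain e where "\<And>x. x \<in> I \<Longrightarrow> \<rho> x - c * x = e"
      using has_field_derivative_zero_constant[OF convex_I, of "\<lambda>x. \<rho> x - c * x"]
        has_field_derivative_at_within by metis
    then have "\<rho> x = c * x + e" if "x \<in> I" for x using that by (simp add: algebra_simps)
    then have "harmonic_pair I \<rho> \<Psi> c A e"
      using c pos \<Psi> by (auto simp: harmonic_pair_def mult.commute)
    then show ?thesis by blast
  next
    case False
    define \<zeta> where "\<zeta> = - \<beta> / \<alpha>"
    define A where "A = 1 / \<alpha> ^ 3"
    have eq: "\<alpha> * x + \<beta> = \<alpha> * (x - \<zeta>)" for x using False by (simp add: \<zeta>_def field_simps)
    have cub': "\<Psi> x * (x - \<zeta>) ^ 3 = A" if "x \<in> I" for x
      using cub[OF that] False unfolding eq by (simp add: A_def eq_divide_eq power_mult_distrib mult_ac)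
    have A: "A \<noteq> 0" using False by (simp add: A_def)
    have \<zeta>: "\<zeta> \<notin> I" using cub'[of \<zeta>] A by auto
    have u: "x - \<zeta> \<noteq> 0" if "x \<in> I" for x using that \<zeta> by auto
    have \<Psi>: "\<Psi> x = A / (x - \<zeta>) ^ 3" if "x \<in> I" for x
      using cub'[OF that] u[OF that] by (simp add: eq_divide_eq)
    \<comment> \<open>With \<open>u = x - \<zeta>\<close>, the linear relation reads
      \<open>u * \<rho>' + 3 * \<rho> = c * u\<close>. The integrating factor
      \<open>u\<^sup>2\<close> turns it into \<open>N' = 0\<close>, whence
      \<open>\<kappa> = c / 4\<close> and \<open>D = 4 * E / c\<close>.\<close>
    define N where "N x = \<rho> x * (x - \<zeta>) ^ 3 - c / 4 * (x - \<zeta>) ^ 4" for x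
    have "(N has_real_derivative 0) (at x)" if x: "x \<in> I" for x
    proof -
      have "deriv \<Psi> x * (x - \<zeta>) ^ 3 + \<Psi> x * (3 * (x - \<zeta>)\<^sup>2) = 0"
      proof (rule DERIV_zero_if_locally_zero[OF _ open_I x])
        show "((\<lambda>x. \<Psi> x * (x - \<zeta>) ^ 3 - A) has_real_derivative
            deriv \<Psi> x * (x - \<zeta>) ^ 3 + \<Psi> x * (3 * (x - \<zeta>)\<^sup>2)) (at x)"
          by (auto intro!: derivative_eq_intros DERIV_\<rho>\<Psi>(2)[OF x])
      qed (simp add: cub')
      then have "(x - \<zeta>)\<^sup>2 * (deriv \<Psi> x * (x - \<zeta>) + 3 * \<Psi> x) = 0"
        by (simp add: power2_eq_square power3_eq_cube algebra_simps)
      then have "deriv \<Psi> x * (x - \<zeta>) = - 3 * \<Psi> x" using u[OF x] by simp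
      then have "\<Psi> x * (deriv \<rho> x * (x - \<zeta>) + 3 * \<rho> x) =
          \<Psi> x * (deriv \<rho> x * (x - \<zeta>)) - \<rho> x * (deriv \<Psi> x * (x - \<zeta>))"
        by (simp only:) (simp add: algebra_simps)
      also have "\<dots> = (deriv \<rho> x * \<Psi> x - \<rho> x * deriv \<Psi> x) * (x - \<zeta>)"
        by (simp add: algebra_simps)
      also have "\<dots> = \<Psi> x * (c * (x - \<zeta>))" unfolding lin[OF x] by simp
      finally have "\<Psi> x * (deriv \<rho> x * (x - \<zeta>) + 3 * \<rho> x) = \<Psi> x * (c * (x - \<zeta>))" .
      then have "deriv \<rho> x * (x - \<zeta>) + 3 * \<rho> x = c * (x - \<zeta>)" using \<Psi>nz[OF x] by simp
      then have eq: "(deriv \<rho> x * (x - \<zeta>) + 3 * \<rho> x) * (x - \<zeta>)\<^sup>2 = c * (x - \<zeta>) * (x - \<zeta>)\<^sup>2" by simp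
      have "(N has_real_derivative
          (deriv \<rho> x * (x - \<zeta>) + 3 * \<rho> x) * (x - \<zeta>)\<^sup>2 - c * (x - \<zeta>) * (x - \<zeta>)\<^sup>2) (at x)"
        unfolding N_def[abs_def]
        by (auto intro!: derivative_eq_intros DERIV_\<rho>\<Psi>(1)[OF x])
           (simp add: power2_eq_square power3_eq_cube algebra_simps)
      then show ?thesis unfolding eq by simp
    qed
    then have "(N has_real_derivative 0) (at x within I)" if "x \<in> I" for x
      using that has_field_derivative_at_within by blast
    then obtain E where E: "\<And>x. x \<in> I \<Longrightarrow> N x = E"
      using has_field_derivative_zero_constant[OF convex_I, of N] by blast
    have \<rho>: "\<rho> x = c / 4 * ((x - \<zeta>) ^ 4 + 4 * E / c) / (x - \<zeta>) ^ 3" if x: "x \<in> I" for x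
    proof -
      have "c / 4 * ((x - \<zeta>) ^ 4 + 4 * E / c) = c / 4 * (x - \<zeta>) ^ 4 + E"
        using c by (simp add: distrib_left)
      also have "\<dots> = \<rho> x * (x - \<zeta>) ^ 3" using E[OF x] by (simp add: N_def)
      finally show ?thesis using u[OF x] by (simp add: eq_divide_eq)
    qed
    have "A * ((x - \<zeta>) ^ 4 + 4 * E / c) > 0" if x: "x \<in> I" for x
    proof -
      define w where "w = (x - \<zeta>) ^ 3"
      have "\<rho> x * \<Psi> x = c / 4 * (A * ((x - \<zeta>) ^ 4 + 4 * E / c)) / w\<^sup>2"
        unfolding \<rho>[OF x] \<Psi>[OF x] w_def[symmetric] by (simp add: power2_eq_square mult_ac)
      then have "0 < c / 4 * (A * ((x - \<zeta>) ^ 4 + 4 * E / c)) / w\<^sup>2" using pos[OF x] by simp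
      then have "0 < c / 4 * (A * ((x - \<zeta>) ^ 4 + 4 * E / c))"
        by (rule contrapos_pp) (simp add: divide_nonpos_nonneg not_less)
      then show ?thesis using c by (simp add: zero_less_mult_iff)
    qed
    then have "isotonic_pair I \<rho> \<Psi> (c / 4) A \<zeta> (4 * E / c)"
      using c \<zeta> \<Psi> \<rho> by (simp add: isotonic_pair_def)
    then show ?thesis by blast
  qed
qed

lemma harmonic_pair_freq2:
  assumes h: "harmonic_pair I \<rho> \<Psi> k A e" and x: "x \<in> I"
  shows "freq2 x = k"
proof -
  have "(\<rho> has_real_derivative k) (at x)"
    by (rule has_field_derivative_transform_within_open[of "\<lambda>x. k * x + e" _ _ I])
       (use h x open_I in \<open>auto intro!: derivative_eq_intros simp: harmonic_pair_def\<close>)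
  moreover have "(\<Psi> has_real_derivative 0) (at x)"
    by (rule has_field_derivative_transform_within_open[of "\<lambda>x. A" _ _ I])
       (use h x open_I in \<open>auto simp: harmonic_pair_def\<close>)
  ultimately show ?thesis by (simp add: freq2_def DERIV_imp_deriv)
qed

lemma isotonic_pair_freq2:
  assumes h: "isotonic_pair I \<rho> \<Psi> \<kappa> A \<zeta> D" and x: "x \<in> I"
  shows "freq2 x = 4 * \<kappa>"
proof -
  define u where "u = x - \<zeta>"
  have u: "u \<noteq> 0" using assms by (auto simp: u_def isotonic_pair_def)
  have A: "A \<noteq> 0" using assms by (auto simp: isotonic_pair_def)
  have \<rho>': "(\<rho> has_real_derivative \<kappa> * (1 - 3 * D / u ^ 4)) (at x)"
  proof (rule has_field_derivative_transform_within_open[of "\<lambda>x. \<kappa> * ((x - \<zeta>) ^ 4 + D) / (x - \<zeta>) ^ 3" _ _ I])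
    show "((\<lambda>x. \<kappa> * ((x - \<zeta>) ^ 4 + D) / (x - \<zeta>) ^ 3) has_real_derivative \<kappa> * (1 - 3 * D / u ^ 4)) (at x)"
      using u by (auto intro!: derivative_eq_intros simp: u_def[symmetric])
        (simp add: field_simps eval_nat_numeral)
  qed (use h x open_I in \<open>auto simp: isotonic_pair_def\<close>)
  have \<Psi>': "(\<Psi> has_real_derivative - 3 * A / u ^ 4) (at x)"
  proof (rule has_field_derivative_transform_within_open[of "\<lambda>x. A / (x - \<zeta>) ^ 3" _ _ I])
    show "((\<lambda>x. A / (x - \<zeta>) ^ 3) has_real_derivative - 3 * A / u ^ 4) (at x)"
      using u by (auto intro!: derivative_eq_intros simp: u_def[symmetric])
        (simp add: field_simps eval_nat_numeral)
  qed (use h x open_I in \<open>auto simp: isotonic_pair_def\<close>)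
  have quot: "\<rho> x / \<Psi> x = \<kappa> * (u ^ 4 + D) / A"
    using h x u by (simp add: isotonic_pair_def u_def)
  show ?thesis
    unfolding freq2_def DERIV_imp_deriv[OF \<rho>'] DERIV_imp_deriv[OF \<Psi>'] quot using A u
    by (simp add: field_simps)
qed

lemma harmonic_pair_periods:
  assumes h: "harmonic_pair I \<rho> \<Psi> k A e"
  shows "all_periods_equal I \<rho> \<Psi> (2 * pi / sqrt k)"
  unfolding all_periods_equal_def
proof (intro allI impI)
  fix K z assume K: "K \<noteq> 0 \<and> bounded_nonconstant_solution I \<rho> \<Psi> K z"
  then obtain v where z: "\<And>t. z t \<in> I" "\<And>t. (z has_real_derivative v t) (at t)"
    "\<And>t. (v has_real_derivative - U' 0 K (z t)) (at t)" and nc: "\<not> z constant_on UNIV"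
    unfolding bounded_nonconstant_solution_iff by metis
  have k: "k > 0" using h by (simp add: harmonic_pair_def)
  define q where "q = (A / K\<^sup>2 - e) / k"
  have "U' 0 K (z t) = (sqrt k)\<^sup>2 * (z t - q)" for t
    using h z(1)[of t] k by (simp add: U'_def harmonic_pair_def q_def field_simps)
  then show "is_minimal_period z (2 * pi / sqrt k)"
    using harmonic_oscillator_minimal_period[of "sqrt k" z v q] z nc k by simp
qed

text \<open>\<open>u\<close> has constant sign on \<open>I\<close>, so \<open>u\<close> and its
  square have the same periods. The square oscillates harmonically with angular frequency
  \<open>2 * sqrt \<kappa>\<close>, whatever \<open>K\<close> and \<open>D\<close> are.\<close>

lemma isotonic_pair_periods:
  assumes h: "isotonic_pair I \<rho> \<Psi> \<kappa> A \<zeta> D"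
  shows "all_periods_equal I \<rho> \<Psi> (pi / sqrt \<kappa>)"
  unfolding all_periods_equal_def
proof (intro allI impI)
  fix K z assume K: "K \<noteq> 0 \<and> bounded_nonconstant_solution I \<rho> \<Psi> K z"
  then obtain v where z: "\<And>t. z t \<in> I" "\<And>t. (z has_real_derivative v t) (at t)"
    "\<And>t. (v has_real_derivative - U' 0 K (z t)) (at t)" and nc: "\<not> z constant_on UNIV"
    unfolding bounded_nonconstant_solution_iff by metis
  have \<kappa>: "\<kappa> > 0" and \<zeta>: "\<zeta> \<notin> I" using h by (auto simp: isotonic_pair_def)
  define u where "u t = z t - \<zeta>" for t
  have u0: "u t \<noteq> 0" for t using z(1)[of t] \<zeta> by (auto simp: u_def)
  obtain s :: real where s: "s = 1 \<or> s = -1" "\<And>x. x \<in> I \<Longrightarrow> s * (x - \<zeta>) > 0"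
    by (rule connected_imp_constant_sign[OF connected_I, of "\<lambda>x. x - \<zeta>"])
       (use \<zeta> in \<open>auto intro!: continuous_intros\<close>)
  have u_eq: "u t = u t'" if "(u t)\<^sup>2 = (u t')\<^sup>2" for t t'
    using that s(1) s(2)[OF z(1), of t] s(2)[OF z(1), of t'] by (auto simp: u_def power2_eq_iff)
  have ud: "(u has_real_derivative v t) (at t)" for t
    unfolding u_def[abs_def] using z(2)[of t] by (auto intro!: derivative_eq_intros)
  \<comment> \<open>Both \<open>K\<close> and \<open>D\<close> enter the motion only through this
    coefficient of the inverse cube; it cancels in the equation for the square of
    \<open>u\<close>.\<close>
  define B where "B = A / (\<kappa> * K\<^sup>2) - D"
  define a where "a t = \<kappa> * (u t - B / u t ^ 3)" for t
  have vd: "(v has_real_derivative - a t) (at t)" for t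
  proof -
    have \<rho>\<Psi>: "\<rho> (z t) = \<kappa> * (u t ^ 4 + D) / u t ^ 3" "\<Psi> (z t) = A / u t ^ 3"
      using h z(1)[of t] by (simp_all add: isotonic_pair_def u_def)
    have "\<kappa> * B = A / K\<^sup>2 - \<kappa> * D" using \<kappa> K by (simp add: B_def field_simps)
    then have at: "a t = \<kappa> * u t - (A / K\<^sup>2 - \<kappa> * D) / u t ^ 3" by (simp add: a_def right_diff_distrib)
    have "U' 0 K (z t) = a t"
      unfolding at U'_def funpow_0 \<rho>\<Psi> using u0[of t] K by (simp add: field_simps eval_nat_numeral)
    then show ?thesis using z(3)[of t] by simp
  qed
  \<comment> \<open>By conservation of the energy \<open>E\<close>, \<open>(u\<^sup>2)'' = 4 E - 4 \<kappa> u\<^sup>2\<close>.\<close>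
  define E where "E t = (v t)\<^sup>2 / 2 + \<kappa> / 2 * ((u t)\<^sup>2 + B / (u t)\<^sup>2)" for t
  have "(E has_real_derivative 0) (at t)" for t
    unfolding E_def[abs_def] using u0[of t]
    by (auto intro!: derivative_eq_intros ud vd) (simp add: a_def field_simps eval_nat_numeral)
  then have E: "E t = E 0" for t using DERIV_isconst_all by blast
  have min: "is_minimal_period (\<lambda>t. (u t)\<^sup>2) (2 * pi / (2 * sqrt \<kappa>))"
  proof (rule harmonic_oscillator_minimal_period)
    show "((\<lambda>t. (u t)\<^sup>2) has_real_derivative 2 * u t * v t) (at t)" for t
      by (auto intro!: derivative_eq_intros ud)
    show "((\<lambda>t. 2 * u t * v t) has_real_derivative - ((2 * sqrt \<kappa>)\<^sup>2 * ((u t)\<^sup>2 - E 0 / \<kappa>))) (at t)" for t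
    proof -
      have "((\<lambda>t. 2 * u t * v t) has_real_derivative 2 * (v t)\<^sup>2 - 2 * u t * a t) (at t)"
        by (auto intro!: derivative_eq_intros ud vd simp: power2_eq_square)
      moreover have sq: "(2 * sqrt \<kappa>)\<^sup>2 = 4 * \<kappa>" using \<kappa> by (simp add: power_mult_distrib)
      have "2 * (v t)\<^sup>2 - 2 * u t * a t = - ((2 * sqrt \<kappa>)\<^sup>2 * ((u t)\<^sup>2 - E 0 / \<kappa>))"
        unfolding E[of t, symmetric] sq using \<kappa> u0[of t]
        by (simp add: E_def a_def field_simps eval_nat_numeral)
      ultimately show ?thesis by simp
    qed
    show "\<not> (\<lambda>t. (u t)\<^sup>2) constant_on UNIV"
    proof
      assume "(\<lambda>t. (u t)\<^sup>2) constant_on UNIV"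
      then have "(u t)\<^sup>2 = (u 0)\<^sup>2" for t by (auto simp: constant_on_def)
      then have "u t = u 0" for t using u_eq by blast
      then have "z t = z 0" for t by (simp add: u_def)
      then show False using nc by (auto simp: constant_on_def)
    qed
  qed (use \<kappa> in auto)
  have "is_period (\<lambda>t. (u t)\<^sup>2) T \<longleftrightarrow> is_period z T" for T
  proof -
    have "(u (t + T))\<^sup>2 = (u t)\<^sup>2 \<longleftrightarrow> z (t + T) = z t" for t
      using u_eq[of "t + T" t] by (auto simp: u_def)
    then show ?thesis by (simp add: is_period_def periodic_fun_simple_def)
  qed
  then have "is_minimal_period z (2 * pi / (2 * sqrt \<kappa>))"
    using min by (simp add: is_minimal_period_def)
  then show "is_minimal_period z (pi / sqrt \<kappa>)" by simp
qed

lemma nondeg_stable_exactly_at_sqrt: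
  assumes "x \<in> I" "\<rho> x * \<Psi> x > 0" "freq2 x > 0"
  shows "nondeg_stable_exactly_at I \<rho> \<Psi> {sqrt (\<Psi> x / \<rho> x), - sqrt (\<Psi> x / \<rho> x)} x"
proof -
  have pos: "\<Psi> x / \<rho> x > 0" using assms(2) by (auto simp: zero_less_divide_iff zero_less_mult_iff)
  have "K \<in> {sqrt (\<Psi> x / \<rho> x), - sqrt (\<Psi> x / \<rho> x)}" if "K \<noteq> 0" "equilibrium I \<rho> \<Psi> K x" for K
  proof -
    have "\<Psi> x = K\<^sup>2 * \<rho> x" using that by (simp add: equilibrium_def potential_deriv_def field_simps)
    then have "K\<^sup>2 = (sqrt (\<Psi> x / \<rho> x))\<^sup>2" using assms(2) pos by (auto simp: field_simps)
    then show ?thesis by (simp add: power2_eq_iff)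
  qed
  moreover have "K \<noteq> 0 \<and> nondeg_stable_equilibrium I \<rho> \<Psi> K x"
    if "K \<in> {sqrt (\<Psi> x / \<rho> x), - sqrt (\<Psi> x / \<rho> x)}" for K
  proof -
    have "K\<^sup>2 = \<Psi> x / \<rho> x" "K \<noteq> 0" using that pos by auto
    then show ?thesis using nondeg_if_freq2_pos[OF assms(1,2) _ assms(3)] by blast
  qed
  ultimately show ?thesis unfolding nondeg_stable_exactly_at_def by blast
qed

lemma all_periods_equal_imp_commensurable:
  assumes "all_periods_equal I \<rho> \<Psi> T"
  shows "cond_all I \<rho> \<Psi>"
  unfolding cond_all_def periodic_commensurable_def
proof (intro conjI ballI allI impI)
  fix z assume "z \<in> {z. \<exists>K. K \<noteq> 0 \<and> bounded_nonconstant_solution I \<rho> \<Psi> K z}"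
  then show "\<exists>T. is_period z T" using assms by (auto simp: all_periods_equal_def is_minimal_period_def)
next
  fix z\<^sub>1 z\<^sub>2 T\<^sub>1 T\<^sub>2
  assume z: "z\<^sub>1 \<in> {z. \<exists>K. K \<noteq> 0 \<and> bounded_nonconstant_solution I \<rho> \<Psi> K z}"
    "z\<^sub>2 \<in> {z. \<exists>K. K \<noteq> 0 \<and> bounded_nonconstant_solution I \<rho> \<Psi> K z}"
    and T: "is_period z\<^sub>1 T\<^sub>1 \<and> is_period z\<^sub>2 T\<^sub>2"
  have min: "is_minimal_period z\<^sub>1 T" "is_minimal_period z\<^sub>2 T" using assms z by (auto simp: all_periods_equal_def)
  then have "T > 0" by (simp add: is_minimal_period_def is_period_def)
  have "T\<^sub>1 / T \<in> \<rat>" "T\<^sub>2 / T \<in> \<rat>"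
    using min T period_commensurable_with_minimal_period by blast+
  then have "(T\<^sub>1 / T) / (T\<^sub>2 / T) \<in> \<rat>" by (rule Rats_divide)
  then show "T\<^sub>1 / T\<^sub>2 \<in> \<rat>" using \<open>T > 0\<close> by simp
qed

end

section \<open>Implications between the closing notions\<close>

lemma periodic_commensurable_subset:
  "periodic_commensurable S \<Longrightarrow> S' \<subseteq> S \<Longrightarrow> periodic_commensurable S'"
  unfolding periodic_commensurable_def by blast

lemma cond_all_imp_commensurable_near:
  assumes "cond_all I \<rho> \<Psi>"
  shows "commensurable_near I \<rho> \<Psi> K\<^sub>0 z\<^sub>0"
  unfolding commensurable_near_def
  by (intro exI[of _ 1] conjI periodic_commensurable_subset[OF assms[unfolded cond_all_def]]) auto

lemma closing_imp_semilocally_closing: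
  assumes "closing I \<rho> \<Psi>"
  shows "semilocally_closing I \<rho> \<Psi>"
proof -
  have all: "cond_all I \<rho> \<Psi>" using assms by (simp add: closing_def)
  have "cond_all_semiloc I \<rho> \<Psi> K z" if "K \<noteq> 0" for K z
    unfolding cond_all_semiloc_def
    by (rule periodic_commensurable_subset[OF all[unfolded cond_all_def]]) (use that in auto)
  then show ?thesis
    using assms cond_all_imp_commensurable_near[OF all]
    by (auto simp: closing_def semilocally_closing_def cond_all_loc_def)
qed

context smooth_oscillator
begin

lemma semilocally_closing_imp_locally_closing:
  assumes "semilocally_closing I \<rho> \<Psi>"
  shows "locally_closing I \<rho> \<Psi>"
  using assms semilocal_imp_nondeg unfolding semilocally_closing_def locally_closing_def cond_ex_loc_def
  by meson

text \<open>A stable equilibrium may be degenerate and then is no witness for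
  \<open>cond_ex_loc\<close>. Instead, a bounded solution near it, with \<open>K\<^sub>0\<close>
  kept fixed, satisfies the semilocal condition, and this produces a nondegenerate minimum.\<close>

lemma weakly_closing_imp_locally_closing:
  assumes "weakly_closing I \<rho> \<Psi>" "I \<noteq> {}"
  shows "locally_closing I \<rho> \<Psi>"
proof -
  have loc: "cond_all_loc I \<rho> \<Psi>"
    using assms(1) nondeg_imp_stable unfolding weakly_closing_def cond_all_loc_weak_def cond_all_loc_def
    by blast
  obtain z\<^sub>0 where "z\<^sub>0 \<in> I" using assms(2) by blast
  then obtain K\<^sub>0 where K0: "K\<^sub>0 \<noteq> 0" and st: "stable_equilibrium I \<rho> \<Psi> K\<^sub>0 z\<^sub>0"
    using assms(1) by (auto simp: weakly_closing_def)
  then have "commensurable_near I \<rho> \<Psi> K\<^sub>0 z\<^sub>0"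
    using assms(1) by (auto simp: weakly_closing_def cond_all_loc_weak_def)
  then obtain \<epsilon> \<delta> where \<epsilon>: "\<epsilon> > 0" and \<delta>: "\<delta> > 0" and comm: "periodic_commensurable
        {z. \<exists>K. K \<noteq> 0 \<and> K \<in> {K\<^sub>0 - \<delta> <..< K\<^sub>0 + \<delta>} \<and>
              bounded_nonconstant_solution I \<rho> \<Psi> K z \<and> range z \<subseteq> {z\<^sub>0 - \<epsilon> .. z\<^sub>0 + \<epsilon>}}"
    unfolding commensurable_near_def by (elim exE conjE) (rule that)
  obtain z where z: "bounded_nonconstant_solution I \<rho> \<Psi> K\<^sub>0 z" "range z \<subseteq> {z\<^sub>0 - \<epsilon>..z\<^sub>0 + \<epsilon>}"
    using stable_imp_bounded_nonconstant_solution[OF st \<epsilon>] by metis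
  have "cond_all_semiloc I \<rho> \<Psi> K\<^sub>0 z"
    unfolding cond_all_semiloc_def
    by (rule periodic_commensurable_subset[OF comm]) (use K0 \<delta> z(2) in \<open>auto intro!: exI[of _ K\<^sub>0]\<close>)
  then have "cond_ex_loc I \<rho> \<Psi>"
    using semilocal_imp_nondeg[OF z(1)] K0 by (auto simp: cond_ex_loc_def)
  then show ?thesis using loc by (simp add: locally_closing_def)
qed

lemma strongly_closing_imp_locally_closing:
  assumes "strongly_closing I \<rho> \<Psi>" "I \<noteq> {}"
  shows "locally_closing I \<rho> \<Psi>"
  using assms by (auto simp: strongly_closing_def locally_closing_def cond_ex_loc_def)

lemma all_closing_if_isochronous:
  assumes per: "all_periods_equal I \<rho> \<Psi> T" and "I \<noteq> {}"
    and pos: "\<And>x. x \<in> I \<Longrightarrow> \<rho> x * \<Psi> x > 0" "\<And>x. x \<in> I \<Longrightarrow> freq2 x > 0"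
  shows "closing I \<rho> \<Psi>" "semilocally_closing I \<rho> \<Psi>" "locally_closing I \<rho> \<Psi>"
    "strongly_closing I \<rho> \<Psi>" "weakly_closing I \<rho> \<Psi>"
proof -
  have all: "cond_all I \<rho> \<Psi>" by (rule all_periods_equal_imp_commensurable[OF per])
  have nd: "\<exists>K. K \<noteq> 0 \<and> nondeg_stable_equilibrium I \<rho> \<Psi> K x" if "x \<in> I" for x
    using nondeg_stable_exactly_at_sqrt[OF that pos[OF that]] unfolding nondeg_stable_exactly_at_def by blast
  obtain x K where xK: "K \<noteq> 0" "nondeg_stable_equilibrium I \<rho> \<Psi> K x" using nd \<open>I \<noteq> {}\<close> by blast
  then show cl: "closing I \<rho> \<Psi>"
    using stable_imp_bounded_nonconstant_solution[OF nondeg_imp_stable[OF xK(2)], of 1] all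
    unfolding closing_def by (metis zero_less_one)
  show "semilocally_closing I \<rho> \<Psi>" using cl by (rule closing_imp_semilocally_closing)
  then show "locally_closing I \<rho> \<Psi>" by (rule semilocally_closing_imp_locally_closing)
  then show "strongly_closing I \<rho> \<Psi>" using nd by (auto simp: strongly_closing_def locally_closing_def)
  show "weakly_closing I \<rho> \<Psi>"
    using nd nondeg_imp_stable cond_all_imp_commensurable_near[OF all]
    unfolding weakly_closing_def cond_all_loc_weak_def by blast
qed

text \<open>A cycle of implications: each notion implies the local one, the local one forces an
  explicit pair, and an explicit pair has one common minimal period, from which all five notions
  follow.\<close>

lemma closing_notions_iff_pair:
  assumes nz: "\<And>x. x \<in> I \<Longrightarrow> \<rho> x \<noteq> 0" and "I \<noteq> {}"
  defines "pair \<equiv> (\<exists>k A e. harmonic_pair I \<rho> \<Psi> k A e) \<or> (\<exists>\<kappa> A \<zeta> D. isotonic_pair I \<rho> \<Psi> \<kappa> A \<zeta> D)"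
  shows "closing I \<rho> \<Psi> \<longleftrightarrow> pair" "semilocally_closing I \<rho> \<Psi> \<longleftrightarrow> pair" "locally_closing I \<rho> \<Psi> \<longleftrightarrow> pair"
    "strongly_closing I \<rho> \<Psi> \<longleftrightarrow> pair" "weakly_closing I \<rho> \<Psi> \<longleftrightarrow> pair"
proof -
  have "\<exists>T. all_periods_equal I \<rho> \<Psi> T \<and> (\<forall>x\<in>I. \<rho> x * \<Psi> x > 0) \<and> (\<forall>x\<in>I. freq2 x > 0)" if pair
    using that unfolding pair_def
  proof (elim disjE exE)
    fix k A e assume h: "harmonic_pair I \<rho> \<Psi> k A e"
    then show ?thesis
      using harmonic_pair_periods[OF h] harmonic_pair_freq2[OF h]
      by (auto simp: harmonic_pair_def mult.commute intro!: exI)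
  next
    fix \<kappa> A \<zeta> D assume h: "isotonic_pair I \<rho> \<Psi> \<kappa> A \<zeta> D"
    then have "\<kappa> > 0" by (simp add: isotonic_pair_def)
    then show ?thesis
      using isotonic_pair_periods[OF h] isotonic_pair_freq2[OF h] isotonic_pair_product_pos[OF h]
      by (metis mult_pos_pos zero_less_numeral)
  qed
  then have "closing I \<rho> \<Psi> \<and> semilocally_closing I \<rho> \<Psi> \<and> locally_closing I \<rho> \<Psi> \<and> strongly_closing I \<rho> \<Psi> \<and>
      weakly_closing I \<rho> \<Psi>" if pair
    using all_closing_if_isochronous[OF _ \<open>I \<noteq> {}\<close>] that by blast
  moreover have "locally_closing I \<rho> \<Psi> \<Longrightarrow> pair"
    unfolding pair_def by (rule locally_closing_imp_pair[OF _ nz])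
  ultimately show "closing I \<rho> \<Psi> \<longleftrightarrow> pair" "semilocally_closing I \<rho> \<Psi> \<longleftrightarrow> pair" "locally_closing I \<rho> \<Psi> \<longleftrightarrow> pair"
    "strongly_closing I \<rho> \<Psi> \<longleftrightarrow> pair" "weakly_closing I \<rho> \<Psi> \<longleftrightarrow> pair"
    using closing_imp_semilocally_closing semilocally_closing_imp_locally_closing
      strongly_closing_imp_locally_closing[OF _ \<open>I \<noteq> {}\<close>] weakly_closing_imp_locally_closing[OF _ \<open>I \<noteq> {}\<close>]
    by blast+
qed

end
section \<open>Counting closing functions\<close>

text \<open>Every iterated derivative agrees on \<open>I\<close> with a function of the same shape.
  Agreement on the open set \<open>I\<close> is enough to continue the induction.\<close>

lemma C_infinity_on_inverse_power:
  assumes "open I" "\<zeta> \<notin> I"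
  shows "C_infinity_on I (\<lambda>z. a / (z - \<zeta>) ^ m)"
proof -
  let ?f = "\<lambda>z. a / (z - \<zeta>) ^ m"
  have d: "(g has_real_derivative - (a' * real k) / (x - \<zeta>) ^ Suc k) (at x)"
    if g: "\<And>x. x \<in> I \<Longrightarrow> g x = a' / (x - \<zeta>) ^ k" and x: "x \<in> I" for g :: "real \<Rightarrow> real" and a' k x
  proof (rule has_field_derivative_transform_within_open[OF _ assms(1) x])
    have u: "x - \<zeta> \<noteq> 0" using x assms(2) by auto
    have "((\<lambda>x. a' / (x - \<zeta>) ^ k) has_real_derivative
        - (a' * (real k * (x - \<zeta>) ^ (k - 1))) / ((x - \<zeta>) ^ k * (x - \<zeta>) ^ k)) (at x)"
      using u by (auto intro!: derivative_eq_intros)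
    moreover have "- (a' * (real k * w ^ (k - 1))) / (w ^ k * w ^ k) = - (a' * real k) / w ^ Suc k"
      if "w \<noteq> 0" for w :: real
      using that by (cases k) (auto simp: field_simps)
    ultimately show "((\<lambda>x. a' / (x - \<zeta>) ^ k) has_real_derivative - (a' * real k) / (x - \<zeta>) ^ Suc k) (at x)"
      using u by metis
  qed (simp add: g)
  have "\<exists>a' k. \<forall>x\<in>I. (deriv ^^ n) ?f x = a' / (x - \<zeta>) ^ k" for n
  proof (induction n)
    case 0
    then show ?case by auto
  next
    case (Suc n)
    then obtain a' k where g: "\<And>x. x \<in> I \<Longrightarrow> (deriv ^^ n) ?f x = a' / (x - \<zeta>) ^ k" by blast
    have "(deriv ^^ Suc n) ?f x = - (a' * real k) / (x - \<zeta>) ^ Suc k" if "x \<in> I" for x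
      using DERIV_imp_deriv[OF d[OF g that]] by simp
    then show ?case by blast
  qed
  then show ?thesis
    unfolding C_infinity_on_def field_differentiable_def using d by metis
qed

section \<open>Classes of functions up to a positive factor\<close>

lemma equiv_pos_proportional: "equiv UNIV (pos_proportional I)"
proof (rule equivI)
  show "refl_on UNIV (pos_proportional I)"
    by (auto simp: refl_on_def pos_proportional_def intro: exI[of _ 1])
  show "sym (pos_proportional I)"
  proof (rule symI)
    fix f g assume "(f, g) \<in> pos_proportional I"
    then obtain c where "c > 0" "\<forall>z\<in>I. g z = c * f z" by (auto simp: pos_proportional_def)
    then show "(g, f) \<in> pos_proportional I" by (auto simp: pos_proportional_def intro!: exI[of _ "1 / c"])
  qed
  show "trans (pos_proportional I)"
  proof (rule transI)
    fix f g h assume "(f, g) \<in> pos_proportional I" "(g, h) \<in> pos_proportional I"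
    then obtain c c' where "c > 0" "\<forall>z\<in>I. g z = c * f z" "c' > 0" "\<forall>z\<in>I. h z = c' * g z"
      by (auto simp: pos_proportional_def)
    then show "(f, h) \<in> pos_proportional I"
      by (auto simp: pos_proportional_def intro!: exI[of _ "c' * c"])
  qed
qed auto

lemma quotient_eq_classes_of_representatives:
  assumes "equiv UNIV r" "P \<subseteq> S" "\<And>x. x \<in> S \<Longrightarrow> \<exists>p\<in>P. (p, x) \<in> r"
  shows "S // r = (\<lambda>p. r `` {p}) ` P"
proof
  show "S // r \<subseteq> (\<lambda>p. r `` {p}) ` P"
  proof
    fix X assume "X \<in> S // r"
    then obtain x where x: "x \<in> S" "X = r `` {x}" by (auto simp: quotient_def)
    obtain p where "p \<in> P" "(p, x) \<in> r" using assms(3)[OF x(1)] by blast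
    then show "X \<in> (\<lambda>p. r `` {p}) ` P" using x(2) equiv_class_eq[OF assms(1)] by blast
  qed
  show "(\<lambda>p. r `` {p}) ` P \<subseteq> S // r" using assms(2) by (auto simp: quotient_def)
qed

section \<open>Uniqueness of the parameters of the explicit forms\<close>

lemma polynomials_eq_if_eq_on_open:
  fixes p q :: "real poly"
  assumes "open I" "I \<noteq> {}" "\<And>x. x \<in> I \<Longrightarrow> poly p x = poly q x"
  shows "poly p x = poly q x"
proof -
  have "infinite I" using assms(1,2) finite_imp_not_open by blast
  moreover have "I \<subseteq> {x. poly (p - q) x = 0}" using assms(3) by auto
  ultimately have "infinite {x. poly (p - q) x = 0}" using finite_subset by blast
  then have "p - q = 0" using poly_roots_finite by blast
  then show ?thesis by simp
qed

text \<open>Evaluating the polynomial identities at \<open>\<zeta>\<close>, outside of \<open>I\<close>, determines \<open>D\<close> and \<open>\<zeta>\<close>.\<close>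

lemma linear_eq_isotonic_imp_zero:
  fixes k e \<kappa> \<zeta> D :: real
  assumes "open I" "I \<noteq> {}" "\<zeta> \<notin> I" "\<kappa> \<noteq> 0"
    and eq: "\<And>x. x \<in> I \<Longrightarrow> k * x + e = \<kappa> * ((x - \<zeta>) ^ 4 + D) / (x - \<zeta>) ^ 3"
  shows "D = 0"
proof -
  define p q where "p = [:e, k:] * [:- \<zeta>, 1:] ^ 3" and "q = [:\<kappa>:] * ([:- \<zeta>, 1:] ^ 4 + [:D:])"
  have "poly p x = poly q x" if x: "x \<in> I" for x
  proof -
    have "x - \<zeta> \<noteq> 0" using x assms(3) by auto
    then have "(k * x + e) * (x - \<zeta>) ^ 3 = \<kappa> * ((x - \<zeta>) ^ 4 + D)"
      unfolding eq[OF x] by simp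
    then show ?thesis by (simp add: p_def q_def poly_power algebra_simps)
  qed
  then have "poly p \<zeta> = poly q \<zeta>" by (rule polynomials_eq_if_eq_on_open[OF assms(1,2)])
  then show ?thesis using assms(4) by (simp add: p_def q_def poly_power)
qed

lemma isotonic_force_without_singular_part:
  fixes u \<kappa> :: real
  assumes "u \<noteq> 0"
  shows "\<kappa> * (u ^ 4 + 0) / u ^ 3 = \<kappa> * u"
  using assms by (simp add: eval_nat_numeral)

lemma isotonic_eq_isotonic_imp_center_eq:
  fixes \<kappa> \<zeta> D \<kappa>' \<zeta>' D' :: real
  assumes "open I" "I \<noteq> {}" "\<zeta> \<notin> I" "\<zeta>' \<notin> I" "\<kappa> \<noteq> 0" "D \<noteq> 0"
    and eq: "\<And>x. x \<in> I \<Longrightarrow> \<kappa> * ((x - \<zeta>) ^ 4 + D) / (x - \<zeta>) ^ 3 = \<kappa>' * ((x - \<zeta>') ^ 4 + D') / (x - \<zeta>') ^ 3"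
  shows "\<zeta>' = \<zeta>"
proof -
  define p q where "p = [:\<kappa>:] * ([:- \<zeta>, 1:] ^ 4 + [:D:]) * [:- \<zeta>', 1:] ^ 3"
    and "q = [:\<kappa>':] * ([:- \<zeta>', 1:] ^ 4 + [:D':]) * [:- \<zeta>, 1:] ^ 3"
  have "poly p x = poly q x" if x: "x \<in> I" for x
  proof -
    have "x - \<zeta> \<noteq> 0" "x - \<zeta>' \<noteq> 0" using x assms(3,4) by auto
    then have "\<kappa> * ((x - \<zeta>) ^ 4 + D) * (x - \<zeta>') ^ 3 = \<kappa>' * ((x - \<zeta>') ^ 4 + D') * (x - \<zeta>) ^ 3"
      using eq[OF x] by (simp add: frac_eq_eq)
    then show ?thesis by (simp add: p_def q_def poly_power)
  qed
  then have "poly p \<zeta> = poly q \<zeta>" by (rule polynomials_eq_if_eq_on_open[OF assms(1,2)])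
  then show ?thesis using assms(5,6) by (simp add: p_def q_def poly_power)
qed

section \<open>Classification for a function \<open>\<rho>\<close> without zeros\<close>

locale smooth_restoring_force =
  fixes I :: "real set" and \<rho> :: "real \<Rightarrow> real"
  assumes open_I: "open I" and connected_I: "connected I" and nonempty_I: "I \<noteq> {}"
    and smooth_\<rho>: "C_infinity_on I \<rho>" and \<rho>_nonzero: "\<And>x. x \<in> I \<Longrightarrow> \<rho> x \<noteq> 0"
begin

lemma smooth_oscillatorI: "C_infinity_on I \<Psi> \<Longrightarrow> smooth_oscillator I \<rho> \<Psi>"
  using open_I connected_I smooth_\<rho> by (simp add: smooth_oscillator_def)

lemma closing_iff_pair:
  assumes "C_infinity_on I \<Psi>"
  shows "closing I \<rho> \<Psi> \<longleftrightarrow>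
    (\<exists>k A e. harmonic_pair I \<rho> \<Psi> k A e) \<or> (\<exists>\<kappa> A \<zeta> D. isotonic_pair I \<rho> \<Psi> \<kappa> A \<zeta> D)"
  using smooth_oscillator.closing_notions_iff_pair(1)[OF smooth_oscillatorI[OF assms] \<rho>_nonzero nonempty_I] .

lemma \<rho>_DERIV: "x \<in> I \<Longrightarrow> (\<rho> has_real_derivative deriv \<rho> x) (at x)"
  using C_infinity_on_DERIV[OF smooth_\<rho>, of x 0] by simp

lemma continuous_on_\<rho>: "continuous_on I \<rho>"
  using \<rho>_DERIV by (meson DERIV_isCont continuous_at_imp_continuous_on)

lemma convex_I: "convex I"
  using connected_I by (simp add: is_interval_connected_1 is_interval_convex_1[symmetric])

lemma const_deriv_form_imp_linear:
  assumes "const_deriv_form I \<rho> k"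
  obtains \<zeta> where "k > 0" "\<zeta> \<notin> I" "\<And>x. x \<in> I \<Longrightarrow> \<rho> x = k * (x - \<zeta>)"
proof -
  have k: "k > 0" "\<And>x. x \<in> I \<Longrightarrow> deriv \<rho> x = k" using assms by (auto simp: const_deriv_form_def)
  have "((\<lambda>x. \<rho> x - k * x) has_real_derivative 0) (at x within I)" if "x \<in> I" for x
    using DERIV_diff[OF \<rho>_DERIV[OF that] DERIV_cmult[OF DERIV_ident, of k]] k(2)[OF that]
    by (simp add: has_field_derivative_at_within)
  then obtain e where e: "\<And>x. x \<in> I \<Longrightarrow> \<rho> x - k * x = e"
    using has_field_derivative_zero_constant[OF convex_I, of "\<lambda>x. \<rho> x - k * x"] by blast
  have "\<rho> x = k * (x - (- e / k))" if "x \<in> I" for x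
    using e[OF that] k(1) by (simp add: algebra_simps)
  moreover from this have "- e / k \<notin> I" using \<rho>_nonzero by fastforce
  ultimately show thesis using that k(1) by blast
qed

lemma const_deriv_form_if_linear:
  assumes "k > 0" "\<And>x. x \<in> I \<Longrightarrow> \<rho> x = k * x + e"
  shows "const_deriv_form I \<rho> k"
  unfolding const_deriv_form_def
proof (intro conjI ballI)
  fix x assume x: "x \<in> I"
  have "(\<rho> has_real_derivative k) (at x)"
    by (rule has_field_derivative_transform_within_open[of "\<lambda>x. k * x + e" _ _ I])
       (use x open_I assms(2) in \<open>auto intro!: derivative_eq_intros\<close>)
  then show "deriv \<rho> x = k" by (rule DERIV_imp_deriv)
qed fact

text \<open>Here \<open>\<rho> z = k * (z - \<zeta>)\<close> with \<open>\<zeta>\<close> outside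
  \<open>I\<close>, so \<open>A / \<rho> z ^ 3\<close> has the coefficient \<open>A / k ^ 3\<close>
  in terms of \<open>z - \<zeta>\<close>, and the singular part of \<open>\<rho>\<close> is
  absent.\<close>

lemma const_deriv_form_pairs:
  assumes "const_deriv_form I \<rho> k" "A \<noteq> 0"
  shows "(\<forall>z\<in>I. A * \<rho> z > 0) \<Longrightarrow> (\<forall>z\<in>I. \<Psi> z = A) \<Longrightarrow> \<exists>e. harmonic_pair I \<rho> \<Psi> k A e"
    and "(\<forall>z\<in>I. A * \<rho> z ^ 2 > 0) \<Longrightarrow> (\<forall>z\<in>I. \<Psi> z = A / \<rho> z ^ 3) \<Longrightarrow>
      \<exists>\<zeta>. isotonic_pair I \<rho> \<Psi> k (A / k ^ 3) \<zeta> 0"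
proof -
  obtain \<zeta> where k: "k > 0" and \<zeta>: "\<zeta> \<notin> I" and \<rho>: "\<And>x. x \<in> I \<Longrightarrow> \<rho> x = k * (x - \<zeta>)"
    using const_deriv_form_imp_linear[OF assms(1)] by blast
  show "\<exists>e. harmonic_pair I \<rho> \<Psi> k A e" if "\<forall>z\<in>I. A * \<rho> z > 0" "\<forall>z\<in>I. \<Psi> z = A"
  proof -
    have "\<rho> x = k * x + (- k * \<zeta>)" if "x \<in> I" for x by (simp add: \<rho>[OF that] algebra_simps)
    then show ?thesis using that k unfolding harmonic_pair_def by blast
  qed
  assume A: "\<forall>z\<in>I. A * \<rho> z ^ 2 > 0" and \<Psi>: "\<forall>z\<in>I. \<Psi> z = A / \<rho> z ^ 3"
  have "isotonic_pair I \<rho> \<Psi> k (A / k ^ 3) \<zeta> 0"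
    unfolding isotonic_pair_def
  proof (intro conjI ballI k \<zeta>)
    fix x assume x: "x \<in> I"
    have u: "x - \<zeta> \<noteq> 0" using x \<zeta> by auto
    have "A * \<rho> x ^ 2 > 0" using A x by blast
    then have "A > 0" by (simp add: zero_less_mult_iff not_less[symmetric])
    moreover have "(x - \<zeta>) ^ 4 > 0" using u by (simp add: zero_less_power_eq)
    ultimately show "A / k ^ 3 * ((x - \<zeta>) ^ 4 + 0) > 0"
      using mult_pos_pos[OF divide_pos_pos[OF _ zero_less_power[OF k]]] by auto
    have "\<Psi> x = A / \<rho> x ^ 3" using \<Psi> x by blast
    then show "\<Psi> x = A / k ^ 3 / (x - \<zeta>) ^ 3" unfolding \<rho>[OF x] by (simp add: power_mult_distrib)
    show "\<rho> x = k * ((x - \<zeta>) ^ 4 + 0) / (x - \<zeta>) ^ 3"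
      unfolding \<rho>[OF x] isotonic_force_without_singular_part[OF u] ..
  qed
  then show "\<exists>\<zeta>. isotonic_pair I \<rho> \<Psi> k (A / k ^ 3) \<zeta> 0" by blast
qed

text \<open>An isotonic pair with linear \<open>\<rho>\<close> has \<open>D = 0\<close>, hence
  \<open>\<rho> x = \<kappa> * (x - \<zeta>)\<close> and its \<open>\<Psi>\<close> is a multiple of
  \<open>1 / \<rho> ^ 3\<close>; the harmonic pairs are the case \<open>i = 1\<close>.\<close>

lemma closing_iff_if_const_deriv_form:
  assumes cd: "const_deriv_form I \<rho> k" and \<Psi>: "C_infinity_on I \<Psi>"
  shows "closing I \<rho> \<Psi> \<longleftrightarrow> (\<exists>i\<in>{1, 2::nat}. \<exists>A. A \<noteq> 0 \<and> (\<forall>z\<in>I. A * \<rho> z ^ i > 0) \<and>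
      (\<forall>z\<in>I. \<Psi> z = A / \<rho> z ^ (i\<^sup>2 - 1)))" (is "_ \<longleftrightarrow> ?R")
proof -
  have R: "?R \<longleftrightarrow> (\<exists>A. A \<noteq> 0 \<and> (\<forall>z\<in>I. A * \<rho> z > 0) \<and> (\<forall>z\<in>I. \<Psi> z = A)) \<or>
      (\<exists>A. A \<noteq> 0 \<and> (\<forall>z\<in>I. A * \<rho> z ^ 2 > 0) \<and> (\<forall>z\<in>I. \<Psi> z = A / \<rho> z ^ 3))"
    by simp
  show ?thesis
    unfolding R
  proof
    assume "closing I \<rho> \<Psi>"
    then consider k' A e where "harmonic_pair I \<rho> \<Psi> k' A e" | \<kappa> A \<zeta> D where "isotonic_pair I \<rho> \<Psi> \<kappa> A \<zeta> D"
      using closing_iff_pair[OF \<Psi>] by blast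
    then show "(\<exists>A. A \<noteq> 0 \<and> (\<forall>z\<in>I. A * \<rho> z > 0) \<and> (\<forall>z\<in>I. \<Psi> z = A)) \<or>
      (\<exists>A. A \<noteq> 0 \<and> (\<forall>z\<in>I. A * \<rho> z ^ 2 > 0) \<and> (\<forall>z\<in>I. \<Psi> z = A / \<rho> z ^ 3))"
    proof cases
      case 1
      then have "A \<noteq> 0" using nonempty_I by (force simp: harmonic_pair_def)
      moreover have "\<forall>z\<in>I. A * \<rho> z > 0" "\<forall>z\<in>I. \<Psi> z = A" using 1 by (auto simp: harmonic_pair_def)
      ultimately show ?thesis by blast
    next
      case 2
      then have \<kappa>: "\<kappa> > 0" and \<zeta>: "\<zeta> \<notin> I" by (auto simp: isotonic_pair_def)
      obtain \<xi> where "k > 0" "\<xi> \<notin> I" and \<rho>: "\<And>x. x \<in> I \<Longrightarrow> \<rho> x = k * (x - \<xi>)"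
        using const_deriv_form_imp_linear[OF cd] by blast
      have "D = 0"
      proof (rule linear_eq_isotonic_imp_zero[OF open_I nonempty_I \<zeta>])
        show "k * x + (- k * \<xi>) = \<kappa> * ((x - \<zeta>) ^ 4 + D) / (x - \<zeta>) ^ 3" if "x \<in> I" for x
        proof -
          have "k * x + (- k * \<xi>) = \<rho> x" by (simp add: \<rho>[OF that] algebra_simps)
          also have "\<dots> = \<kappa> * ((x - \<zeta>) ^ 4 + D) / (x - \<zeta>) ^ 3"
            using 2 that unfolding isotonic_pair_def by blast
          finally show ?thesis .
        qed
      qed (use \<kappa> in simp)
      have lin: "\<rho> x = \<kappa> * (x - \<zeta>)" if x: "x \<in> I" for x
      proof -
        have "x - \<zeta> \<noteq> 0" using x \<zeta> by auto
        moreover have "\<rho> x = \<kappa> * ((x - \<zeta>) ^ 4 + 0) / (x - \<zeta>) ^ 3"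
          using 2 x \<open>D = 0\<close> by (simp add: isotonic_pair_def)
        ultimately show ?thesis by (metis isotonic_force_without_singular_part)
      qed
      have \<Psi>x: "\<Psi> x = A * \<kappa> ^ 3 / \<rho> x ^ 3" if x: "x \<in> I" for x
      proof -
        have "\<Psi> x = A / (x - \<zeta>) ^ 3" using 2 x unfolding isotonic_pair_def by blast
        then show ?thesis using \<kappa> by (simp add: lin[OF x] power_mult_distrib)
      qed
      have pos: "A * \<kappa> ^ 3 * \<rho> x ^ 2 > 0" if x: "x \<in> I" for x
      proof -
        have "A * (x - \<zeta>) ^ 4 > 0" using 2 x \<open>D = 0\<close> by (simp add: isotonic_pair_def)
        moreover have "(x - \<zeta>) ^ 4 \<ge> 0" by simp
        ultimately have "A > 0" by (metis mult_nonpos_nonneg not_less)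
        then show ?thesis using \<kappa> \<rho>_nonzero[OF x] by simp
      qed
      obtain x where "x \<in> I" using nonempty_I by blast
      then have "A * \<kappa> ^ 3 \<noteq> 0" using pos by force
      then show ?thesis using pos \<Psi>x by blast
    qed
  next
    assume "(\<exists>A. A \<noteq> 0 \<and> (\<forall>z\<in>I. A * \<rho> z > 0) \<and> (\<forall>z\<in>I. \<Psi> z = A)) \<or>
      (\<exists>A. A \<noteq> 0 \<and> (\<forall>z\<in>I. A * \<rho> z ^ 2 > 0) \<and> (\<forall>z\<in>I. \<Psi> z = A / \<rho> z ^ 3))"
    then show "closing I \<rho> \<Psi>"
    proof (elim disjE exE conjE)
      fix A assume "A \<noteq> 0" "\<forall>z\<in>I. A * \<rho> z > 0" "\<forall>z\<in>I. \<Psi> z = A"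
      then show ?thesis using const_deriv_form_pairs(1)[OF cd] closing_iff_pair[OF \<Psi>] by blast
    next
      fix A assume "A \<noteq> 0" "\<forall>z\<in>I. A * \<rho> z ^ 2 > 0" "\<forall>z\<in>I. \<Psi> z = A / \<rho> z ^ 3"
      then show ?thesis using const_deriv_form_pairs(2)[OF cd] closing_iff_pair[OF \<Psi>] by blast
    qed
  qed
qed

lemma closing_classes_eq:
  assumes P: "\<And>p. p \<in> P \<Longrightarrow> C_infinity_on I p \<and> closing I \<rho> p"
    and "\<And>\<Psi>. C_infinity_on I \<Psi> \<Longrightarrow> closing I \<rho> \<Psi> \<Longrightarrow> \<exists>p\<in>P. (p, \<Psi>) \<in> pos_proportional I"
  shows "closing_classes I \<rho> = (\<lambda>p. pos_proportional I `` {p}) ` P"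
  unfolding closing_classes_def
  by (rule quotient_eq_classes_of_representatives[OF equiv_pos_proportional]) (use assms in auto)

text \<open>The sign of \<open>A\<close> is determined, for \<open>i = 1\<close> by the constant
  sign of \<open>\<rho>\<close> and for \<open>i = 2\<close> as positive, so each \<open>i\<close>
  contributes one class. The two classes differ because \<open>\<rho>\<close> is not
  constant.\<close>

lemma card_closing_classes_if_const_deriv_form:
  assumes cd: "const_deriv_form I \<rho> k"
  shows "card (closing_classes I \<rho>) = 2"
proof -
  obtain \<zeta> where k: "k > 0" and \<zeta>: "\<zeta> \<notin> I" and \<rho>: "\<And>x. x \<in> I \<Longrightarrow> \<rho> x = k * (x - \<zeta>)"
    using const_deriv_form_imp_linear[OF cd] by blast
  obtain s :: real where s: "s = 1 \<or> s = -1" "\<And>x. x \<in> I \<Longrightarrow> s * \<rho> x > 0"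
    using connected_imp_constant_sign[OF connected_I continuous_on_\<rho> \<rho>_nonzero] by blast
  \<comment> \<open>The exponent 0 writes the constant \<open>s\<close> in the form covered by the
    smoothness lemma.\<close>
  define P1 P2 :: "real \<Rightarrow> real" where "P1 = (\<lambda>z. s / (z - \<zeta>) ^ 0)" and "P2 = (\<lambda>z. 1 / k ^ 3 / (z - \<zeta>) ^ 3)"
  have smooth: "C_infinity_on I P1" "C_infinity_on I P2"
    unfolding P1_def P2_def by (rule C_infinity_on_inverse_power[OF open_I \<zeta>])+
  have P1: "P1 z = s" for z by (simp add: P1_def)
  have P2: "P2 z = 1 / \<rho> z ^ 3" if "z \<in> I" for z by (simp add: P2_def \<rho>[OF that] power_mult_distrib)
  have "closing I \<rho> P1"
    unfolding closing_iff_if_const_deriv_form[OF cd smooth(1)]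
    by (rule bexI[of _ 1], rule exI[of _ s]) (use s P1 in auto)
  moreover have "closing I \<rho> P2"
    unfolding closing_iff_if_const_deriv_form[OF cd smooth(2)]
    by (rule bexI[of _ 2], rule exI[of _ 1]) (use P2 \<rho>_nonzero in auto)
  moreover have "\<exists>p\<in>{P1, P2}. (p, \<Psi>) \<in> pos_proportional I" if sm: "C_infinity_on I \<Psi>" and cl: "closing I \<rho> \<Psi>" for \<Psi>
  proof -
    obtain i :: nat and A where iA: "i \<in> {1, 2}" "A \<noteq> 0" "\<forall>z\<in>I. A * \<rho> z ^ i > 0" "\<forall>z\<in>I. \<Psi> z = A / \<rho> z ^ (i\<^sup>2 - 1)"
      using cl unfolding closing_iff_if_const_deriv_form[OF cd sm] by blast
    obtain x where x: "x \<in> I" using nonempty_I by blast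
    show ?thesis
    proof (cases "i = 1")
      case True
      have "A * \<rho> x > 0" "s * \<rho> x > 0" using iA(3) s(2) x True by auto
      then have "s * A > 0" using s(1) by (auto simp: zero_less_mult_iff)
      then have "(P1, \<Psi>) \<in> pos_proportional I"
        using iA(4) True s(1) P1 by (auto simp: pos_proportional_def intro!: exI[of _ "s * A"])
      then show ?thesis by blast
    next
      case False
      then have i: "i = 2" using iA(1) by simp
      have "A * \<rho> x ^ 2 > 0" using iA(3) x i by simp
      then have "A > 0" using \<rho>_nonzero[OF x] by (simp add: zero_less_mult_iff)
      then have "(P2, \<Psi>) \<in> pos_proportional I"
        using iA(4) i P2 by (auto simp: pos_proportional_def intro!: exI[of _ A])
      then show ?thesis by blast
    qed
  qed
  ultimately have classes: "closing_classes I \<rho> = (\<lambda>p. pos_proportional I `` {p}) ` {P1, P2}"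
    using smooth by (intro closing_classes_eq) auto
  have "(P1, P2) \<notin> pos_proportional I"
  proof
    assume "(P1, P2) \<in> pos_proportional I"
    then obtain c where c: "c > 0" "\<forall>z\<in>I. P2 z = c * P1 z" by (auto simp: pos_proportional_def)
    obtain x where x: "x \<in> I" using nonempty_I by blast
    obtain e where e: "e > 0" "ball x e \<subseteq> I" using open_I x open_contains_ball by blast
    define y where "y = x + e / 2"
    have y: "y \<in> I" "y \<noteq> x" using e by (auto simp: y_def subset_iff dist_real_def)
    have "1 / \<rho> x ^ 3 = 1 / \<rho> y ^ 3" using c(2) x y(1) P2 P1 by metis
    then have "\<rho> x ^ 3 = \<rho> y ^ 3" by simp
    then have "\<rho> x = \<rho> y" by (metis odd_real_root_power_cancel odd_numeral)
    then show False using \<rho>[OF x] \<rho>[OF y(1)] k y(2) by simp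
  qed
  then have "pos_proportional I `` {P1} \<noteq> pos_proportional I `` {P2}"
    using eq_equiv_class[OF _ equiv_pos_proportional] by blast
  then show ?thesis by (simp add: classes)
qed

lemma rational_form_pair:
  assumes rf: "rational_form I \<rho> D \<mu> \<zeta>" and A: "\<forall>z\<in>I. A * ((z - \<zeta>) ^ 4 + D) > 0" "\<forall>z\<in>I. \<Psi> z = A / (z - \<zeta>) ^ 3"
  shows "isotonic_pair I \<rho> \<Psi> (1 / \<mu>\<^sup>2) A \<zeta> D"
  using assms by (auto simp: rational_form_def isotonic_pair_def)

text \<open>\<open>D \<noteq> 0\<close> excludes harmonic pairs, and comparing poles identifies
  \<open>\<zeta>'\<close> with \<open>\<zeta>\<close>. The two numerators are then positive
  multiples of each other, which transfers the sign condition from \<open>D'\<close> to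
  \<open>D\<close>.\<close>

lemma closing_iff_if_rational_form:
  assumes rf: "rational_form I \<rho> D \<mu> \<zeta>" and \<Psi>: "C_infinity_on I \<Psi>"
  shows "closing I \<rho> \<Psi> \<longleftrightarrow> (\<exists>A. A \<noteq> 0 \<and> (\<forall>z\<in>I. A * ((z - \<zeta>) ^ 4 + D) > 0) \<and>
      (\<forall>z\<in>I. \<Psi> z = A / (z - \<zeta>) ^ 3))"
proof
  have D: "D \<noteq> 0" and \<mu>: "\<mu> > 0" and \<zeta>: "\<zeta> \<notin> I"
    and \<rho>: "\<And>z. z \<in> I \<Longrightarrow> \<rho> z = 1 / \<mu>\<^sup>2 * ((z - \<zeta>) ^ 4 + D) / (z - \<zeta>) ^ 3"
    using rf by (auto simp: rational_form_def)
  assume "closing I \<rho> \<Psi>"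
  then consider k' A e where "harmonic_pair I \<rho> \<Psi> k' A e" | \<kappa> A \<zeta>' D' where "isotonic_pair I \<rho> \<Psi> \<kappa> A \<zeta>' D'"
    using closing_iff_pair[OF \<Psi>] by blast
  then show "\<exists>A. A \<noteq> 0 \<and> (\<forall>z\<in>I. A * ((z - \<zeta>) ^ 4 + D) > 0) \<and> (\<forall>z\<in>I. \<Psi> z = A / (z - \<zeta>) ^ 3)"
  proof cases
    case 1
    have "D = 0"
    proof (rule linear_eq_isotonic_imp_zero[OF open_I nonempty_I \<zeta>])
      show "k' * x + e = 1 / \<mu>\<^sup>2 * ((x - \<zeta>) ^ 4 + D) / (x - \<zeta>) ^ 3" if "x \<in> I" for x
        using 1 \<rho>[OF that] that by (simp add: harmonic_pair_def)
    qed (use \<mu> in simp)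
    then show ?thesis using D by simp
  next
    case 2
    have "\<zeta>' = \<zeta>"
    proof (rule isotonic_eq_isotonic_imp_center_eq[OF open_I nonempty_I \<zeta>])
      show "1 / \<mu>\<^sup>2 * ((x - \<zeta>) ^ 4 + D) / (x - \<zeta>) ^ 3 = \<kappa> * ((x - \<zeta>') ^ 4 + D') / (x - \<zeta>') ^ 3" if "x \<in> I" for x
        using 2 \<rho>[OF that] that by (simp add: isotonic_pair_def)
    qed (use \<mu> D 2 in \<open>auto simp: isotonic_pair_def\<close>)
    have pos: "A * ((x - \<zeta>) ^ 4 + D) > 0" if x: "x \<in> I" for x
    proof -
      have "x - \<zeta> \<noteq> 0" using x \<zeta> by auto
      moreover have "1 / \<mu>\<^sup>2 * ((x - \<zeta>) ^ 4 + D) / (x - \<zeta>) ^ 3 = \<kappa> * ((x - \<zeta>) ^ 4 + D') / (x - \<zeta>) ^ 3"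
        using 2 \<rho>[OF x] x \<open>\<zeta>' = \<zeta>\<close> by (simp add: isotonic_pair_def)
      ultimately have "1 / \<mu>\<^sup>2 * ((x - \<zeta>) ^ 4 + D) = \<kappa> * ((x - \<zeta>) ^ 4 + D')"
        by (metis divide_cancel_right power_not_zero)
      then have "(x - \<zeta>) ^ 4 + D = \<mu>\<^sup>2 * \<kappa> * ((x - \<zeta>) ^ 4 + D')" using \<mu> by (simp add: field_simps)
      then have "A * ((x - \<zeta>) ^ 4 + D) = \<mu>\<^sup>2 * \<kappa> * (A * ((x - \<zeta>) ^ 4 + D'))" by simp
      moreover have "A * ((x - \<zeta>) ^ 4 + D') > 0" "\<kappa> > 0" using 2 x \<open>\<zeta>' = \<zeta>\<close> by (auto simp: isotonic_pair_def)
      moreover have "\<mu>\<^sup>2 > 0" using \<mu> by simp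
      ultimately show ?thesis by (simp only: mult_pos_pos)
    qed
    moreover from this have "A \<noteq> 0" using nonempty_I by force
    moreover have "\<forall>z\<in>I. \<Psi> z = A / (z - \<zeta>) ^ 3" using 2 \<open>\<zeta>' = \<zeta>\<close> by (simp add: isotonic_pair_def)
    ultimately show ?thesis by blast
  qed
next
  assume "\<exists>A. A \<noteq> 0 \<and> (\<forall>z\<in>I. A * ((z - \<zeta>) ^ 4 + D) > 0) \<and> (\<forall>z\<in>I. \<Psi> z = A / (z - \<zeta>) ^ 3)"
  then show "closing I \<rho> \<Psi>"
    using rational_form_pair[OF rf] closing_iff_pair[OF \<Psi>] by blast
qed

lemma card_closing_classes_if_rational_form:
  assumes rf: "rational_form I \<rho> D \<mu> \<zeta>"
  shows "card (closing_classes I \<rho>) = 1"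
proof -
  have \<mu>: "\<mu> > 0" and \<zeta>: "\<zeta> \<notin> I" and \<rho>: "\<And>z. z \<in> I \<Longrightarrow> \<rho> z = ((z - \<zeta>) ^ 4 + D) / (\<mu>\<^sup>2 * (z - \<zeta>) ^ 3)"
    using rf by (auto simp: rational_form_def)
  have nz: "(z - \<zeta>) ^ 4 + D \<noteq> 0" if "z \<in> I" for z using \<rho>[OF that] \<rho>_nonzero[OF that] by auto
  have cont: "continuous_on I (\<lambda>z. (z - \<zeta>) ^ 4 + D)" by (intro continuous_intros)
  obtain s :: real where s: "s = 1 \<or> s = -1" "\<And>z. z \<in> I \<Longrightarrow> s * ((z - \<zeta>) ^ 4 + D) > 0"
    using connected_imp_constant_sign[OF connected_I cont nz] by blast
  define P where "P = (\<lambda>z. s / (z - \<zeta>) ^ 3)"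
  have smooth: "C_infinity_on I P"
    unfolding P_def by (rule C_infinity_on_inverse_power[OF open_I \<zeta>])
  have "closing I \<rho> P"
    unfolding closing_iff_if_rational_form[OF rf smooth]
    by (rule exI[of _ s]) (use s in \<open>auto simp: P_def\<close>)
  moreover have "(P, \<Psi>) \<in> pos_proportional I" if sm: "C_infinity_on I \<Psi>" and cl: "closing I \<rho> \<Psi>" for \<Psi>
  proof -
    obtain A where A: "A \<noteq> 0" "\<forall>z\<in>I. A * ((z - \<zeta>) ^ 4 + D) > 0" "\<forall>z\<in>I. \<Psi> z = A / (z - \<zeta>) ^ 3"
      using cl unfolding closing_iff_if_rational_form[OF rf sm] by blast
    obtain x where x: "x \<in> I" using nonempty_I by blast
    have "s * A > 0"
      using A(2)[rule_format, OF x] s(2)[OF x] s(1) by (auto simp: zero_less_mult_iff)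
    then show ?thesis using A(3) s(1) by (auto simp: pos_proportional_def P_def intro!: exI[of _ "s * A"])
  qed
  ultimately have "closing_classes I \<rho> = (\<lambda>p. pos_proportional I `` {p}) ` {P}"
    using smooth by (intro closing_classes_eq) auto
  then show ?thesis by simp
qed

text \<open>The split of isotonic pairs is by \<open>D\<close>: for \<open>D = 0\<close> the force
  is linear, for \<open>D \<noteq> 0\<close> it has the rational form with
  \<open>\<mu> = 1 / sqrt \<kappa>\<close>.\<close>

lemma closing_imp_special_form:
  assumes "C_infinity_on I \<Psi>" "closing I \<rho> \<Psi>"
  shows "(\<exists>k. const_deriv_form I \<rho> k) \<or> (\<exists>D \<mu> \<zeta>. rational_form I \<rho> D \<mu> \<zeta>)"
proof -
  consider k A e where "harmonic_pair I \<rho> \<Psi> k A e" | \<kappa> A \<zeta> D where "isotonic_pair I \<rho> \<Psi> \<kappa> A \<zeta> D"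
    using closing_iff_pair[OF assms(1)] assms(2) by blast
  then show ?thesis
  proof cases
    case 1
    then have "const_deriv_form I \<rho> k"
      by (intro const_deriv_form_if_linear[of k e]) (auto simp: harmonic_pair_def)
    then show ?thesis by blast
  next
    case 2
    then have \<kappa>: "\<kappa> > 0" and \<zeta>: "\<zeta> \<notin> I"
      and \<rho>: "\<And>x. x \<in> I \<Longrightarrow> \<rho> x = \<kappa> * ((x - \<zeta>) ^ 4 + D) / (x - \<zeta>) ^ 3"
      by (auto simp: isotonic_pair_def)
    show ?thesis
    proof (cases "D = 0")
      case True
      have "\<rho> x = \<kappa> * x + (- \<kappa> * \<zeta>)" if x: "x \<in> I" for x
      proof -
        have "x - \<zeta> \<noteq> 0" using x \<zeta> by auto
        then have "\<rho> x = \<kappa> * (x - \<zeta>)"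
          unfolding \<rho>[OF x] True by (rule isotonic_force_without_singular_part)
        then show ?thesis by (simp add: algebra_simps)
      qed
      then show ?thesis using const_deriv_form_if_linear[OF \<kappa>] by blast
    next
      case False
      have "rational_form I \<rho> D (1 / sqrt \<kappa>) \<zeta>"
        using False \<kappa> \<zeta> \<rho> by (auto simp: rational_form_def power_divide)
      then show ?thesis by blast
    qed
  qed
qed

lemma card_closing_classes_le: "finite (closing_classes I \<rho>) \<and> card (closing_classes I \<rho>) \<le> 2"
proof (cases "closing_classes I \<rho> = {}")
  case False
  then obtain \<Psi> where "C_infinity_on I \<Psi>" "closing I \<rho> \<Psi>" by (auto simp: closing_classes_def quotient_def)
  then consider k where "const_deriv_form I \<rho> k" | D \<mu> \<zeta> where "rational_form I \<rho> D \<mu> \<zeta>"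
    using closing_imp_special_form by blast
  then have "card (closing_classes I \<rho>) = 2 \<or> card (closing_classes I \<rho>) = 1"
    using card_closing_classes_if_const_deriv_form card_closing_classes_if_rational_form by cases auto
  \<comment> \<open>Positivity matters because \<open>card\<close> is 0 on infinite sets; a positive
    value gives finiteness.\<close>
  then have "card (closing_classes I \<rho>) > 0" "card (closing_classes I \<rho>) \<le> 2" by auto
  then show ?thesis using card_ge_0_finite by blast
qed simp

lemma const_deriv_form_periods_and_equilibria:
  assumes cd: "const_deriv_form I \<rho> k" and i: "i \<in> {1, 2::nat}" and smooth: "C_infinity_on I \<Psi>"
    and A: "A \<noteq> 0" "\<forall>z\<in>I. A * \<rho> z ^ i > 0" "\<forall>z\<in>I. \<Psi> z = A / \<rho> z ^ (i\<^sup>2 - 1)"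
  shows "all_periods_equal I \<rho> \<Psi> (2 * pi / (real i * sqrt k)) \<and>
    (\<forall>z\<in>I. nondeg_stable_exactly_at I \<rho> \<Psi> {sqrt (A / \<rho> z ^ (i\<^sup>2)), - sqrt (A / \<rho> z ^ (i\<^sup>2))} z)"
proof -
  interpret smooth_oscillator I \<rho> \<Psi> by (rule smooth_oscillatorI[OF smooth])
  have k: "k > 0" using cd by (simp add: const_deriv_form_def)
  have quot: "\<Psi> z / \<rho> z = A / \<rho> z ^ (i\<^sup>2)" if "z \<in> I" for z
    using i A(3) that by (auto simp: eval_nat_numeral)
  have *: "all_periods_equal I \<rho> \<Psi> (2 * pi / (real i * sqrt k)) \<and> (\<forall>z\<in>I. \<rho> z * \<Psi> z > 0) \<and> (\<forall>z\<in>I. freq2 z > 0)"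
  proof (cases "i = 1")
    case True
    then obtain e where h: "harmonic_pair I \<rho> \<Psi> k A e"
      using const_deriv_form_pairs(1)[OF cd A(1), of \<Psi>] A by auto
    show ?thesis
      using harmonic_pair_periods[OF h] harmonic_pair_freq2[OF h] h True
      by (auto simp: harmonic_pair_def mult.commute)
  next
    case False
    then have "i = 2" using i by simp
    then obtain \<zeta> where h: "isotonic_pair I \<rho> \<Psi> k (A / k ^ 3) \<zeta> 0"
      using const_deriv_form_pairs(2)[OF cd A(1), of \<Psi>] A by auto
    show ?thesis
      using isotonic_pair_periods[OF h] isotonic_pair_freq2[OF h] isotonic_pair_product_pos[OF h] k \<open>i = 2\<close>
      by simp
  qed
  show ?thesis
  proof (intro conjI ballI)
    show "nondeg_stable_exactly_at I \<rho> \<Psi> {sqrt (A / \<rho> z ^ (i\<^sup>2)), - sqrt (A / \<rho> z ^ (i\<^sup>2))} z" if "z \<in> I" for z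
      using nondeg_stable_exactly_at_sqrt[OF that] * that unfolding quot[OF that] by blast
  qed (use * in blast)
qed

lemma rational_form_periods_and_equilibria:
  assumes rf: "rational_form I \<rho> D \<mu> \<zeta>" and smooth: "C_infinity_on I \<Psi>"
    and A: "\<forall>z\<in>I. A * ((z - \<zeta>) ^ 4 + D) > 0" "\<forall>z\<in>I. \<Psi> z = A / (z - \<zeta>) ^ 3"
  shows "all_periods_equal I \<rho> \<Psi> (pi * \<mu>) \<and>
    (\<forall>z\<in>I. nondeg_stable_exactly_at I \<rho> \<Psi>
       {\<mu> * sqrt (A / ((z - \<zeta>) ^ 4 + D)), - (\<mu> * sqrt (A / ((z - \<zeta>) ^ 4 + D)))} z)"
proof -
  interpret smooth_oscillator I \<rho> \<Psi> by (rule smooth_oscillatorI[OF smooth])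
  have \<mu>: "\<mu> > 0" and \<zeta>: "\<zeta> \<notin> I" and \<rho>: "\<And>z. z \<in> I \<Longrightarrow> \<rho> z = ((z - \<zeta>) ^ 4 + D) / (\<mu>\<^sup>2 * (z - \<zeta>) ^ 3)"
    using rf by (auto simp: rational_form_def)
  note h = rational_form_pair[OF rf A]
  have "pi / sqrt (1 / \<mu>\<^sup>2) = pi * \<mu>" using \<mu> by (simp add: real_sqrt_divide)
  then have "all_periods_equal I \<rho> \<Psi> (pi * \<mu>)" using isotonic_pair_periods[OF h] by simp
  moreover have "nondeg_stable_exactly_at I \<rho> \<Psi>
       {\<mu> * sqrt (A / ((z - \<zeta>) ^ 4 + D)), - (\<mu> * sqrt (A / ((z - \<zeta>) ^ 4 + D)))} z" if z: "z \<in> I" for z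
  proof -
    have u: "z - \<zeta> \<noteq> 0" using z \<zeta> by auto
    have "\<Psi> z / \<rho> z = \<mu>\<^sup>2 * (A / ((z - \<zeta>) ^ 4 + D))"
      using A(2) z u by (simp add: \<rho>[OF z])
    then have "sqrt (\<Psi> z / \<rho> z) = \<mu> * sqrt (A / ((z - \<zeta>) ^ 4 + D))"
      using \<mu> by (simp only: real_sqrt_mult) simp
    moreover have "freq2 z > 0" using isotonic_pair_freq2[OF h z] \<mu> by simp
    ultimately show ?thesis
      using nondeg_stable_exactly_at_sqrt[OF z isotonic_pair_product_pos[OF h z]] by simp
  qed
  ultimately show ?thesis by blast
qed

end

section \<open>Assembly of the classification on an open, possibly unbounded interval\<close>

theorem mainTheorem4:
  fixes a b :: ereal and I :: "real set" and \<rho> :: "real \<Rightarrow> real"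
  assumes "a < b"
    and I_def: "I = einterval a b"
    and "C_infinity_on I \<rho>"
  shows
    "(\<forall>\<Psi>. C_infinity_on I \<Psi> \<longrightarrow>
        semilocally_closing I \<rho> \<Psi> \<or> closing I \<rho> \<Psi> \<or> strongly_closing I \<rho> \<Psi> \<or> weakly_closing I \<rho> \<Psi> \<longrightarrow>
        locally_closing I \<rho> \<Psi>)
   \<and> ((\<forall>z\<in>I. \<rho> z \<noteq> 0) \<longrightarrow>
        (\<forall>\<Psi>. C_infinity_on I \<Psi> \<longrightarrow>
            (closing I \<rho> \<Psi> \<longleftrightarrow> semilocally_closing I \<rho> \<Psi>) \<and>
            (closing I \<rho> \<Psi> \<longleftrightarrow> locally_closing I \<rho> \<Psi>) \<and>
            (closing I \<rho> \<Psi> \<longleftrightarrow> strongly_closing I \<rho> \<Psi>) \<and>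
            (closing I \<rho> \<Psi> \<longleftrightarrow> weakly_closing I \<rho> \<Psi>))
      \<and> finite (closing_classes I \<rho>) \<and> card (closing_classes I \<rho>) \<le> 2
      \<and> (\<forall>k. const_deriv_form I \<rho> k \<longrightarrow>
            card (closing_classes I \<rho>) = 2
          \<and> (\<forall>\<Psi>. C_infinity_on I \<Psi> \<longrightarrow>
               (closing I \<rho> \<Psi> \<longleftrightarrow>
                 (\<exists>i\<in>{1, 2::nat}. \<exists>A. A \<noteq> 0 \<and> (\<forall>z\<in>I. A * \<rho> z ^ i > 0) \<and>
                    (\<forall>z\<in>I. \<Psi> z = A / \<rho> z ^ (i\<^sup>2 - 1)))))
          \<and> (\<forall>i\<in>{1, 2::nat}. \<forall>A \<Psi>. C_infinity_on I \<Psi> \<and> A \<noteq> 0 \<and> (\<forall>z\<in>I. A * \<rho> z ^ i > 0) \<and>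
               (\<forall>z\<in>I. \<Psi> z = A / \<rho> z ^ (i\<^sup>2 - 1)) \<longrightarrow>
               all_periods_equal I \<rho> \<Psi> (2 * pi / (real i * sqrt k)) \<and>
               (\<forall>z\<in>I. nondeg_stable_exactly_at I \<rho> \<Psi>
                        {sqrt (A / \<rho> z ^ (i\<^sup>2)), - sqrt (A / \<rho> z ^ (i\<^sup>2))} z)))
      \<and> (\<forall>D \<mu> \<zeta>. rational_form I \<rho> D \<mu> \<zeta> \<longrightarrow>
            card (closing_classes I \<rho>) = 1
          \<and> (\<forall>\<Psi>. C_infinity_on I \<Psi> \<longrightarrow>
               (closing I \<rho> \<Psi> \<longleftrightarrow>
                 (\<exists>A. A \<noteq> 0 \<and> (\<forall>z\<in>I. A * ((z - \<zeta>) ^ 4 + D) > 0) \<and>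
                    (\<forall>z\<in>I. \<Psi> z = A / (z - \<zeta>) ^ 3))))
          \<and> (\<forall>A \<Psi>. C_infinity_on I \<Psi> \<and> A \<noteq> 0 \<and> (\<forall>z\<in>I. A * ((z - \<zeta>) ^ 4 + D) > 0) \<and>
               (\<forall>z\<in>I. \<Psi> z = A / (z - \<zeta>) ^ 3) \<longrightarrow>
               all_periods_equal I \<rho> \<Psi> (pi * \<mu>) \<and>
               (\<forall>z\<in>I. nondeg_stable_exactly_at I \<rho> \<Psi>
                        {\<mu> * sqrt (A / ((z - \<zeta>) ^ 4 + D)), - (\<mu> * sqrt (A / ((z - \<zeta>) ^ 4 + D)))} z)))
      \<and> ((\<nexists>k. const_deriv_form I \<rho> k) \<and> (\<nexists>D \<mu> \<zeta>. rational_form I \<rho> D \<mu> \<zeta>) \<longrightarrow>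
            (\<forall>\<Psi>. C_infinity_on I \<Psi> \<longrightarrow> \<not> closing I \<rho> \<Psi>)))"
proof -
  have openI: "open I" and nonempty: "I \<noteq> {}"
    using einterval_nonempty[OF assms(1)] unfolding I_def by auto
  have connected: "connected I"
    unfolding I_def
    by (intro is_interval_connected)
       (metis einterval_iff ereal_less_eq(3) is_interval_1 le_less_trans less_le_trans)
  have osc: "smooth_oscillator I \<rho> \<Psi>" if "C_infinity_on I \<Psi>" for \<Psi>
    using that openI connected assms(3) by (simp add: smooth_oscillator_def)
  have loc: "locally_closing I \<rho> \<Psi>"
    if \<Psi>: "C_infinity_on I \<Psi>"
      and cl: "semilocally_closing I \<rho> \<Psi> \<or> closing I \<rho> \<Psi> \<or> strongly_closing I \<rho> \<Psi> \<or> weakly_closing I \<rho> \<Psi>" for \<Psi>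
    using cl closing_imp_semilocally_closing
      smooth_oscillator.semilocally_closing_imp_locally_closing[OF osc[OF \<Psi>]]
      smooth_oscillator.strongly_closing_imp_locally_closing[OF osc[OF \<Psi>] _ nonempty]
      smooth_oscillator.weakly_closing_imp_locally_closing[OF osc[OF \<Psi>] _ nonempty]
    by blast
  show ?thesis
  proof (rule conjI, goal_cases)
    case 1
    show ?case using loc by blast
  next
    case 2
    show ?case
    proof (rule impI, goal_cases)
      case 1
      then interpret smooth_restoring_force I \<rho>
        using openI connected nonempty assms(3) by unfold_locales auto
      note iff = smooth_oscillator.closing_notions_iff_pair[OF osc \<rho>_nonzero nonempty_I]
      show ?case
      proof (intro conjI allI impI)
        fix \<Psi> assume \<Psi>: "C_infinity_on I \<Psi>"
        show "closing I \<rho> \<Psi> \<longleftrightarrow> semilocally_closing I \<rho> \<Psi>" "closing I \<rho> \<Psi> \<longleftrightarrow> locally_closing I \<rho> \<Psi>"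
          "closing I \<rho> \<Psi> \<longleftrightarrow> strongly_closing I \<rho> \<Psi>" "closing I \<rho> \<Psi> \<longleftrightarrow> weakly_closing I \<rho> \<Psi>"
          using iff[OF \<Psi>] by simp_all
      next
        show "finite (closing_classes I \<rho>)" "card (closing_classes I \<rho>) \<le> 2"
          using card_closing_classes_le by simp_all
      next
        fix k assume cd: "const_deriv_form I \<rho> k"
        show "card (closing_classes I \<rho>) = 2" by (rule card_closing_classes_if_const_deriv_form[OF cd])
      next
        fix k \<Psi> assume "const_deriv_form I \<rho> k" "C_infinity_on I \<Psi>"
        then show "closing I \<rho> \<Psi> \<longleftrightarrow> (\<exists>i\<in>{1, 2::nat}. \<exists>A. A \<noteq> 0 \<and> (\<forall>z\<in>I. A * \<rho> z ^ i > 0) \<and>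
                      (\<forall>z\<in>I. \<Psi> z = A / \<rho> z ^ (i\<^sup>2 - 1)))"
          by (rule closing_iff_if_const_deriv_form)
      next
        fix k assume cd: "const_deriv_form I \<rho> k"
        show "\<forall>i\<in>{1, 2::nat}. \<forall>A \<Psi>. C_infinity_on I \<Psi> \<and> A \<noteq> 0 \<and> (\<forall>z\<in>I. A * \<rho> z ^ i > 0) \<and>
                 (\<forall>z\<in>I. \<Psi> z = A / \<rho> z ^ (i\<^sup>2 - 1)) \<longrightarrow>
                 all_periods_equal I \<rho> \<Psi> (2 * pi / (real i * sqrt k)) \<and>
                 (\<forall>z\<in>I. nondeg_stable_exactly_at I \<rho> \<Psi>
                          {sqrt (A / \<rho> z ^ (i\<^sup>2)), - sqrt (A / \<rho> z ^ (i\<^sup>2))} z)"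
          by (intro ballI allI impI, elim conjE) (rule const_deriv_form_periods_and_equilibria[OF cd])
      next
        fix D \<mu> \<zeta> assume rf: "rational_form I \<rho> D \<mu> \<zeta>"
        show "card (closing_classes I \<rho>) = 1" by (rule card_closing_classes_if_rational_form[OF rf])
      next
        fix D \<mu> \<zeta> \<Psi> assume "rational_form I \<rho> D \<mu> \<zeta>" "C_infinity_on I \<Psi>"
        then show "closing I \<rho> \<Psi> \<longleftrightarrow> (\<exists>A. A \<noteq> 0 \<and> (\<forall>z\<in>I. A * ((z - \<zeta>) ^ 4 + D) > 0) \<and>
                      (\<forall>z\<in>I. \<Psi> z = A / (z - \<zeta>) ^ 3))"
          by (rule closing_iff_if_rational_form)
      next
        fix D \<mu> \<zeta> A \<Psi> assume rf: "rational_form I \<rho> D \<mu> \<zeta>"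
          and "C_infinity_on I \<Psi> \<and> A \<noteq> 0 \<and> (\<forall>z\<in>I. A * ((z - \<zeta>) ^ 4 + D) > 0) \<and> (\<forall>z\<in>I. \<Psi> z = A / (z - \<zeta>) ^ 3)"
        then have "C_infinity_on I \<Psi>" "\<forall>z\<in>I. A * ((z - \<zeta>) ^ 4 + D) > 0" "\<forall>z\<in>I. \<Psi> z = A / (z - \<zeta>) ^ 3"
          by blast+
        note * = rational_form_periods_and_equilibria[OF rf this]
        show "all_periods_equal I \<rho> \<Psi> (pi * \<mu>)" using * by blast
        show "\<forall>z\<in>I. nondeg_stable_exactly_at I \<rho> \<Psi>
            {\<mu> * sqrt (A / ((z - \<zeta>) ^ 4 + D)), - (\<mu> * sqrt (A / ((z - \<zeta>) ^ 4 + D)))} z" using * by blast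
      next
        fix \<Psi> assume "(\<nexists>k. const_deriv_form I \<rho> k) \<and> (\<nexists>D \<mu> \<zeta>. rational_form I \<rho> D \<mu> \<zeta>)" "C_infinity_on I \<Psi>"
        then show "\<not> closing I \<rho> \<Psi>" using closing_imp_special_form by blast
      qed
    qed
  qed
qed

end
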